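(* Let $n\ge1$ and consider the full dynamic model of a quadrotor with a payload suspended by a chain of $n$ links, with states $x\in\mathbb{R}^3$, $R\in\mathsf{SO}(3)$, $q_i\in\mathsf{S}^2$, $\Omega\in\mathbb{R}^3$, $\omega_i\in\mathbb{R}^3$ with $q_i\cdot\omega_i=0$: $$M_{00}\ddot x+\sum_{i=1}^nM_{0i}\ddot q_i=-fRe_3+M_{00}ge_3,$$ $$M_{ii}\ddot q_i-\hat q_i^2\Big(M_{i0}\ddot x+\sum_{j=1,\,j\neq i}^nM_{ij}\ddot q_j\Big)=-M_{ii}\|\dot q_i\|^2q_i-\sum_{a=i}^nm_agl_i\hat q_i^2e_3\quad(1\le i\le n),$$ $$J\dot\Omega+\hat\Omega J\Omega=M,\qquad \dot R=R\hat\Omega,\qquad \dot q_i=\omega_i\times q_i.$$ Let $x_d\in\mathbb{R}^3$ be a fixed desired location. Let $$A=-K_x\mathbf{x}-K_{\dot x}\dot{\mathbf{x}}-M_{00}ge_3\in\mathbb{R}^3,$$ where $\mathbf{x}$, $\dot{\mathbf x}$ and the gains $K_x,K_{\dot x}$ (which asymptotically stabilize the linearized simplified dynamics) are as specified in the context, and let the control inputs be $$f=-A\cdot Re_3,$$ $$M=-\frac{k_R}{\epsilon^2}e_R-\frac{k_\Omega}{\epsilon}e_\Omega+\Omega\times J\Omega-J\big(\hat\Omega R^TR_c\Omega_c-R^TR_c\dot\Omega_c\big),$$ where $\epsilon,k_R,k_\Omega$ are positive constants and $R_c,\Omega_c,e_R,e_\Omega$ are as defined in the context. Then there exists $\epsilon^\star>0$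 such that for all $0<\epsilon<\epsilon^\star$ the desired equilibrium ($x=x_d$, $\dot x=0$, $q_i=e_3$ and $\omega_i=0$ for all $i$, $R=R_c$, $\Omega=0$) of the closed-loop system is exponentially stable.
   Context: Notation. $e_1,e_2,e_3$ is the standard basis of $\mathbb{R}^3$; $e_3$ is the direction of gravity and $g$ the gravitational acceleration. $\mathsf{SO}(3)=\{R\in\mathbb{R}^{3\times3}:R^TR=I_3,\det R=1\}$, $\mathsf{S}^2=\{q\in\mathbb{R}^3:\|q\|=1\}$. The hat map $\hat\cdot:\mathbb{R}^3\to\mathfrak{so}(3)$ is defined by $\hat xy=x\times y$; its inverse is the vee map $\vee$. $C=[e_1,e_2]\in\mathbb{R}^{3\times2}$, and $I_{3\times 2}=[e_1,e_2]$. System parameters. $m>0$ and $J\in\mathbb{R}^{3\times3}$ (symmetric positive definite) are the quadrotor's mass and inertia matrix; $m_i>0$, $l_i>0$ are the mass and length of the $i$-th link. $M_{00}=m+\sum_{i=1}^nm_i$, $M_{0i}=M_{i0}=\sum_{a=i}^nm_al_i$, $M_{ij}=\big(\sum_{a=\max\{i,j\}}^nm_a\big)l_il_j$ for $1\le i,j\le n$. The inputs are $f\in\mathbb{R}$ (thrust magnitude) and $M\in\mathbb{R}^3$ (moment). State vector and gains. $$\mathbf{x}=[\,x-x_d;\ C^T(e_3\times q_1);\dots;C^T(e_3\times q_n)]\in\mathbb{R}^{3+2n},\qquad \dot{\mathbf{x}}=[\,\dot x;\ C^T\omega_1;\dots;C^T\omega_n]\in\mathbb{R}^{3+2n}$$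 (here $\dot{\mathbf x}$ is the name of the second vector). The gains are $K_x=[k_xI_3,k_{q_1}I_{3\times2},\dots,k_{q_n}I_{3\times2}]$ and $K_{\dot x}=[k_{\dot x}I_3,k_{\omega_1}I_{3\times2},\dots,k_{\omega_n}I_{3\times2}]$ in $\mathbb{R}^{3\times(3+2n)}$, with real constants $k_x,k_{\dot x},k_{q_i},k_{\omega_i}$ chosen so that the origin of the linear system $$\mathbf{M}\ddot{\mathbf z}+\mathbf{G}\mathbf z=\mathbf{B}\,(-K_x\mathbf z-K_{\dot x}\dot{\mathbf z}),\qquad \mathbf z\in\mathbb{R}^{3+2n},$$ is asymptotically stable, where $$\mathbf M=\begin{bmatrix}\mathbf M_{xx}&\mathbf M_{xq}\\ \mathbf M_{xq}^T&\mathbf M_{qq}\end{bmatrix},\quad \mathbf G=\begin{bmatrix}0_3&0_{3\times2n}\\0_{2n\times3}&\mathbf G_{qq}\end{bmatrix},\quad \mathbf B=\begin{bmatrix}I_3\\0_{2n\times3}\end{bmatrix},$$ $\mathbf M_{xx}=M_{00}I_3$, $\mathbf M_{xq}=[-M_{01}\hat e_3C,\dots,-M_{0n}\hat e_3C]$, $\mathbf M_{qq}$ is the $2n\times2n$ matrix with $(i,j)$ block $M_{ij}I_2$, and $\mathbf G_{qq}=\mathrm{diag}\big[\sum_{a=1}^nm_agl_1I_2,\ \sum_{a=2}^nm_agl_2I_2,\dots,m_ngl_nI_2\big]$. (This is the linearization about the hanging equilibrium of the model in which $-fRe_3$ is replaced by a free input $u\in\mathbb{R}^3$.) Desired attitude.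 $b_{3_c}=-A/\|A\|$. Given a constant desired first body axis direction $b_{1_d}\in\mathsf{S}^2$, assumed not parallel to $b_{3_c}$ (at the desired equilibrium $b_{3_c}=e_3$), set $$R_c=\Big[-\frac{\hat b_{3_c}^2b_{1_d}}{\|\hat b_{3_c}^2b_{1_d}\|},\ \frac{\hat b_{3_c}b_{1_d}}{\|\hat b_{3_c}b_{1_d}\|},\ b_{3_c}\Big]\in\mathsf{SO}(3),\qquad \Omega_c=(R_c^T\dot R_c)^\vee,$$ time derivatives being taken along the closed-loop trajectories. Error variables: $e_R=\frac12(R_c^TR-R^TR_c)^\vee$, $e_\Omega=\Omega-R^TR_c\Omega_c$. *)

theory Defs
  imports "HOL-Analysis.Analysis"
begin

section \<open>Stability of equilibria\<close>

text \<open>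
  A dynamical system is given by a predicate \<open>sol T \<phi>\<close>: the curve \<open>\<phi>\<close> is a trajectory on the
  time interval \<open>T\<close>, which starts at 0.
\<close>

definition asymptotically_stable ::
    "(real set \<Rightarrow> (real \<Rightarrow> 's) \<Rightarrow> bool) \<Rightarrow> 's::metric_space \<Rightarrow> bool" where
  "asymptotically_stable sol e \<longleftrightarrow>
     (\<forall>\<eta>>0. \<exists>\<delta>>0. \<forall>\<phi>. sol {0..} \<phi> \<longrightarrow> dist (\<phi> 0) e < \<delta> \<longrightarrow> (\<forall>t\<ge>0. dist (\<phi> t) e < \<eta>)) \<and>
     (\<exists>\<delta>>0. \<forall>\<phi>. sol {0..} \<phi> \<longrightarrow> dist (\<phi> 0) e < \<delta> \<longrightarrow> (\<phi> \<longlongrightarrow> e) at_top)"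

text \<open>
  Exponential stability relative to the set \<open>S\<close> of admissible states. Every admissible state near
  \<open>e\<close> is the start of a trajectory that exists for all future time, and every trajectory starting
  there obeys the exponential bound as long as it exists. Taking \<open>s = e\<close>, the constant curve \<open>e\<close> is
  the only trajectory from \<open>e\<close>, so \<open>e\<close> is an equilibrium.
\<close>

definition exponentially_stable ::
    "'s set \<Rightarrow> (real set \<Rightarrow> (real \<Rightarrow> 's) \<Rightarrow> bool) \<Rightarrow> 's::metric_space \<Rightarrow> bool" where
  "exponentially_stable S sol e \<longleftrightarrow> e \<in> S \<and>
     (\<exists>\<delta>>0. \<exists>c>0. \<exists>\<gamma>>0. \<forall>s\<in>S. dist s e < \<delta> \<longrightarrow>
        (\<exists>\<phi>. sol {0..} \<phi> \<and> \<phi> 0 = s) \<and>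
        (\<forall>T \<phi>. (T = {0..} \<or> (\<exists>b>0. T = {0..<b})) \<longrightarrow> sol T \<phi> \<longrightarrow> \<phi> 0 = s \<longrightarrow>
           (\<forall>t\<in>T. dist (\<phi> t) e \<le> c * dist s e * exp (- \<gamma> * t))))"


section \<open>Vectors and matrices in dimension three\<close>

abbreviation e3 :: "real^3" where "e3 \<equiv> axis 3 1"

definition hat :: "real^3 \<Rightarrow> real^3^3" where
  "hat x = matrix (cross3 x)"

text \<open>Only the values on skew-symmetric matrices matter.\<close>

definition vee :: "real^3^3 \<Rightarrow> real^3" where
  "vee S = vector [S$3$2, S$1$3, S$2$1]"

lemma hat_mult: "hat x *v y = cross3 x y"
proof -
  have "linear (cross3 x)"
    using bilinear_cross by (simp add: bilinear_def)
  then show ?thesis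
    by (simp add: hat_def matrix_works)
qed

lemma hat_components:
  "hat x = vector [vector [0, - x$3, x$2], vector [x$3, 0, - x$1], vector [- x$2, x$1, 0]]"
  by (simp add: hat_def matrix_def cross3_def vec_eq_iff forall_3 axis_def)

lemma vee_hat: "vee (hat x) = x"
  by (simp add: vee_def hat_components vec_eq_iff forall_3)

lemma hat_vee:
  assumes "transpose S = - S"
  shows "hat (vee S) = S"
proof -
  have S: "S$j$i = - S$i$j" for i j
    using arg_cong[OF assms, of "\<lambda>A. A$i$j"] by (simp add: transpose_def)
  have "S$i$i = 0" for i
    using S[of i i] by simp
  with S[of 1 2] S[of 1 3] S[of 2 3] show ?thesis
    by (simp add: vee_def hat_components vec_eq_iff forall_3)
qed

text \<open>The matrix with columns \<open>e\<^sub>1, e\<^sub>2\<close>, that is, both \<open>C\<close> and \<open>I\<^sub>3\<^sub>\<times>\<^sub>2\<close>.\<close>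

definition C32 :: "real^2^3" where
  "C32 = transpose (vector [axis 1 1, axis 2 1])"


section \<open>The quadrotor with a chain of links\<close>

text \<open>
  The links are indexed by a finite linearly ordered type \<open>'n\<close>, which stands for \<open>{1, ..., n}\<close>
  with \<open>n = CARD('n)\<close>, the least index being the link attached to the quadrotor; so
  \<open>\<Sum>a\<in>{i..}\<close> is the sum over \<open>a = i, ..., n\<close>.
\<close>

record 'n quadrotor =
  mass :: real
  inertia :: "real^3^3"
  link_mass :: "'n \<Rightarrow> real"
  link_length :: "'n \<Rightarrow> real"
  gravity :: real

record 'n controller =
  k_x :: real
  k_v :: real
  k_q :: "'n \<Rightarrow> real"
  k_w :: "'n \<Rightarrow> real"
  k_R :: real
  k_Om :: real
  target :: "real^3"
  heading :: "real^3"

definition M00 :: "'n::{finite,linorder} quadrotor \<Rightarrow> real" where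
  "M00 P = mass P + (\<Sum>i\<in>UNIV. link_mass P i)"

definition M0 :: "'n::{finite,linorder} quadrotor \<Rightarrow> 'n \<Rightarrow> real" where
  "M0 P i = (\<Sum>a\<in>{i..}. link_mass P a * link_length P i)"

definition Mij :: "'n::{finite,linorder} quadrotor \<Rightarrow> 'n \<Rightarrow> 'n \<Rightarrow> real" where
  "Mij P i j = (\<Sum>a\<in>{max i j..}. link_mass P a) * link_length P i * link_length P j"

definition Gi :: "'n::{finite,linorder} quadrotor \<Rightarrow> 'n \<Rightarrow> real" where
  "Gi P i = (\<Sum>a\<in>{i..}. link_mass P a * gravity P * link_length P i)"

text \<open>States \<open>(x, v, q, w, R, Om)\<close> with \<open>v\<close> the velocity of the quadrotor.\<close>

type_synonym 'n state =
  "(real^3) \<times> (real^3) \<times> ((real^3, 'n) vec) \<times> ((real^3, 'n) vec) \<times> (real^3^3) \<times> (real^3)"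

definition states :: "'n::finite state set" where
  "states = {(x, v, q, w, R, Om).
     (\<forall>i. norm (q$i) = 1 \<and> q$i \<bullet> w$i = 0) \<and> rotation_matrix R}"

definition full_dynamics ::
    "'n::{finite,linorder} quadrotor \<Rightarrow> (real \<Rightarrow> real) \<Rightarrow> (real \<Rightarrow> real^3) \<Rightarrow>
     real set \<Rightarrow> (real \<Rightarrow> 'n state) \<Rightarrow> bool" where
  "full_dynamics P f M T \<phi> \<longleftrightarrow> (\<exists>x x' x'' q q' q'' w R Om Om'. \<forall>t\<in>T.
     \<phi> t = (x t, x' t, q t, w t, R t, Om t) \<and>
     \<phi> t \<in> states \<and>
     (x has_vector_derivative x' t) (at t within T) \<and>
     (x' has_vector_derivative x'' t) (at t within T) \<and>
     (q has_vector_derivative q' t) (at t within T) \<and>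
     (q' has_vector_derivative q'' t) (at t within T) \<and>
     (R has_vector_derivative R t ** hat (Om t)) (at t within T) \<and>
     (Om has_vector_derivative Om' t) (at t within T) \<and>
     (\<forall>i. q' t $ i = cross3 (w t $ i) (q t $ i)) \<and>
     M00 P *\<^sub>R x'' t + (\<Sum>i\<in>UNIV. M0 P i *\<^sub>R q'' t $ i)
       = - (f t *\<^sub>R (R t *v e3)) + (M00 P * gravity P) *\<^sub>R e3 \<and>
     (\<forall>i. Mij P i i *\<^sub>R q'' t $ i
           - (hat (q t $ i) ** hat (q t $ i)) *v
               (M0 P i *\<^sub>R x'' t + (\<Sum>j\<in>UNIV - {i}. Mij P i j *\<^sub>R q'' t $ j))
         = - ((Mij P i i * (norm (q' t $ i))\<^sup>2) *\<^sub>R q t $ i)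
           - Gi P i *\<^sub>R ((hat (q t $ i) ** hat (q t $ i)) *v e3)) \<and>
     inertia P *v Om' t + hat (Om t) *v (inertia P *v Om t) = M t)"


section \<open>Linearization of the simplified dynamics\<close>

text \<open>
  The index type \<open>3 + 'n \<times> 2\<close> stands for \<open>{1, ..., 3 + 2n}\<close>: first the three components of the
  position part, then for each link \<open>i\<close> the two components of its block.
\<close>

definition block_vector :: "real^3 \<Rightarrow> ('n::finite \<Rightarrow> real^2) \<Rightarrow> real^(3 + 'n \<times> 2)" where
  "block_vector y p = (\<chi> k. case k of Inl a \<Rightarrow> y$a | Inr (i, b) \<Rightarrow> p i $ b)"

definition block_row :: "real^3^3 \<Rightarrow> ('n::finite \<Rightarrow> real^2^3) \<Rightarrow> real^(3 + 'n \<times> 2)^3" where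
  "block_row X Y = (\<chi> r. block_vector (X$r) (\<lambda>i. Y i $ r))"

definition block_matrix ::
    "real^3^3 \<Rightarrow> ('n::finite \<Rightarrow> real^2^3) \<Rightarrow> ('n \<Rightarrow> real^3^2) \<Rightarrow> ('n \<Rightarrow> 'n \<Rightarrow> real^2^2) \<Rightarrow>
     real^(3 + 'n \<times> 2)^(3 + 'n \<times> 2)" where
  "block_matrix X Y Z W = (\<chi> k. case k of
       Inl a \<Rightarrow> block_vector (X$a) (\<lambda>j. Y j $ a)
     | Inr (i, a) \<Rightarrow> block_vector (Z i $ a) (\<lambda>j. W i j $ a))"

definition mass_matrix ::
    "'n::{finite,linorder} quadrotor \<Rightarrow> real^(3 + 'n \<times> 2)^(3 + 'n \<times> 2)" where
  "mass_matrix P = block_matrix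
     (M00 P *\<^sub>R mat 1)
     (\<lambda>j. - (M0 P j *\<^sub>R (hat e3 ** C32)))
     (\<lambda>i. transpose (- (M0 P i *\<^sub>R (hat e3 ** C32))))
     (\<lambda>i j. Mij P i j *\<^sub>R mat 1)"

definition gravity_matrix ::
    "'n::{finite,linorder} quadrotor \<Rightarrow> real^(3 + 'n \<times> 2)^(3 + 'n \<times> 2)" where
  "gravity_matrix P = block_matrix 0 (\<lambda>j. 0) (\<lambda>i. 0)
     (\<lambda>i j. if i = j then Gi P i *\<^sub>R mat 1 else 0)"

definition input_matrix :: "real^3^(3 + 'n::finite \<times> 2)" where
  "input_matrix = transpose (block_row (mat 1) (\<lambda>i. 0))"

definition Kx :: "'n::finite controller \<Rightarrow> real^(3 + 'n \<times> 2)^3" where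
  "Kx K = block_row (k_x K *\<^sub>R mat 1) (\<lambda>i. k_q K i *\<^sub>R C32)"

definition Kv :: "'n::finite controller \<Rightarrow> real^(3 + 'n \<times> 2)^3" where
  "Kv K = block_row (k_v K *\<^sub>R mat 1) (\<lambda>i. k_w K i *\<^sub>R C32)"

text \<open>The trajectories \<open>(z, z')\<close> of the linear system under the linear feedback.\<close>

definition linearized_dynamics ::
    "'n::{finite,linorder} quadrotor \<Rightarrow> 'n controller \<Rightarrow> real set \<Rightarrow>
     (real \<Rightarrow> (real^(3 + 'n \<times> 2)) \<times> (real^(3 + 'n \<times> 2))) \<Rightarrow> bool" where
  "linearized_dynamics P K T \<phi> \<longleftrightarrow> (\<exists>z z' z''. \<forall>t\<in>T.
     \<phi> t = (z t, z' t) \<and>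
     (z has_vector_derivative z' t) (at t within T) \<and>
     (z' has_vector_derivative z'' t) (at t within T) \<and>
     mass_matrix P *v z'' t + gravity_matrix P *v z t
       = input_matrix *v (- (Kx K *v z t) - Kv K *v z' t))"


section \<open>The controller\<close>

definition virtual_force ::
    "'n::{finite,linorder} quadrotor \<Rightarrow> 'n controller \<Rightarrow> 'n state \<Rightarrow> real^3" where
  "virtual_force P K = (\<lambda>(x, v, q, w, R, Om).
     - (Kx K *v block_vector (x - target K) (\<lambda>i. transpose C32 *v cross3 e3 (q$i)))
     - Kv K *v block_vector v (\<lambda>i. transpose C32 *v w$i)
     - (M00 P * gravity P) *\<^sub>R e3)"

definition b3c :: "'n::{finite,linorder} quadrotor \<Rightarrow> 'n controller \<Rightarrow> 'n state \<Rightarrow> real^3" where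
  "b3c P K s = - (virtual_force P K s /\<^sub>R norm (virtual_force P K s))"

definition Rc :: "'n::{finite,linorder} quadrotor \<Rightarrow> 'n controller \<Rightarrow> 'n state \<Rightarrow> real^3^3" where
  "Rc P K s =
    (let b = b3c P K s; u = hat b *v heading K; u2 = (hat b ** hat b) *v heading K
     in transpose (vector [- (u2 /\<^sub>R norm u2), u /\<^sub>R norm u, b]))"

definition thrust :: "'n::{finite,linorder} quadrotor \<Rightarrow> 'n controller \<Rightarrow> 'n state \<Rightarrow> real" where
  "thrust P K = (\<lambda>(x, v, q, w, R, Om). - (virtual_force P K (x, v, q, w, R, Om) \<bullet> (R *v e3)))"

definition e_R :: "real^3^3 \<Rightarrow> real^3^3 \<Rightarrow> real^3" where
  "e_R Rd R = (1/2) *\<^sub>R vee (transpose Rd ** R - transpose R ** Rd)"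

definition e_Om :: "real^3^3 \<Rightarrow> real^3 \<Rightarrow> real^3^3 \<Rightarrow> real^3 \<Rightarrow> real^3" where
  "e_Om Rd Omd R Om = Om - (transpose R ** Rd) *v Omd"

text \<open>\<open>Omd\<close> and \<open>Omd'\<close> are the values of \<open>\<Omega>\<^sub>c\<close> and of its time derivative.\<close>

definition moment ::
    "'n::{finite,linorder} quadrotor \<Rightarrow> 'n controller \<Rightarrow> real \<Rightarrow> real^3 \<Rightarrow> real^3 \<Rightarrow> 'n state \<Rightarrow> real^3"
  where
  "moment P K \<epsilon> Omd Omd' = (\<lambda>(x, v, q, w, R, Om).
    (let Rd = Rc P K (x, v, q, w, R, Om); J = inertia P
     in - ((k_R K / \<epsilon>\<^sup>2) *\<^sub>R e_R Rd R)
        - (k_Om K / \<epsilon>) *\<^sub>R e_Om Rd Omd R Om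
        + cross3 Om (J *v Om)
        - J *v (hat Om *v ((transpose R ** Rd) *v Omd) - (transpose R ** Rd) *v Omd')))"

text \<open>
  The feedback contains time derivatives along the trajectory itself, so the closed loop is
  described by its trajectories. Along them, the commanded attitude has to be well defined and
  the derivatives have to exist.
\<close>

definition closed_loop ::
    "'n::{finite,linorder} quadrotor \<Rightarrow> 'n controller \<Rightarrow> real \<Rightarrow> real set \<Rightarrow> (real \<Rightarrow> 'n state) \<Rightarrow> bool"
  where
  "closed_loop P K \<epsilon> T \<phi> \<longleftrightarrow> (\<exists>Rc' Omc Omc'.
     (\<forall>t\<in>T.
        virtual_force P K (\<phi> t) \<noteq> 0 \<and>
        \<not> collinear {0, heading K, b3c P K (\<phi> t)} \<and>
        ((\<lambda>s. Rc P K (\<phi> s)) has_vector_derivative Rc' t) (at t within T) \<and>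
        Omc t = vee (transpose (Rc P K (\<phi> t)) ** Rc' t) \<and>
        (Omc has_vector_derivative Omc' t) (at t within T)) \<and>
     full_dynamics P (\<lambda>t. thrust P K (\<phi> t)) (\<lambda>t. moment P K \<epsilon> (Omc t) (Omc' t) (\<phi> t)) T \<phi>)"

text \<open>The commanded attitude does not depend on the last two components of the state.\<close>

definition desired_equilibrium ::
    "'n::{finite,linorder} quadrotor \<Rightarrow> 'n controller \<Rightarrow> 'n state" where
  "desired_equilibrium P K =
    (target K, 0, (\<chi> i. e3), 0, Rc P K (target K, 0, (\<chi> i. e3), 0, mat 1, 0), 0)"

end

theory Submission
  imports Defs
begin

text \<open>
  Let \<open>Q = R\<^sub>c\<^sup>T R\<close> and \<open>e = e\<^sub>\<Omega>\<close>. The moment cancels all terms coming from the motion of \<open>R\<^sub>c\<close>, so that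
  \<open>Q' = Q hat e\<close> and \<open>J e' = - (k\<^sub>R / \<epsilon>\<^sup>2) e\<^sub>R - (k\<^sub>\<Omega> / \<epsilon>) e\<close>: the attitude error is autonomous, and the
  closed loop is a cascade in which it drives the position and the links. This makes a singular
  perturbation argument superfluous, and every \<open>\<epsilon> > 0\<close> works. To first order the attitude error is
  a damped oscillator with an explicit quadratic Lyapunov function. The errors of the position and
  of the links obey the linearized simplified dynamics, up to second order terms and a term bounded
  by the attitude error; the converse Lyapunov theorem for linear systems provides a quadratic
  Lyapunov function for them. A weighted sum of both functions decays exponentially along every
  trajectory near the equilibrium.

  In the coordinates \<open>(x, v, q, w, Q, e)\<close> the closed loop is a locally Lipschitz differential equation
  not containing derivatives of the commanded attitude. Picard iteration for a globally Lipschitz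
  extension yields a solution for all time, and the decay estimate keeps it in the region where the
  extension agrees with the original equation.
\<close>

section \<open>Ordinary differential equations and quadratic Lyapunov functions\<close>

text \<open>The moment contains the derivative of \<open>Omc\<close>, hence derivatives of the
  accelerations, which solve a linear system and are not given by a formula. Every estimate
  therefore uses variables in which this derivative cancels; for the return to the original system
  only its existence is needed, and it follows from solving a differentiable, uniformly coercive
  linear system. Recovering \<open>Om\<close> from the angular velocity error is not circular,
  because the accelerations, and with them \<open>Omc\<close>, depend on the attitude but not on
  \<open>Om\<close>. The Lyapunov variables measure the distance to the equilibrium only locally and
  only on the constraint set: \<open>e_R\<close> also vanishes at half turns, and the link errors
  record two of three components, which does not tell a hanging link from an inverted one. The
  differential equation, in contrast, is solved in the full linear space. So the accelerations are
  defined and Lipschitz on a ball that ignores the constraints, the constraints are recovered as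
  first integrals, and first-exit arguments confine the trajectories to the ball.\<close>

lemma gronwall_differential:
  fixes g g' :: "real \<Rightarrow> real"
  assumes "0 \<le> b"
    and der: "\<And>t. t \<in> {0..b} \<Longrightarrow> (g has_real_derivative g' t) (at t within {0..b})"
    and le: "\<And>t. t \<in> {0..b} \<Longrightarrow> g' t \<le> k * g t"
  shows "g b \<le> g 0 * exp (k * b)"
proof (cases "b = 0")
  case False
  with \<open>0 \<le> b\<close> have "0 < b" by simp
  \<comment> \<open>The integrating factor turns the inequality into \<open>h' \<le> 0\<close>, and
    the mean value theorem compares \<open>h b\<close> with \<open>h 0\<close>. A negative
    \<open>k\<close> gives exponential decay.\<close>
  define h where "h t = g t * exp (- k * t)" for t
  have dh: "(h has_derivative (\<lambda>d. d * ((g' t - k * g t) * exp (- k * t)))) (at t within {0..b})"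
    if "t \<in> {0..b}" for t
  proof -
    have "(h has_real_derivative (g' t - k * g t) * exp (- k * t)) (at t within {0..b})"
      unfolding h_def by (rule derivative_eq_intros der that refl)+ (simp add: algebra_simps)
    then show ?thesis
      by (simp add: has_field_derivative_def mult.commute[of "_ * exp _"] mult_commute_abs)
  qed
  obtain c where c: "c \<in> {0<..<b}" and eq: "h b - h 0 = (b - 0) * ((g' c - k * g c) * exp (- k * c))"
    using mvt_simple[OF \<open>0 < b\<close> dh] by auto
  have "b * ((g' c - k * g c) * exp (- k * c)) \<le> 0"
    using c le[of c] \<open>0 < b\<close> by (simp add: mult_le_0_iff)
  with eq have "h b \<le> h 0" by simp
  then have "h b * exp (k * b) \<le> h 0 * exp (k * b)" by simp
  then show ?thesis by (simp add: h_def mult.assoc exp_add[symmetric])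
qed simp

lemma integral_has_vector_derivative_atLeast:
  fixes f :: "real \<Rightarrow> 'a::banach"
  assumes "continuous_on {0..} f" "0 \<le> t"
  shows "((\<lambda>u. integral {0..u} f) has_vector_derivative f t) (at t within {0..})"
proof -
  have "((\<lambda>u. integral {0..u} f) has_vector_derivative f t) (at t within {0..t+1})"
    by (rule integral_has_vector_derivative) (use assms in \<open>auto intro: continuous_on_subset\<close>)
  \<comment> \<open>Derivatives are local, so the bounded interval used for the integral may be
    exchanged for the half-line, also at the endpoint 0.\<close>
  moreover have "at t within {0..t+1} = at t within {0..}"
    by (rule at_within_nhd[where S="{..<t+1}"]) auto
  ultimately show ?thesis by simp
qed

text \<open>Integration preserves the growth rate \<open>l\<close> and gains a factor
  \<open>1 / l\<close>. This gain makes the Picard operator contract in the weighted norm.\<close>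

lemma norm_integral_le_exp:
  fixes f :: "real \<Rightarrow> 'a::banach"
  assumes cont: "continuous_on {0..t} f" and "0 \<le> t" "0 < l" "0 \<le> C"
    and bound: "\<And>u. u \<in> {0..t} \<Longrightarrow> norm (f u) \<le> C * exp (l * u)"
  shows "norm (integral {0..t} f) \<le> C / l * exp (l * t)"
proof -
  have I: "((\<lambda>u. C * exp (l * u)) has_integral (C / l * exp (l * t) - C / l * exp (l * 0))) {0..t}"
    by (rule fundamental_theorem_of_calculus[OF \<open>0 \<le> t\<close>])
      (use \<open>0 < l\<close> in \<open>auto intro!: derivative_eq_intros
        simp: has_real_derivative_iff_has_vector_derivative[symmetric]\<close>)
  have "norm (integral {0..t} f) \<le> integral {0..t} (\<lambda>u. C * exp (l * u))"
    by (rule integral_norm_bound_integral) (use I bound cont integrable_continuous_real in auto)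
  also have "\<dots> \<le> C / l * exp (l * t)"
    using integral_unique[OF I] assms(3,4) by simp
  finally show ?thesis .
qed

text \<open>The Picard operator is a contraction for the norm \<open>sup\<^sub>t exp (- l * t) * norm (\<phi> t)\<close> once
  \<open>l > L\<close>; the fixed point \<open>g\<close> below is the solution multiplied by this weight.\<close>

lemma lipschitz_global_solution:
  fixes F :: "'a::banach \<Rightarrow> 'a"
  assumes lip: "L-lipschitz_on UNIV F"
  obtains \<phi> where "\<phi> 0 = s"
    "\<And>t. 0 \<le> t \<Longrightarrow> (\<phi> has_vector_derivative F (\<phi> t)) (at t within {0..})"
proof -
  \<comment> \<open>Any \<open>l > L\<close> gives the contraction factor \<open>L / l < 1\<close>;
    adding 1 also keeps \<open>l\<close> positive when \<open>L = 0\<close>.\<close>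
  define l where "l = L + 1"
  have L: "0 \<le> L" using lip lipschitz_on_nonneg by blast
  then have l: "0 < l" "L / l < 1" "L \<le> l" by (auto simp: l_def)
  have FL: "norm (F x - F y) \<le> L * norm (x - y)" for x y
    using lipschitz_on_normD[OF lip] by simp
  have F: "continuous_on X F" for X
    using lipschitz_on_continuous_on[OF lip] continuous_on_subset by blast
  define I where "I g t = integral {0..t} (\<lambda>u. F (exp (l * u) *\<^sub>R apply_bcontfun g u))"
    for g :: "real \<Rightarrow>\<^sub>C 'a" and t
  have contF: "continuous_on X (\<lambda>u. F (exp (l * u) *\<^sub>R apply_bcontfun g u))" for g :: "real \<Rightarrow>\<^sub>C 'a" and X
    by (rule continuous_on_compose2[OF F[of UNIV]]) (auto intro!: continuous_intros)
  have Ider: "(I g has_vector_derivative F (exp (l * t) *\<^sub>R apply_bcontfun g t)) (at t within {0..})"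
    if "0 \<le> t" for g t
    unfolding I_def using integral_has_vector_derivative_atLeast[OF contF that] .
  have Icont: "continuous_on {0..} (I g)" for g
    using Ider has_vector_derivative_continuous continuous_on_eq_continuous_within
    by (metis atLeast_iff)
  \<comment> \<open>Bounded continuous functions live on the whole real line; \<open>max 0 t\<close>
    extends the weighted iterate by its value at 0 to negative times.\<close>
  define T where "T g t = exp (- l * max 0 t) *\<^sub>R (s + I g (max 0 t))" for g t
  have T: "T g \<in> bcontfun" for g
  proof -
    define C where "C = norm (F 0) + L * norm g"
    have C: "0 \<le> C" using L by (simp add: C_def)
    have b: "norm (F (exp (l * u) *\<^sub>R apply_bcontfun g u)) \<le> C * exp (l * u)" if "0 \<le> u" for u
    proof -
      have "norm (F (exp (l * u) *\<^sub>R apply_bcontfun g u))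
          \<le> norm (F 0) + norm (F (exp (l * u) *\<^sub>R apply_bcontfun g u) - F 0)"
        by (metis add.commute diff_add_cancel norm_triangle_ineq)
      also have "\<dots> \<le> norm (F 0) * 1 + L * (exp (l * u) * norm (apply_bcontfun g u))"
        using FL[of "exp (l * u) *\<^sub>R apply_bcontfun g u" 0] by simp
      also have "\<dots> \<le> norm (F 0) * exp (l * u) + L * (exp (l * u) * norm g)"
        using that l L norm_bounded[of g u] by (intro add_mono mult_left_mono) auto
      finally show ?thesis by (simp add: C_def algebra_simps)
    qed
    have "norm (T g t) \<le> norm s + C / l" for t
    proof -
      define r where "r = max 0 t"
      have r: "0 \<le> r" by (simp add: r_def)
      have "norm (I g r) \<le> C / l * exp (l * r)"
        unfolding I_def by (rule norm_integral_le_exp[OF contF r l(1) C]) (use b in auto)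
      then have "exp (- l * r) * norm (I g r) \<le> exp (- l * r) * (C / l * exp (l * r))"
        by (intro mult_left_mono) auto
      then have "exp (- l * r) * norm (I g r) \<le> C / l"
        by (simp add: exp_minus field_simps)
      moreover have "exp (- l * r) * norm s \<le> 1 * norm s"
        using r l by (intro mult_right_mono) auto
      moreover have "norm (T g t) \<le> exp (- l * r) * (norm s + norm (I g r))"
        unfolding T_def r_def[symmetric] by (simp add: norm_triangle_ineq)
      ultimately show ?thesis by (simp add: algebra_simps)
    qed
    moreover have "continuous_on UNIV (T g)"
      unfolding T_def
      by (intro continuous_intros continuous_on_compose2[OF Icont]) auto
    ultimately show ?thesis by (intro bcontfun_normI)
  qed
  have Tapply: "apply_bcontfun (Bcontfun (T g)) = T g" for g
    using T by (simp add: Bcontfun_inverse)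
  have contr: "dist (Bcontfun (T g)) (Bcontfun (T h)) \<le> L / l * dist g h" for g h
  proof (rule dist_bound)
    fix t :: real
    define r where "r = max 0 t"
    have r: "0 \<le> r" by (simp add: r_def)
    define D where "D u = F (exp (l * u) *\<^sub>R apply_bcontfun g u) - F (exp (l * u) *\<^sub>R apply_bcontfun h u)" for u
    have "norm (D u) \<le> L * dist g h * exp (l * u)" for u
    proof -
      have "norm (D u) \<le> L * norm (exp (l * u) *\<^sub>R apply_bcontfun g u - exp (l * u) *\<^sub>R apply_bcontfun h u)"
        unfolding D_def by (rule FL)
      also have "\<dots> = L * (exp (l * u) * dist (apply_bcontfun g u) (apply_bcontfun h u))"
        by (simp add: dist_norm scaleR_diff_right[symmetric])
      also have "\<dots> \<le> L * (exp (l * u) * dist g h)"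
        using L dist_bounded[of g u h] by (intro mult_left_mono) auto
      finally show ?thesis by (simp add: algebra_simps)
    qed
    then have "norm (integral {0..r} D) \<le> (L * dist g h) / l * exp (l * r)"
      using L r l by (intro norm_integral_le_exp) (auto simp: D_def intro!: continuous_intros contF)
    moreover have "I g r - I h r = integral {0..r} D"
      unfolding I_def D_def
      by (rule integral_diff[symmetric]) (auto intro!: integrable_continuous_real contF)
    ultimately have "exp (- l * r) * norm (I g r - I h r) \<le> exp (- l * r) * ((L * dist g h) / l * exp (l * r))"
      by (intro mult_left_mono) auto
    also have "\<dots> = L / l * dist g h" by (simp add: exp_minus field_simps)
    finally show "dist (apply_bcontfun (Bcontfun (T g)) t) (apply_bcontfun (Bcontfun (T h)) t) \<le> L / l * dist g h"
      unfolding Tapply T_def r_def[symmetric] dist_norm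
      by (simp add: scaleR_diff_right[symmetric])
  qed
  then obtain g where g: "Bcontfun (T g) = g"
    using banach_fix_type[of "L / l" "\<lambda>g. Bcontfun (T g)"] L l by auto
  define \<phi> where "\<phi> t = exp (l * t) *\<^sub>R apply_bcontfun g t" for t
  have \<phi>: "\<phi> t = s + I g t" if "0 \<le> t" for t
  proof -
    have "apply_bcontfun g t = T g t" using g Tapply by metis
    then show ?thesis
      using that by (simp add: \<phi>_def T_def exp_minus)
  qed
  show thesis
  proof
    show "\<phi> 0 = s" using \<phi>[of 0] by (simp add: I_def)
    fix t :: real assume t: "0 \<le> t"
    have "((\<lambda>t. s + I g t) has_vector_derivative F (\<phi> t)) (at t within {0..})"
      unfolding \<phi>_def using Ider[OF t] has_vector_derivative_add[OF has_vector_derivative_const] by fastforce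
    then show "(\<phi> has_vector_derivative F (\<phi> t)) (at t within {0..})"
      by (rule has_vector_derivative_transform[rotated 2]) (use t \<phi> in auto)
  qed
qed

text \<open>Homogeneity reduces the claim to the unit sphere, where compactness provides a minimum
  \<open>B z z\<close>, positive because \<open>z\<close> is not 0.\<close>

lemma bilinear_form_coercive:
  fixes B :: "'a::euclidean_space \<Rightarrow> 'a \<Rightarrow> real"
  assumes B: "bounded_bilinear B" and pos: "\<And>x. x \<noteq> 0 \<Longrightarrow> 0 < B x x"
  obtains c where "0 < c" "\<And>x. c * (norm x)\<^sup>2 \<le> B x x"
proof (cases "sphere (0::'a) 1 = {}")
  case True
  have "x = 0" for x :: 'a
  proof (rule ccontr)
    assume "x \<noteq> 0"
    then have "x /\<^sub>R norm x \<in> sphere 0 1" by simp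
    with True show False by blast
  qed
  then have "1 * (norm x)\<^sup>2 \<le> B x x" for x
    using bounded_bilinear.zero_left[OF B, of 0] by (metis mult_zero_right norm_zero order_refl zero_power2)
  then show ?thesis by (rule that[OF zero_less_one])
next
  case False
  have "continuous_on (sphere 0 1) (\<lambda>x. B x x)"
    by (intro bounded_bilinear.continuous_on[OF B] continuous_intros)
  then obtain z where z: "z \<in> sphere 0 1" "\<And>x. x \<in> sphere 0 1 \<Longrightarrow> B z z \<le> B x x"
    using continuous_attains_inf[OF compact_sphere False] by blast
  have "B z z * (norm x)\<^sup>2 \<le> B x x" for x
  proof (cases "x = 0")
    case False
    have "B z z \<le> B (x /\<^sub>R norm x) (x /\<^sub>R norm x)" by (rule z) (use False in simp)
    also have "\<dots> = B x x / (norm x)\<^sup>2"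
      by (simp add: bounded_bilinear.scaleR_left[OF B] bounded_bilinear.scaleR_right[OF B]
          power2_eq_square divide_inverse)
    finally show ?thesis using False by (simp add: field_simps)
  qed (simp add: bounded_bilinear.zero_left[OF B])
  moreover have "B z z > 0" using z(1) by (intro pos) auto
  ultimately show ?thesis by (rule that[rotated])
qed

text \<open>Converse Lyapunov theorem: the form is \<open>B x y = \<integral>\<^sub>0\<^sup>T \<Phi> t x \<bullet> \<Phi> t y\<close> for the flow \<open>\<Phi>\<close> and a
  time \<open>T\<close> at which the flow has halved all norms.\<close>

lemma linear_lyapunov_form:
  fixes L :: "'a::euclidean_space \<Rightarrow> 'a"
  assumes lin: "bounded_linear L"
    and conv: "\<And>\<phi>. (\<And>t. 0 \<le> t \<Longrightarrow> (\<phi> has_vector_derivative L (\<phi> t)) (at t within {0..})) \<Longrightarrow>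
      (\<phi> \<longlongrightarrow> 0) at_top"
  obtains B :: "'a \<Rightarrow> 'a \<Rightarrow> real" and c where "bounded_bilinear B" "\<And>x y. B x y = B y x" "0 < c"
    "\<And>x. c * (norm x)\<^sup>2 \<le> B x x" "\<And>x. 2 * B x (L x) \<le> - (norm x)\<^sup>2 / 2"
proof -
  interpret L: bounded_linear L by fact
  obtain K where K: "K > 0" "\<And>x. norm (L x) \<le> norm x * K" using L.pos_bounded by auto
  define sol where "sol \<phi> \<longleftrightarrow> (\<forall>t\<ge>0. (\<phi> has_vector_derivative L (\<phi> t)) (at t within {0..}))"
    for \<phi> :: "real \<Rightarrow> 'a"
  have "K-lipschitz_on UNIV L"
    by (rule lipschitz_onI) (use K in \<open>auto simp: dist_norm L.diff[symmetric] mult.commute less_imp_le\<close>)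
  then have ex: "\<exists>\<phi>. \<phi> 0 = x \<and> sol \<phi>" for x
    using lipschitz_global_solution[of K L x] unfolding sol_def by metis
  \<comment> \<open>By linearity, uniqueness reduces to the initial value 0, and there Gronwall's
    inequality for the squared norm forces the solution to vanish. The algebraic properties of the
    flow below are instances of this uniqueness.\<close>
  have zero: "\<phi> t = 0" if sol: "sol \<phi>" and "\<phi> 0 = 0" "0 \<le> t" for \<phi> t
  proof -
    have "\<phi> t \<bullet> \<phi> t \<le> (\<phi> 0 \<bullet> \<phi> 0) * exp ((2 * K) * t)"
    proof (rule gronwall_differential[OF \<open>0 \<le> t\<close>])
      fix u assume u: "u \<in> {0..t}"
      then have d: "(\<phi> has_vector_derivative L (\<phi> u)) (at u within {0..t})"
        using sol has_vector_derivative_within_subset[of \<phi> _ u "{0..}" "{0..t}"]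
        unfolding sol_def by auto
      show "((\<lambda>u. \<phi> u \<bullet> \<phi> u) has_real_derivative (2 * (\<phi> u \<bullet> L (\<phi> u)))) (at u within {0..t})"
        unfolding has_real_derivative_iff_has_vector_derivative
        using bounded_bilinear.has_vector_derivative[OF bounded_bilinear_inner d d]
        by (simp add: inner_commute)
      have "\<phi> u \<bullet> L (\<phi> u) \<le> norm (\<phi> u) * (norm (\<phi> u) * K)"
        by (rule order_trans[OF norm_cauchy_schwarz]) (simp add: K mult_left_mono)
      then show "2 * (\<phi> u \<bullet> L (\<phi> u)) \<le> 2 * K * (\<phi> u \<bullet> \<phi> u)"
        by (simp add: power2_norm_eq_inner[symmetric] power2_eq_square algebra_simps)
    qed
    then show ?thesis using \<open>\<phi> 0 = 0\<close> inner_ge_zero[of "\<phi> t"] by (simp add: order_antisym)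
  qed
  define \<Phi> where "\<Phi> x = (SOME \<phi>. \<phi> 0 = x \<and> sol \<phi>)" for x
  have \<Phi>0: "\<Phi> x 0 = x" and \<Phi>: "sol (\<Phi> x)" for x
    using someI_ex[OF ex[of x]] unfolding \<Phi>_def by auto
  have uniq: "\<phi> t = \<Phi> (\<phi> 0) t" if "sol \<phi>" "0 \<le> t" for \<phi> t
  proof -
    have "sol (\<lambda>t. \<phi> t - \<Phi> (\<phi> 0) t)"
      using that(1) \<Phi>[of "\<phi> 0"] unfolding sol_def by (auto simp: L.diff intro!: derivative_intros)
    from zero[OF this _ that(2)] show ?thesis by (simp add: \<Phi>0)
  qed
  have \<Phi>add: "\<Phi> (x + y) t = \<Phi> x t + \<Phi> y t" if "0 \<le> t" for x y t
  proof -
    have "sol (\<lambda>t. \<Phi> x t + \<Phi> y t)"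
      using \<Phi>[of x] \<Phi>[of y] unfolding sol_def by (auto simp: L.add intro!: derivative_intros)
    from uniq[OF this that] show ?thesis by (simp add: \<Phi>0)
  qed
  have \<Phi>scale: "\<Phi> (r *\<^sub>R x) t = r *\<^sub>R \<Phi> x t" if "0 \<le> t" for r x t
  proof -
    have "sol (\<lambda>t. r *\<^sub>R \<Phi> x t)"
      using \<Phi>[of x] unfolding sol_def by (auto simp: L.scaleR intro!: derivative_eq_intros)
    from uniq[OF this that] show ?thesis by (simp add: \<Phi>0)
  qed
  \<comment> \<open>\<open>L\<close> maps solutions to solutions, so the flow commutes with
    \<open>L\<close>. This expresses the time derivative of the flow by a change of the initial
    value.\<close>
  have \<Phi>L: "\<Phi> (L x) t = L (\<Phi> x t)" if "0 \<le> t" for x t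
  proof -
    have "sol (\<lambda>t. L (\<Phi> x t))"
      using \<Phi>[of x] unfolding sol_def by (auto intro!: L.has_vector_derivative)
    from uniq[OF this that] show ?thesis by (simp add: \<Phi>0)
  qed
  have \<Phi>lin: "linear (\<lambda>x. \<Phi> x t)" if "0 \<le> t" for t
    by (rule linearI) (use that \<Phi>add \<Phi>scale in auto)
  have \<Phi>cont: "continuous_on {0..t} (\<Phi> x)" for x t
  proof -
    have "continuous_on {0..} (\<Phi> x)"
      using \<Phi>[of x] has_vector_derivative_continuous continuous_on_eq_continuous_within
      unfolding sol_def by (metis atLeast_iff)
    then show ?thesis by (rule continuous_on_subset) auto
  qed
  obtain T where T: "0 < T" "\<And>x. norm (\<Phi> x T) \<le> norm x / 2"
  proof -
    \<comment> \<open>Each of the \<open>DIM('a)\<close> basis vectors contributes at most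
      \<open>norm x * e\<close> to \<open>\<Phi> x T\<close>, hence all of them together at most
      \<open>norm x / 2\<close>.\<close>
    define e where "e = 1 / (2 * real DIM('a))"
    have e: "e > 0" by (simp add: e_def)
    have "\<forall>\<^sub>F t in at_top. \<forall>b\<in>Basis. norm (\<Phi> b t) < e"
    proof (rule eventually_ball_finite)
      show "\<forall>b\<in>Basis. \<forall>\<^sub>F t in at_top. norm (\<Phi> b t) < e"
        using conv[of "\<Phi> _"] \<Phi> e tendstoD[of "\<Phi> _" 0 at_top e] unfolding sol_def by auto
    qed auto
    from eventually_conj[OF this eventually_gt_at_top[of 0]]
    obtain T where T: "T > 0" "\<And>b. b \<in> Basis \<Longrightarrow> norm (\<Phi> b T) < e"
      unfolding eventually_at_top_linorder by auto
    have "norm (\<Phi> x T) \<le> norm x / 2" for x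
    proof -
      have "\<Phi> x T = \<Phi> (\<Sum>b\<in>Basis. (x \<bullet> b) *\<^sub>R b) T" by (simp add: euclidean_representation)
      also have "\<dots> = (\<Sum>b\<in>Basis. (x \<bullet> b) *\<^sub>R \<Phi> b T)"
        unfolding linear_sum[OF \<Phi>lin[OF less_imp_le[OF T(1)]]] \<Phi>scale[OF less_imp_le[OF T(1)]] ..
      also have "norm \<dots> \<le> (\<Sum>b\<in>(Basis::'a set). norm x * e)"
      proof (rule sum_norm_le)
        fix b :: 'a assume "b \<in> Basis"
        then show "norm ((x \<bullet> b) *\<^sub>R \<Phi> b T) \<le> norm x * e"
          using T(2)[of b] Basis_le_norm[of b x] by (auto intro!: mult_mono simp: less_imp_le)
      qed
      also have "\<dots> = norm x / 2" by (simp add: e_def)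
      finally show ?thesis .
    qed
    with T(1) show thesis by (rule that)
  qed
  define B where "B x y = integral {0..T} (\<lambda>t. \<Phi> x t \<bullet> \<Phi> y t)" for x y
  have int: "(\<lambda>t. \<Phi> x t \<bullet> \<Phi> y t) integrable_on {0..T}" for x y
    by (intro integrable_continuous_real continuous_intros \<Phi>cont)
  have Bsym: "B x y = B y x" for x y by (simp add: B_def inner_commute)
  have Badd: "B (x + y) z = B x z + B y z" for x y z
    unfolding B_def by (subst integral_add[symmetric, OF int int])
      (auto intro!: integral_cong simp: \<Phi>add inner_add_left)
  have Bscale: "B (r *\<^sub>R x) z = r *\<^sub>R B x z" for r x z
  proof -
    have "B (r *\<^sub>R x) z = integral {0..T} (\<lambda>t. r *\<^sub>R (\<Phi> x t \<bullet> \<Phi> z t))"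
      unfolding B_def by (rule integral_cong) (simp add: \<Phi>scale)
    then show ?thesis by (simp add: B_def)
  qed
  have Blin: "linear (\<lambda>x. B x z)" for z
    by (intro linearI Badd Bscale)
  have "linear (\<lambda>y. B x y)" for x
  proof -
    have "(\<lambda>y. B x y) = (\<lambda>y. B y x)" by (rule ext) (rule Bsym)
    then show ?thesis using Blin[of x] by (rule ssubst[where P=linear])
  qed
  then have bil: "bilinear B"
    unfolding bilinear_def by (intro conjI allI Blin)
  then have bb: "bounded_bilinear B" by (simp add: bilinear_conv_bounded_bilinear)
  have Bpos: "B x x > 0" if "x \<noteq> 0" for x
  proof -
    \<comment> \<open>A continuous nonnegative integrand with integral 0 vanishes everywhere, in
      particular at time 0, where it equals \<open>x \<bullet> x\<close>.\<close>
    have "B x x \<noteq> 0"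
    proof
      assume "B x x = 0"
      then have "((\<lambda>t. \<Phi> x t \<bullet> \<Phi> x t) has_integral 0) {0..T}"
        using int[of x x] by (simp add: B_def has_integral_integral)
      then have int0: "((\<lambda>t. \<Phi> x t \<bullet> \<Phi> x t) has_integral 0) (cbox 0 T)" by simp
      have cont: "continuous_on (cbox 0 T) (\<lambda>t. \<Phi> x t \<bullet> \<Phi> x t)"
        unfolding cbox_interval by (intro continuous_intros \<Phi>cont)
      have mem: "T / 2 \<in> box 0 T" "0 \<in> cbox 0 T"
        using T(1) unfolding box_real cbox_interval by simp_all
      then have ne: "box 0 T \<noteq> {}" by blast
      have "\<Phi> x 0 \<bullet> \<Phi> x 0 = 0"
        by (rule has_integral_0_cbox_imp_0[OF cont inner_ge_zero int0 ne mem(2)])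
      then have "x \<bullet> x = 0" unfolding \<Phi>0 .
      with that show False by simp
    qed
    moreover have "B x x \<ge> 0" unfolding B_def by (rule integral_nonneg[OF int]) auto
    ultimately show ?thesis by simp
  qed
  obtain c where c: "c > 0" "\<And>x. c * (norm x)\<^sup>2 \<le> B x x"
  proof (rule bilinear_form_coercive[OF bb])
    show "0 < B x x" if "x \<noteq> 0" for x using that by (rule Bpos)
  qed (rule that)
  \<comment> \<open>The integrand of \<open>2 * B x (L x)\<close> is the derivative of the squared
    norm of the flow, so the integral is the difference of its values at \<open>T\<close> and 0.
    Halved norms at time \<open>T\<close> make it at most -3/4 of the squared norm of
    \<open>x\<close>.\<close>
  have "2 * B x (L x) \<le> - (norm x)\<^sup>2 / 2" for x
  proof -
    have "((\<lambda>t. 2 * (\<Phi> x t \<bullet> \<Phi> (L x) t)) has_integral (\<Phi> x T \<bullet> \<Phi> x T - \<Phi> x 0 \<bullet> \<Phi> x 0)) {0..T}"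
    proof (rule fundamental_theorem_of_calculus)
      fix u assume u: "u \<in> {0..T}"
      then have d: "(\<Phi> x has_vector_derivative L (\<Phi> x u)) (at u within {0..T})"
        using \<Phi>[of x] has_vector_derivative_within_subset[of "\<Phi> x" _ u "{0..}" "{0..T}"]
        unfolding sol_def by auto
      show "((\<lambda>u. \<Phi> x u \<bullet> \<Phi> x u) has_vector_derivative 2 * (\<Phi> x u \<bullet> \<Phi> (L x) u)) (at u within {0..T})"
        using bounded_bilinear.has_vector_derivative[OF bounded_bilinear_inner d d] u
        by (simp add: inner_commute \<Phi>L)
    qed (use T in auto)
    then have "2 * B x (L x) = (norm (\<Phi> x T))\<^sup>2 - (norm x)\<^sup>2"
      by (auto dest!: integral_unique simp: B_def \<Phi>0 power2_norm_eq_inner)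
    moreover have "(norm (\<Phi> x T))\<^sup>2 \<le> (norm x / 2)\<^sup>2" by (rule power_mono[OF T(2)]) simp
    then have "(norm (\<Phi> x T))\<^sup>2 \<le> (norm x)\<^sup>2 / 4" by (simp add: power_divide)
    ultimately show ?thesis
      using zero_le_power2[of "norm x"] by linarith
  qed
  then show thesis by (rule that[OF bb Bsym c])
qed

section \<open>Cascades and Lipschitz maps\<close>

text \<open>The infimum of the closed set of times with \<open>r \<le> g t\<close> belongs to that
  set, and it is not 0 because \<open>g 0 < r\<close>.\<close>

lemma first_exit:
  fixes g :: "real \<Rightarrow> real"
  assumes cont: "continuous_on {0..t1} g" and "g 0 < r" "r \<le> g t1" "0 \<le> t1"
  obtains b where "0 < b" "b \<le> t1" "r \<le> g b" "\<And>t. t \<in> {0..<b} \<Longrightarrow> g t < r"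
proof -
  define S where "S = {t \<in> {0..t1}. r \<le> g t}"
  have "S = {0..t1} \<inter> g -` {r..}" by (auto simp: S_def)
  then have "closed S" using continuous_closed_preimage[OF cont, of "{r..}"] by simp
  moreover have "t1 \<in> S" "bdd_below S" using assms by (auto simp: S_def)
  ultimately have b: "Inf S \<in> S" using closed_contains_Inf by blast
  have "g t < r" if "t \<in> {0..<Inf S}" for t
    using that b cInf_lower[OF _ \<open>bdd_below S\<close>, of t] by (force simp: S_def)
  moreover have "Inf S \<noteq> 0" using b \<open>g 0 < r\<close> by (auto simp: S_def)
  ultimately show thesis using b that[of "Inf S"] by (auto simp: S_def)
qed

text \<open>The coupling \<open>M * norm z\<close> in the first subsystem is not small, but it
  involves only \<open>z\<close>. A large weight \<open>m\<close> on the second Lyapunov function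
  lets the decay of \<open>z\<close> pay for it; the remaining perturbations, which feed back from
  \<open>y\<close> to \<open>z\<close>, are made harmless by a small \<open>k\<close>.\<close>

lemma cascade_decay:
  fixes B1 :: "'a::real_normed_vector \<Rightarrow> 'a \<Rightarrow> real" and B2 :: "'b::real_normed_vector \<Rightarrow> 'b \<Rightarrow> real"
  assumes "bounded_bilinear B1" "bounded_bilinear B2" "0 < c1" "0 < c2" "0 \<le> M"
    and d1: "\<And>y. 2 * B1 y (L1 y) \<le> - c1 * (norm y)\<^sup>2"
    and d2: "\<And>z. 2 * B2 z (L2 z) \<le> - c2 * (norm z)\<^sup>2"
  obtains m k g :: real where "0 < m" "0 < k" "0 < g"
    "\<And>(y::'a) (z::'b) h1 h2. norm h1 \<le> M * norm z + k * (norm y + norm z) \<Longrightarrow> norm h2 \<le> k * (norm y + norm z) \<Longrightarrow>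
      2 * B1 y (L1 y + h1) + m * (2 * B2 z (L2 z + h2)) \<le> - g * ((norm y)\<^sup>2 + (norm z)\<^sup>2)"
proof -
  interpret B1: bounded_bilinear B1 by fact
  interpret B2: bounded_bilinear B2 by fact
  obtain K1 where K1: "K1 > 0" "\<And>x y. norm (B1 x y) \<le> norm x * norm y * K1"
    using B1.pos_bounded by blast
  obtain K2 where K2: "K2 > 0" "\<And>x y. norm (B2 x y) \<le> norm x * norm y * K2"
    using B2.pos_bounded by blast
  define K where "K = max K1 K2"
  have K: "K > 0" "B1 x y \<le> K * norm x * norm y" "B2 u v \<le> K * norm u * norm v" for x y u v
  proof -
    show "K > 0" using K1 by (auto simp: K_def)
    have "norm x * norm y * K1 \<le> norm x * norm y * K" "norm u * norm v * K2 \<le> norm u * norm v * K"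
      by (auto simp: K_def intro!: mult_left_mono)
    then show "B1 x y \<le> K * norm x * norm y" "B2 u v \<le> K * norm u * norm v"
      using K1(2)[of x y] K2(2)[of u v] by (auto simp: mult_ac)
  qed
  \<comment> \<open>The first summand of \<open>m * c2\<close> pays for the cross term
    \<open>2 * K * M * Y * Z\<close> after completing the square at the cost of
    \<open>c1 / 4\<close> of the decay in \<open>Y\<close>; the second leaves a decay in
    \<open>Z\<close> as strong as that in \<open>Y\<close>.\<close>
  define m where "m = (4 * K\<^sup>2 * M\<^sup>2 / c1 + c1) / c2"
  have m: "m > 0" "m * c2 = 4 * K\<^sup>2 * M\<^sup>2 / c1 + c1"
    using assms by (auto simp: m_def intro!: divide_pos_pos add_nonneg_pos)
  \<comment> \<open>All terms containing \<open>k\<close> together then amount to at most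
    \<open>c1 / 4\<close> times the sum of squares, so that \<open>c1 / 2\<close> of the decay is
    left.\<close>
  define k where "k = c1 / (16 * K * (1 + m))"
  have "16 * K * (1 + m) > 0" using K(1) m(1) by simp
  then have k: "k > 0" "k * (4 * K * (1 + m)) = c1 / 4"
  proof -
    assume pos: "16 * K * (1 + m) > 0"
    then show "k > 0" using \<open>0 < c1\<close> by (simp add: k_def)
    have "k * (16 * K * (1 + m)) = c1"
      unfolding k_def by (intro nonzero_eq_divide_eq[THEN iffD1, OF _ refl]) (rule less_imp_neq[OF pos, symmetric])
    then show "k * (4 * K * (1 + m)) = c1 / 4" by simp
  qed
  show thesis
  proof (rule that[of m k "c1 / 2"])
    fix y h1 :: 'a and z h2 :: 'b
    assume h1: "norm h1 \<le> M * norm z + k * (norm y + norm z)" and h2: "norm h2 \<le> k * (norm y + norm z)"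
    define Y Z where "Y = norm y" and "Z = norm z"
    have YZ: "0 \<le> Y" "0 \<le> Z" by (auto simp: Y_def Z_def)
    have 1: "B1 y h1 \<le> K * Y * (M * Z + k * (Y + Z))"
      using order_trans[OF K(2)[of y h1] mult_left_mono[OF h1]] K(1) YZ by (simp add: Y_def Z_def)
    have 2: "B2 z h2 \<le> K * Z * (k * (Y + Z))"
      using order_trans[OF K(3)[of z h2] mult_left_mono[OF h2]] K(1) YZ by (simp add: Y_def Z_def)
    have "2 * B1 y (L1 y + h1) + m * (2 * B2 z (L2 z + h2))
        = 2 * B1 y (L1 y) + 2 * B1 y h1 + m * (2 * B2 z (L2 z)) + m * (2 * B2 z h2)"
      by (simp add: B1.add_right B2.add_right algebra_simps)
    also have "\<dots> \<le> - c1 * Y\<^sup>2 + 2 * (K * Y * (M * Z + k * (Y + Z))) + m * (- c2 * Z\<^sup>2) + m * (2 * (K * Z * (k * (Y + Z))))"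
      using d1[of y] d2[of z] 1 2 m(1) unfolding Y_def[symmetric] Z_def[symmetric]
      by (intro add_mono mult_left_mono) auto
    also have "\<dots> = - c1 * Y\<^sup>2 - (m * c2) * Z\<^sup>2 + 2 * (K * M) * Y * Z + 2 * K * k * (Y * (Y + Z)) + 2 * K * k * m * (Z * (Y + Z))"
      by (simp add: algebra_simps)
    also have "\<dots> \<le> - c1 * Y\<^sup>2 - (m * c2) * Z\<^sup>2 + 2 * (K * M) * Y * Z + k * (4 * K * (1 + m)) * (Y\<^sup>2 + Z\<^sup>2)"
    proof -
      have "2 * Y * Z \<le> Y\<^sup>2 + Z\<^sup>2" using sum_squares_bound[of Y Z] by simp
      then have "Y * (Y + Z) \<le> 2 * (Y\<^sup>2 + Z\<^sup>2)" "Z * (Y + Z) \<le> 2 * (Y\<^sup>2 + Z\<^sup>2)"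
        using zero_le_power2[of Y] zero_le_power2[of Z] mult.commute[of Z Y]
        unfolding power2_eq_square distrib_left by linarith+
      then have "2 * K * k * (Y * (Y + Z)) \<le> 2 * K * k * (2 * (Y\<^sup>2 + Z\<^sup>2))"
          "2 * K * k * m * (Z * (Y + Z)) \<le> 2 * K * k * m * (2 * (Y\<^sup>2 + Z\<^sup>2))"
        using K(1) k(1) m(1) by (auto intro!: mult_left_mono)
      then show ?thesis by (simp add: algebra_simps)
    qed
    also have "\<dots> \<le> - (c1 / 2) * (Y\<^sup>2 + Z\<^sup>2)"
    proof -
      have "0 \<le> (c1 / 2 * Y - 2 * (K * M) * Z)\<^sup>2" by simp
      then have "c1 * (2 * (K * M) * Y * Z) \<le> c1 * (c1 / 4 * Y\<^sup>2 + 4 * K\<^sup>2 * M\<^sup>2 / c1 * Z\<^sup>2)"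
        using \<open>0 < c1\<close> by (simp add: power2_eq_square algebra_simps)
      then have "2 * (K * M) * Y * Z \<le> c1 / 4 * Y\<^sup>2 + 4 * K\<^sup>2 * M\<^sup>2 / c1 * Z\<^sup>2"
        using \<open>0 < c1\<close> by (simp only: mult_le_cancel_left_pos)
      moreover have "0 \<le> c1 / 4 * Z\<^sup>2" using \<open>0 < c1\<close> by simp
      ultimately show ?thesis unfolding m k by (simp add: algebra_simps)
    qed
    finally show "2 * B1 y (L1 y + h1) + m * (2 * B2 z (L2 z + h2)) \<le> - (c1 / 2) * ((norm y)\<^sup>2 + (norm z)\<^sup>2)"
      by (simp add: Y_def Z_def)
  qed (use m k assms in auto)
qed

section \<open>Linear and bilinear operations on vectors and matrices\<close>

lemma bounded_bilinear_matrix_vector: "bounded_bilinear ((*v) :: real^'m^'n \<Rightarrow> real^'m \<Rightarrow> real^'n)"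
  unfolding bilinear_conv_bounded_bilinear[symmetric] bilinear_def
  by (auto intro!: linearI simp: matrix_vector_mult_add_rdistrib matrix_vector_right_distrib
      matrix_vector_mult_scaleR scaleR_matrix_vector_assoc)

lemma bounded_bilinear_matrix_mult:
  "bounded_bilinear ((**) :: real^'m^'n \<Rightarrow> real^'k^'m \<Rightarrow> real^'k^'n)"
  unfolding bilinear_conv_bounded_bilinear[symmetric] bilinear_def
  by (auto intro!: linearI simp: matrix_matrix_mult_def vec_eq_iff sum.distrib sum_distrib_left
      algebra_simps)

lemma bounded_bilinear_cross3: "bounded_bilinear cross3"
  using bilinear_cross by (simp add: bilinear_conv_bounded_bilinear)

lemma bounded_linear_transpose: "bounded_linear (transpose :: real^'m^'n \<Rightarrow> real^'n^'m)"
  unfolding linear_conv_bounded_linear[symmetric]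
  by (auto intro!: linearI simp: transpose_def vec_eq_iff)

lemma bounded_linear_hat: "bounded_linear hat"
  unfolding linear_conv_bounded_linear[symmetric]
  by (auto intro!: linearI simp: hat_components vec_eq_iff forall_3)

lemma bounded_linear_vee: "bounded_linear vee"
  unfolding linear_conv_bounded_linear[symmetric]
  by (auto intro!: linearI simp: vee_def vec_eq_iff forall_3)

text \<open>For the oscillator \<open>r' = e\<close>, \<open>J e' = - (a r + b e)\<close> the energy
  \<open>a * (r \<bullet> r) + e \<bullet> J e\<close> is dissipated only through \<open>e\<close>.
  Adding a small multiple \<open>k\<close> of the cross term \<open>r \<bullet> J e\<close> supplies
  decay in \<open>r\<close> as well.\<close>

lemma attitude_lyapunov_form:
  fixes J :: "real^3^3"
  assumes sym: "transpose J = J" and pos: "\<And>v. v \<noteq> 0 \<Longrightarrow> 0 < v \<bullet> (J *v v)"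
    and "0 < a" "0 < b"
    and inv: "\<And>v. J *v (Ji *v v) = v"
  obtains B :: "(real^3) \<times> (real^3) \<Rightarrow> (real^3) \<times> (real^3) \<Rightarrow> real" and c0 c where
    "bounded_bilinear B" "\<And>x y. B x y = B y x" "0 < c0" "\<And>x. c0 * (norm x)\<^sup>2 \<le> B x x" "0 < c"
    "\<And>x. 2 * B x (snd x, - (Ji *v (a *\<^sub>R fst x + b *\<^sub>R snd x))) \<le> - c * (norm x)\<^sup>2"
proof -
  interpret mv: bounded_bilinear "(*v) :: real^3^3 \<Rightarrow> real^3 \<Rightarrow> real^3" by (rule bounded_bilinear_matrix_vector)
  have symJ: "x \<bullet> (J *v y) = y \<bullet> (J *v x)" for x y
    using dot_lmul_matrix[of y J x] sym by (metis inner_commute transpose_matrix_vector)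
  have "bounded_bilinear (\<lambda>x y. x \<bullet> (J *v y))"
    by (rule bounded_bilinear.comp[OF bounded_bilinear_inner bounded_linear_ident mv.bounded_linear_right])
  from bilinear_form_coercive[OF this pos] obtain j1 where j1: "0 < j1" "\<And>v. j1 * (norm v)\<^sup>2 \<le> v \<bullet> (J *v v)"
    by blast
  obtain j2 where j2: "0 < j2" "\<And>v. norm (J *v v) \<le> norm v * j2"
    using bounded_linear.pos_bounded[OF mv.bounded_linear_right[of J]] by blast
  \<comment> \<open>The first bound keeps the indefinite terms in the derivative below half of the
    damping \<open>b\<close>; the second keeps the form positive definite in spite of the cross
    term.\<close>
  define k where "k = min (b / 2 / (b\<^sup>2 / (2 * a) + j2)) (sqrt (a * j1) / (2 * j2))"
  have den: "b\<^sup>2 / (2 * a) + j2 > 0" using assms j2 by (intro add_nonneg_pos) auto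
  have k0: "0 < k" using assms j1 j2 den by (auto simp: k_def)
  have "k * (b\<^sup>2 / (2 * a) + j2) \<le> b / 2 / (b\<^sup>2 / (2 * a) + j2) * (b\<^sup>2 / (2 * a) + j2)"
    using den by (intro mult_right_mono) (auto simp: k_def)
  also have "\<dots> = b / 2" using den by (intro nonzero_eq_divide_eq[THEN iffD1, OF _ refl]) simp
  finally have k1: "k * (b\<^sup>2 / (2 * a) + j2) \<le> b / 2" .
  have "k\<^sup>2 \<le> (sqrt (a * j1) / (2 * j2))\<^sup>2" using k0 by (intro power_mono) (auto simp: k_def)
  then have k2: "4 * (k * j2)\<^sup>2 \<le> a * j1"
    using assms j1 j2 by (simp add: power_divide power_mult_distrib field_simps)
  define B where "B x y = a * (fst x \<bullet> fst y) + snd x \<bullet> (J *v snd y) + k * (fst x \<bullet> (J *v snd y) + fst y \<bullet> (J *v snd x))"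
    for x y :: "(real^3) \<times> (real^3)"
  have Bsym: "B x y = B y x" for x y
    unfolding B_def using symJ[of "snd x" "snd y"] by (simp add: inner_commute)
  have Blin: "linear (B x)" for x
    by (rule linearI) (simp_all add: B_def mv.add_right mv.scaleR_right inner_simps algebra_simps)
  have "linear (\<lambda>x. B x y)" for y
  proof -
    have "(\<lambda>x. B x y) = B y" by (rule ext) (rule Bsym)
    then show ?thesis using Blin by simp
  qed
  with Blin have bb: "bounded_bilinear B"
    unfolding bilinear_conv_bounded_bilinear[symmetric] bilinear_def by simp
  have nrm: "(norm x)\<^sup>2 = (norm (fst x))\<^sup>2 + (norm (snd x))\<^sup>2" for x :: "(real^3) \<times> (real^3)"
    by (cases x) (simp add: norm_Pair)
  show thesis
  proof (rule that[OF bb Bsym])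
    show "0 < min (a / 2) (j1 / 2)" using assms j1 by simp
    show "0 < min (k * a) b" using assms k0 by simp
    fix x :: "(real^3) \<times> (real^3)"
    define R E where "R = norm (fst x)" and "E = norm (snd x)"
    have RE: "0 \<le> R" "0 \<le> E" by (auto simp: R_def E_def)
    have "\<bar>fst x \<bullet> (J *v snd x)\<bar> \<le> R * (E * j2)"
      unfolding R_def E_def by (rule order_trans[OF Cauchy_Schwarz_ineq2 mult_left_mono[OF j2(2)]]) simp
    then have "2 * k * (- (R * (E * j2))) \<le> 2 * k * (fst x \<bullet> (J *v snd x))"
      using k0 by (intro mult_left_mono) auto
    moreover have "2 * k * (R * (E * j2)) \<le> a / 2 * R\<^sup>2 + j1 / 2 * E\<^sup>2"
    proof -
      have "0 \<le> (a * R - 2 * (k * j2) * E)\<^sup>2" by simp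
      then have "2 * (2 * a) * (k * R * (E * j2)) \<le> a\<^sup>2 * R\<^sup>2 + 4 * (k * j2)\<^sup>2 * E\<^sup>2"
        by (simp add: power2_eq_square algebra_simps)
      also have "\<dots> \<le> a\<^sup>2 * R\<^sup>2 + a * j1 * E\<^sup>2" using k2 by (intro add_left_mono mult_right_mono) auto
      finally have "(2 * a) * (2 * k * (R * (E * j2))) \<le> (2 * a) * (a / 2 * R\<^sup>2 + j1 / 2 * E\<^sup>2)"
        by (simp add: power2_eq_square algebra_simps)
      then show ?thesis using \<open>0 < a\<close> by (simp only: mult_le_cancel_left_pos mult_pos_pos zero_less_numeral)
    qed
    moreover have "B x x = a * R\<^sup>2 + snd x \<bullet> (J *v snd x) + 2 * k * (fst x \<bullet> (J *v snd x))"
      by (simp add: B_def R_def power2_norm_eq_inner)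
    ultimately have "a / 2 * R\<^sup>2 + j1 / 2 * E\<^sup>2 \<le> B x x"
      using j1(2)[of "snd x"] unfolding E_def by linarith
    moreover have "min (a / 2) (j1 / 2) * R\<^sup>2 \<le> a / 2 * R\<^sup>2" "min (a / 2) (j1 / 2) * E\<^sup>2 \<le> j1 / 2 * E\<^sup>2"
      by (intro mult_right_mono; simp)+
    ultimately show "min (a / 2) (j1 / 2) * (norm x)\<^sup>2 \<le> B x x"
      unfolding nrm by (simp add: R_def E_def distrib_left)
    have JJ: "J *v (- (Ji *v v)) = - v" for v by (simp add: mv.minus_right inv)
    \<comment> \<open>The terms \<open>a * (r \<bullet> e)\<close> of potential and kinetic energy
      cancel, and the cross term contributes the wanted \<open>- k * a * R\<^sup>2\<close>.\<close>
    have "B x (snd x, - (Ji *v (a *\<^sub>R fst x + b *\<^sub>R snd x)))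
       = - b * E\<^sup>2 - k * a * R\<^sup>2 - k * b * (fst x \<bullet> snd x) + k * (snd x \<bullet> (J *v snd x))"
      unfolding B_def fst_conv snd_conv JJ
      by (simp add: inner_simps R_def E_def power2_norm_eq_inner inner_commute algebra_simps)
    also have "\<dots> \<le> - b * E\<^sup>2 - k * a * R\<^sup>2 + k * (a / 2 * R\<^sup>2 + b\<^sup>2 / (2 * a) * E\<^sup>2) + k * (j2 * E\<^sup>2)"
    proof -
      have "\<bar>fst x \<bullet> snd x\<bar> \<le> R * E" unfolding R_def E_def by (rule Cauchy_Schwarz_ineq2)
      then have "b * (- (fst x \<bullet> snd x)) \<le> b * (R * E)" using \<open>0 < b\<close> by (intro mult_left_mono) auto
      also have "\<dots> \<le> a / 2 * R\<^sup>2 + b\<^sup>2 / (2 * a) * E\<^sup>2"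
      proof -
        have "0 \<le> (a * R - b * E)\<^sup>2 / (2 * a)" using \<open>0 < a\<close> by simp
        also have "\<dots> = a / 2 * R\<^sup>2 + b\<^sup>2 / (2 * a) * E\<^sup>2 - b * (R * E)"
          using \<open>0 < a\<close> by (simp add: power2_eq_square field_simps)
        finally show ?thesis by simp
      qed
      finally have "k * (b * (- (fst x \<bullet> snd x))) \<le> k * (a / 2 * R\<^sup>2 + b\<^sup>2 / (2 * a) * E\<^sup>2)"
        using k0 by (intro mult_left_mono) auto
      moreover have "snd x \<bullet> (J *v snd x) \<le> E * (E * j2)"
        unfolding E_def by (rule order_trans[OF norm_cauchy_schwarz mult_left_mono[OF j2(2)]]) simp
      then have "k * (snd x \<bullet> (J *v snd x)) \<le> k * (j2 * E\<^sup>2)"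
        using k0 by (intro mult_left_mono) (auto simp: power2_eq_square mult_ac)
      ultimately show ?thesis by (simp add: algebra_simps)
    qed
    also have "\<dots> = - b * E\<^sup>2 - k * a / 2 * R\<^sup>2 + k * (b\<^sup>2 / (2 * a) + j2) * E\<^sup>2"
      by (simp add: algebra_simps)
    also have "\<dots> \<le> - b * E\<^sup>2 - k * a / 2 * R\<^sup>2 + b / 2 * E\<^sup>2"
      using k1 by (intro add_left_mono mult_right_mono) auto
    finally have "2 * B x (snd x, - (Ji *v (a *\<^sub>R fst x + b *\<^sub>R snd x))) \<le> - (k * a) * R\<^sup>2 - b * E\<^sup>2"
      by simp
    moreover have "min (k * a) b * R\<^sup>2 \<le> k * a * R\<^sup>2" "min (k * a) b * E\<^sup>2 \<le> b * E\<^sup>2"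
      by (intro mult_right_mono; simp)+
    ultimately show "2 * B x (snd x, - (Ji *v (a *\<^sub>R fst x + b *\<^sub>R snd x))) \<le> - min (k * a) b * (norm x)\<^sup>2"
      unfolding nrm by (simp add: R_def E_def distrib_left)
  qed
qed

text \<open>Hiding the constant allows Lipschitz continuity of composite expressions to be derived
  from introduction rules alone; a constant is extracted only where an estimate needs one.\<close>

definition lip :: "'a::metric_space set \<Rightarrow> ('a \<Rightarrow> 'b::metric_space) \<Rightarrow> bool" where
  "lip S f \<longleftrightarrow> (\<exists>L. L-lipschitz_on S f)"

named_theorems lip_intros

lemma lip_const [lip_intros]: "lip S (\<lambda>x. c)"
  and lip_ident [lip_intros]: "lip S (\<lambda>x. x)"
  unfolding lip_def using lipschitz_on_constant lipschitz_on_id by blast+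

lemma lip_subset: "lip S f \<Longrightarrow> T \<subseteq> S \<Longrightarrow> lip T f"
  unfolding lip_def using lipschitz_on_subset by blast

lemma lip_compose: "lip S f \<Longrightarrow> lip T g \<Longrightarrow> f ` S \<subseteq> T \<Longrightarrow> lip S (\<lambda>x. g (f x))"
proof -
  assume "lip S f" "lip T g" "f ` S \<subseteq> T"
  then obtain C D where "C-lipschitz_on S f" "D-lipschitz_on T g" by (auto simp: lip_def)
  with \<open>f ` S \<subseteq> T\<close> show ?thesis
    unfolding lip_def using lipschitz_on_compose2[of C S f D g] lipschitz_on_subset[of D T g] by auto
qed

lemma lip_Pair [lip_intros]: "lip S f \<Longrightarrow> lip S g \<Longrightarrow> lip S (\<lambda>x. (f x, g x))"
  unfolding lip_def using lipschitz_on_Pair by blast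

lemma lip_add [lip_intros]: "lip S f \<Longrightarrow> lip S g \<Longrightarrow> lip S (\<lambda>x. f x + g x)"
  and lip_diff [lip_intros]: "lip S f \<Longrightarrow> lip S g \<Longrightarrow> lip S (\<lambda>x. f x - g x)"
  and lip_minus [lip_intros]: "lip S f \<Longrightarrow> lip S (\<lambda>x. - f x)"
  for f g :: "'a::metric_space \<Rightarrow> 'b::real_normed_vector"
  unfolding lip_def using lipschitz_on_add lipschitz_on_diff lipschitz_on_minus by blast+

lemma lip_sum [lip_intros]:
  fixes f :: "'i \<Rightarrow> 'a::metric_space \<Rightarrow> 'b::real_normed_vector"
  assumes "\<And>i. i \<in> I \<Longrightarrow> lip S (f i)"
  shows "lip S (\<lambda>x. \<Sum>i\<in>I. f i x)"
  using assms by (induction I rule: infinite_finite_induct) (auto intro!: lip_intros)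

lemma lip_linear:
  assumes "bounded_linear h" "lip S f"
  shows "lip S (\<lambda>x. h (f x))"
proof -
  obtain B where "B-lipschitz_on UNIV h" by (rule bounded_linear.lipschitz_boundE[OF assms(1)])
  then have "lip UNIV h" by (auto simp: lip_def)
  from lip_compose[OF assms(2) this] show ?thesis by simp
qed

lemma lipD:
  fixes f :: "'a::real_normed_vector \<Rightarrow> 'b::real_normed_vector"
  assumes "lip S f"
  obtains C where "0 < C" "\<And>x y. x \<in> S \<Longrightarrow> y \<in> S \<Longrightarrow> norm (f x - f y) \<le> C * norm (x - y)"
proof -
  obtain L where L: "L-lipschitz_on S f" using assms by (auto simp: lip_def)
  have "norm (f x - f y) \<le> (L + 1) * norm (x - y)" if "x \<in> S" "y \<in> S" for x y
    using lipschitz_on_normD[OF L that] by (simp add: distrib_right add_increasing2)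
  then show thesis using that[of "L + 1"] lipschitz_on_nonneg[OF L] by simp
qed

lemma lipI:
  fixes f :: "'a::real_normed_vector \<Rightarrow> 'b::real_normed_vector"
  assumes "0 \<le> C" "\<And>x y. x \<in> S \<Longrightarrow> y \<in> S \<Longrightarrow> norm (f x - f y) \<le> C * norm (x - y)"
  shows "lip S f"
  unfolding lip_def using assms by (intro exI[of _ C] lipschitz_onI) (auto simp: dist_norm)

lemma lip_bounded:
  fixes f :: "'a::real_normed_vector \<Rightarrow> 'b::real_normed_vector"
  assumes "lip S f" "bounded S"
  obtains K where "0 < K" "\<And>x. x \<in> S \<Longrightarrow> norm (f x) \<le> K"
proof (cases "S = {}")
  case False
  then obtain x0 where x0: "x0 \<in> S" by blast
  obtain C where C: "0 < C" "\<And>x y. x \<in> S \<Longrightarrow> y \<in> S \<Longrightarrow> norm (f x - f y) \<le> C * norm (x - y)"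
    using lipD[OF assms(1)] by blast
  obtain K where K: "0 < K" "\<And>x. x \<in> S \<Longrightarrow> norm x \<le> K" using assms(2) by (auto simp: bounded_pos)
  show thesis
  proof (rule that)
    show "0 < norm (f x0) + C * (2 * K)" using C K by (simp add: add_nonneg_pos)
    fix x assume x: "x \<in> S"
    have "norm (x - x0) \<le> 2 * K" using norm_triangle_ineq4[of x x0] K(2)[OF x] K(2)[OF x0] by simp
    then have "C * norm (x - x0) \<le> C * (2 * K)" using C(1) by simp
    then show "norm (f x) \<le> norm (f x0) + C * (2 * K)"
      using norm_triangle_sub[of "f x" "f x0"] C(2)[OF x x0] by simp
  qed
qed (use that[of 1] in simp)

lemma lip_bilinear:
  fixes h :: "'b::real_normed_vector \<Rightarrow> 'c::real_normed_vector \<Rightarrow> 'd::real_normed_vector"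
    and f :: "'a::real_normed_vector \<Rightarrow> 'b"
  assumes "bounded_bilinear h" "bounded S" "lip S f" "lip S g"
  shows "lip S (\<lambda>x. h (f x) (g x))"
proof -
  interpret h: bounded_bilinear h by fact
  obtain H where H: "0 < H" "\<And>x y. norm (h x y) \<le> norm x * norm y * H" using h.pos_bounded by blast
  obtain F where F: "0 < F" "\<And>x y. x \<in> S \<Longrightarrow> y \<in> S \<Longrightarrow> norm (f x - f y) \<le> F * norm (x - y)" using lipD[OF assms(3)] by blast
  obtain G where G: "0 < G" "\<And>x y. x \<in> S \<Longrightarrow> y \<in> S \<Longrightarrow> norm (g x - g y) \<le> G * norm (x - y)" using lipD[OF assms(4)] by blast
  obtain F' where F': "0 < F'" "\<And>x. x \<in> S \<Longrightarrow> norm (f x) \<le> F'" using lip_bounded[OF assms(3,2)] by blast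
  obtain G' where G': "0 < G'" "\<And>x. x \<in> S \<Longrightarrow> norm (g x) \<le> G'" using lip_bounded[OF assms(4,2)] by blast
  show ?thesis
  proof (rule lipI)
    show "0 \<le> (F * G' + F' * G) * H" using F G F' G' H by simp
    fix x y assume xy: "x \<in> S" "y \<in> S"
    have "h (f x) (g x) - h (f y) (g y) = h (f x - f y) (g x) + h (f y) (g x - g y)"
      by (simp add: h.diff_left h.diff_right)
    also have "norm \<dots> \<le> norm (f x - f y) * norm (g x) * H + norm (f y) * norm (g x - g y) * H"
      by (rule norm_triangle_le) (intro add_mono H)
    also have "\<dots> \<le> (F * norm (x - y)) * G' * H + F' * (G * norm (x - y)) * H"
      using xy F G F' G' H by (intro add_mono mult_mono) auto
    finally show "norm (h (f x) (g x) - h (f y) (g y)) \<le> (F * G' + F' * G) * H * norm (x - y)"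
      by (simp add: algebra_simps)
  qed
qed

lemmas lip_scaleR = lip_bilinear[OF bounded_bilinear_scaleR]
  and lip_inner = lip_bilinear[OF bounded_bilinear_inner]
  and lip_matrix_vector = lip_bilinear[OF bounded_bilinear_matrix_vector]
  and lip_matrix_mult = lip_bilinear[OF bounded_bilinear_matrix_mult]
  and lip_cross3 = lip_bilinear[OF bounded_bilinear_cross3]
  and lip_fst [lip_intros] = lip_linear[OF bounded_linear_fst]
  and lip_snd [lip_intros] = lip_linear[OF bounded_linear_snd]
  and lip_nth [lip_intros] = lip_linear[OF bounded_linear_vec_nth]
  and lip_transpose [lip_intros] = lip_linear[OF bounded_linear_transpose]
  and lip_hat [lip_intros] = lip_linear[OF bounded_linear_hat]
  and lip_vee [lip_intros] = lip_linear[OF bounded_linear_vee]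

lemma norm_vec_le_sum: "norm x \<le> (\<Sum>i\<in>UNIV. norm (x $ i))" for x :: "'a::real_normed_vector ^ 'n"
  unfolding norm_vec_def by (rule L2_set_le_sum) simp

lemma lip_vec [lip_intros]:
  fixes f :: "'i::finite \<Rightarrow> 'a::real_normed_vector \<Rightarrow> 'b::real_normed_vector"
  assumes "\<And>i. lip S (f i)"
  shows "lip S (\<lambda>x. \<chi> i. f i x)"
proof -
  have "\<forall>i. \<exists>C>0. \<forall>x\<in>S. \<forall>y\<in>S. norm (f i x - f i y) \<le> C * norm (x - y)"
    using lipD[OF assms] by metis
  then obtain C where C: "\<And>i. C i > 0" "\<And>i x y. x \<in> S \<Longrightarrow> y \<in> S \<Longrightarrow> norm (f i x - f i y) \<le> C i * norm (x - y)"
    by metis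
  show ?thesis
  proof (rule lipI)
    show "0 \<le> (\<Sum>i\<in>UNIV. C i)" using C(1) by (intro sum_nonneg) (simp add: less_imp_le)
    fix x y assume xy: "x \<in> S" "y \<in> S"
    have "norm ((\<chi> i. f i x) - (\<chi> i. f i y)) \<le> (\<Sum>i\<in>UNIV. norm (f i x - f i y))"
      using norm_vec_le_sum[of "(\<chi> i. f i x) - (\<chi> i. f i y)"] by simp
    also have "\<dots> \<le> (\<Sum>i\<in>UNIV. C i * norm (x - y))" by (intro sum_mono C xy)
    finally show "norm ((\<chi> i. f i x) - (\<chi> i. f i y)) \<le> (\<Sum>i\<in>UNIV. C i) * norm (x - y)"
      by (simp add: sum_distrib_right)
  qed
qed

text \<open>The difference splits into \<open>x - y\<close> divided by \<open>norm x\<close> and the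
  change of the normalizing factor times \<open>y\<close>; each part is at most
  \<open>norm (x - y) / norm x\<close>.\<close>

lemma norm_sgn_diff_le:
  fixes x y :: "'a::real_normed_vector"
  assumes "0 < c" "c \<le> norm x" "y \<noteq> 0"
  shows "norm (sgn x - sgn y) \<le> 2 / c * norm (x - y)"
proof -
  have "x \<noteq> 0" using assms by auto
  then have "sgn x - sgn y = (x - y) /\<^sub>R norm x + (1 / norm x - 1 / norm y) *\<^sub>R y"
    by (simp add: sgn_div_norm algebra_simps inverse_eq_divide)
  also have "norm \<dots> \<le> norm (x - y) / norm x + \<bar>1 / norm x - 1 / norm y\<bar> * norm y"
    by (rule norm_triangle_le) (simp add: divide_inverse mult.commute)
  also have "\<bar>1 / norm x - 1 / norm y\<bar> * norm y = \<bar>norm y - norm x\<bar> / norm x"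
  proof -
    have "1 / norm x - 1 / norm y = (norm y - norm x) / (norm x * norm y)"
      using \<open>x \<noteq> 0\<close> \<open>y \<noteq> 0\<close> by (simp add: diff_frac_eq)
    then show ?thesis using \<open>y \<noteq> 0\<close> by (simp add: abs_divide abs_mult)
  qed
  also have "norm (x - y) / norm x + \<dots> \<le> 2 * norm (x - y) / norm x"
    using norm_triangle_ineq3[of y x] \<open>x \<noteq> 0\<close> by (simp add: divide_simps norm_minus_commute)
  also have "\<dots> \<le> 2 * norm (x - y) / c"
    using assms \<open>x \<noteq> 0\<close> by (intro divide_left_mono mult_pos_pos) auto
  finally show ?thesis by simp
qed

lemma lip_sgn:
  fixes f :: "'a::real_normed_vector \<Rightarrow> 'b::real_normed_vector"
  assumes "lip S f" "0 < c" "\<And>x. x \<in> S \<Longrightarrow> c \<le> norm (f x)"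
  shows "lip S (\<lambda>x. sgn (f x))"
proof -
  have "lip {x. c \<le> norm x} (sgn :: 'b \<Rightarrow> 'b)"
  proof (rule lipI)
    show "0 \<le> 2 / c" using assms(2) by simp
    show "norm (sgn x - sgn y) \<le> 2 / c * norm (x - y)"
      if "x \<in> {x. c \<le> norm x}" "y \<in> {x. c \<le> norm x}" for x y :: 'b
      by (rule norm_sgn_diff_le[OF assms(2)]) (use that assms(2) in auto)
  qed
  from lip_compose[OF assms(1) this] show ?thesis using assms(3) by auto
qed

text \<open>Subtracting the equations at \<open>s\<close> and \<open>t\<close> gives
  \<open>N s (a s - a t) = (r s - r t) - (N s (a t) - N t (a t))\<close>. Coercivity, uniform in
  \<open>s\<close>, inverts the left side and also bounds \<open>a t\<close>. The accelerations,
  given only implicitly, become Lipschitz in this way.\<close>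

lemma lip_solve:
  fixes N :: "'s::real_normed_vector \<Rightarrow> 'a::real_normed_vector \<Rightarrow> 'b::real_normed_vector"
  assumes lin: "\<And>s. s \<in> S \<Longrightarrow> linear (N s)" and "0 < c" "0 \<le> C"
    and coercive: "\<And>s u. s \<in> S \<Longrightarrow> c * norm u \<le> norm (N s u)"
    and N: "\<And>s t u. s \<in> S \<Longrightarrow> t \<in> S \<Longrightarrow> norm (N s u - N t u) \<le> C * norm (s - t) * norm u"
    and r: "lip S r" "bounded S" and sol: "\<And>s. s \<in> S \<Longrightarrow> N s (a s) = r s"
  shows "lip S a"
proof -
  obtain D where D: "0 < D" "\<And>x y. x \<in> S \<Longrightarrow> y \<in> S \<Longrightarrow> norm (r x - r y) \<le> D * norm (x - y)" using lipD[OF r(1)] by blast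
  obtain K where K: "0 < K" "\<And>x. x \<in> S \<Longrightarrow> norm (r x) \<le> K" using lip_bounded[OF r] by blast
  show ?thesis
  proof (rule lipI)
    show "0 \<le> (D + C * (K / c)) / c" using assms D K by simp
    fix s t assume st: "s \<in> S" "t \<in> S"
    have "c * norm (a t) \<le> K" using coercive[OF st(2), of "a t"] sol[OF st(2)] K(2)[OF st(2)] by simp
    then have at: "norm (a t) \<le> K / c" using \<open>0 < c\<close> by (simp add: field_simps)
    have "c * norm (a s - a t) \<le> norm (N s (a s - a t))" by (rule coercive[OF st(1)])
    also have "N s (a s - a t) = (r s - r t) - (N s (a t) - N t (a t))"
      using linear_diff[OF lin[OF st(1)]] sol st by simp
    also have "norm \<dots> \<le> D * norm (s - t) + C * norm (s - t) * norm (a t)"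
      by (rule norm_triangle_le_diff) (intro add_mono D N st)
    also have "\<dots> \<le> D * norm (s - t) + C * norm (s - t) * (K / c)"
      using at \<open>0 \<le> C\<close> by (intro add_left_mono mult_left_mono) auto
    finally show "norm (a s - a t) \<le> (D + C * (K / c)) / c * norm (s - t)"
      using \<open>0 < c\<close> by (simp add: field_simps)
  qed
qed

section \<open>Block matrices and the kinetic energy\<close>

lemma transpose_C32_nth: "(transpose C32 *v v) $ 1 = v $ 1" "(transpose C32 *v v) $ 2 = v $ 2"
  by (simp_all add: C32_def matrix_vector_mult_def sum_3 axis_def)

lemma C32_nth: "(C32 *v p) $ 1 = p $ 1" "(C32 *v p) $ 2 = p $ 2" "(C32 *v p) $ 3 = 0"
  by (simp_all add: C32_def matrix_vector_mult_def sum_2 axis_def transpose_def)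

lemma block_vector_add: "block_vector (a + b) (\<lambda>i. p i + q i) = block_vector a p + block_vector b q"
  and block_vector_diff: "block_vector (a - b) (\<lambda>i. p i - q i) = block_vector a p - block_vector b q"
  and block_vector_zero: "block_vector 0 (\<lambda>i. 0) = 0"
  by (auto simp: block_vector_def vec_eq_iff split: sum.split)

lemma block_vector_surj: obtains a p where "z = block_vector a p"
proof
  show "z = block_vector (\<chi> r. z $ Inl r) (\<lambda>i. \<chi> b. z $ Inr (i, b))"
    by (auto simp: block_vector_def vec_eq_iff split: sum.split)
qed

lemma sum_Plus_UNIV:
  "(\<Sum>k\<in>(UNIV :: ('a::finite + 'b::finite) set). f k) = (\<Sum>a\<in>UNIV. f (Inl a)) + (\<Sum>b\<in>UNIV. f (Inr b))"
  unfolding UNIV_sum by (subst sum.union_disjoint) (auto simp: sum.reindex)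

lemma inner_block_vector: "block_vector a p \<bullet> block_vector b q = a \<bullet> b + (\<Sum>i\<in>UNIV. p i \<bullet> q i)"
  by (simp add: inner_vec_def block_vector_def sum_Plus_UNIV sum.cartesian_product UNIV_Times_UNIV[symmetric]
      split_def del: UNIV_Times_UNIV)

lemma norm_block_vector: "(norm (block_vector a p))\<^sup>2 = (norm a)\<^sup>2 + (\<Sum>i\<in>UNIV. (norm (p i))\<^sup>2)"
  by (simp add: power2_norm_eq_inner inner_block_vector)

lemma norm_block_vector_le: "norm (block_vector a p) \<le> norm a + (\<Sum>i\<in>UNIV. norm (p i))"
proof -
  have "(\<Sum>i\<in>UNIV. (norm (p i))\<^sup>2) \<le> (\<Sum>i\<in>UNIV. norm (p i))\<^sup>2"
  proof -
    have "sqrt (\<Sum>i\<in>UNIV. (norm (p i))\<^sup>2) \<le> (\<Sum>i\<in>UNIV. norm (p i))"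
      using L2_set_le_sum[of UNIV "\<lambda>i. norm (p i)"] by (simp add: L2_set_def)
    from power_mono[OF this, of 2] show ?thesis by (simp add: sum_nonneg)
  qed
  moreover have "0 \<le> norm a * (\<Sum>i\<in>UNIV. norm (p i))" by (simp add: sum_nonneg)
  ultimately have "(norm (block_vector a p))\<^sup>2 \<le> (norm a + (\<Sum>i\<in>UNIV. norm (p i)))\<^sup>2"
    unfolding norm_block_vector power2_sum by linarith
  then show ?thesis by (rule power2_le_imp_le) (simp add: sum_nonneg)
qed

lemma norm_le_block_vector: "norm a \<le> norm (block_vector a p)" "norm (p i) \<le> norm (block_vector a p)"
proof -
  have "(norm (p i))\<^sup>2 \<le> (\<Sum>i\<in>UNIV. (norm (p i))\<^sup>2)"
    using member_le_sum[of i UNIV "\<lambda>i. (norm (p i))\<^sup>2"] by simp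
  moreover have "0 \<le> (\<Sum>i\<in>UNIV. (norm (p i))\<^sup>2)" by (rule sum_nonneg) simp
  ultimately have sq: "(norm a)\<^sup>2 \<le> (norm (block_vector a p))\<^sup>2" "(norm (p i))\<^sup>2 \<le> (norm (block_vector a p))\<^sup>2"
    unfolding norm_block_vector using zero_le_power2[of "norm a"] by linarith+
  show "norm a \<le> norm (block_vector a p)" using sq(1) by (rule power2_le_imp_le) simp
  show "norm (p i) \<le> norm (block_vector a p)" using sq(2) by (rule power2_le_imp_le) simp
qed

lemma block_vector_nth_inner: "(\<Sum>k\<in>UNIV. block_vector X Y $ k * block_vector y p $ k) = X \<bullet> y + (\<Sum>i\<in>UNIV. Y i \<bullet> p i)"
  using inner_block_vector[of X Y y p] by (simp add: inner_vec_def)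

lemma block_row_mult: "block_row X Y *v block_vector y p = X *v y + (\<Sum>i\<in>UNIV. Y i *v p i)"
  by (simp add: vec_eq_iff matrix_vector_mult_def block_row_def block_vector_nth_inner)
    (simp add: inner_vec_def)

lemma block_matrix_mult:
  "block_matrix X Y Z W *v block_vector y p =
    block_vector (X *v y + (\<Sum>j\<in>UNIV. Y j *v p j)) (\<lambda>i. Z i *v y + (\<Sum>j\<in>UNIV. W i j *v p j))"
proof -
  have "(block_matrix X Y Z W *v block_vector y p) $ k =
      block_vector (X *v y + (\<Sum>j\<in>UNIV. Y j *v p j)) (\<lambda>i. Z i *v y + (\<Sum>j\<in>UNIV. W i j *v p j)) $ k" for k
  proof (cases k)
    case (Inl r)
    then show ?thesis
      unfolding matrix_vector_mul_component
      by (simp add: block_matrix_def inner_block_vector)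
        (simp add: block_vector_def matrix_vector_mul_component)
  next
    case (Inr b)
    then show ?thesis
      unfolding matrix_vector_mul_component
      by (simp add: block_matrix_def inner_block_vector split: prod.split)
        (simp add: block_vector_def matrix_vector_mul_component)
  qed
  then show ?thesis by (simp add: vec_eq_iff)
qed

text \<open>The matrix is the transpose of a block row, so its product is identified by inner
  products with arbitrary block vectors.\<close>

lemma input_matrix_mult: "input_matrix *v u = block_vector u (\<lambda>i. 0)"
proof -
  have "(input_matrix *v u) \<bullet> z = block_vector u (\<lambda>i. 0) \<bullet> z" for z :: "real^(3 + 'a \<times> 2)"
  proof -
    obtain a p where z: "z = block_vector a p" by (rule block_vector_surj)
    have "(input_matrix *v u) \<bullet> z = (u v* block_row (mat 1) (\<lambda>i. 0)) \<bullet> z"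
      by (simp add: input_matrix_def vector_transpose_matrix[symmetric])
    also have "\<dots> = u \<bullet> (block_row (mat 1) (\<lambda>i. 0) *v z)" by (simp add: dot_lmul_matrix)
    finally show ?thesis by (simp add: z block_row_mult inner_block_vector)
  qed
  then show ?thesis using vector_eq_rdot[of "input_matrix *v u" "block_vector u (\<lambda>i. 0)"] by blast
qed

context
  fixes P :: "'n::{finite,linorder} quadrotor"
begin

definition energy :: "real^3 \<Rightarrow> ('n \<Rightarrow> real^3) \<Rightarrow> real" where
  "energy a p = M00 P * (a \<bullet> a) + 2 * (\<Sum>i\<in>UNIV. M0 P i * (a \<bullet> p i)) + (\<Sum>i\<in>UNIV. \<Sum>j\<in>UNIV. Mij P i j * (p i \<bullet> p j))"

text \<open>Both sides run over the pairs \<open>i \<le> a\<close>. This converts sums over the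
  masses beyond a link into sums over the links that lead to a mass.\<close>

lemma sum_atLeast_swap:
  fixes f :: "'n \<Rightarrow> 'n \<Rightarrow> 'a::comm_monoid_add"
  shows "(\<Sum>i\<in>UNIV. \<Sum>a\<in>{i..}. f i a) = (\<Sum>a\<in>UNIV. \<Sum>i\<in>{..a}. f i a)"
  unfolding atLeast_def atMost_def using sum.swap_restrict[of UNIV UNIV f "\<lambda>i a. i \<le> a"] by simp

text \<open>Twice the kinetic energy: the \<open>a\<close>-th mass has velocity \<open>v + (\<Sum>i\<le>a. l i *\<^sub>R q' i)\<close>.\<close>

lemma energy_eq:
  "energy v p = mass P * (v \<bullet> v) +
    (\<Sum>a\<in>UNIV. link_mass P a * (norm (v + (\<Sum>i\<in>{..a}. link_length P i *\<^sub>R p i)))\<^sup>2)"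
proof -
  define m where "m = link_mass P"
  define u where "u i = link_length P i *\<^sub>R p i" for i
  have 1: "(\<Sum>i\<in>UNIV. M0 P i * (v \<bullet> p i)) = (\<Sum>a\<in>UNIV. m a * (v \<bullet> (\<Sum>i\<in>{..a}. u i)))"
  proof -
    have "(\<Sum>i\<in>UNIV. M0 P i * (v \<bullet> p i)) = (\<Sum>i\<in>UNIV. \<Sum>a\<in>{i..}. m a * (v \<bullet> u i))"
      by (simp add: M0_def m_def u_def sum_distrib_left mult_ac)
    then show ?thesis by (simp add: sum_atLeast_swap inner_sum_right sum_distrib_left)
  qed
  \<comment> \<open>The range of the sum in \<open>Mij\<close> consists of the masses
    \<open>a\<close> to which both links \<open>i\<close> and \<open>j\<close> lead.\<close>
  have 2: "(\<Sum>i\<in>UNIV. \<Sum>j\<in>UNIV. Mij P i j * (p i \<bullet> p j))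
      = (\<Sum>a\<in>UNIV. m a * ((\<Sum>i\<in>{..a}. u i) \<bullet> (\<Sum>i\<in>{..a}. u i)))"
  proof -
    have "(\<Sum>i\<in>UNIV. \<Sum>j\<in>UNIV. Mij P i j * (p i \<bullet> p j))
        = (\<Sum>i\<in>UNIV. \<Sum>j\<in>UNIV. \<Sum>a\<in>UNIV. if i \<le> a \<and> j \<le> a then m a * (u i \<bullet> u j) else 0)"
      by (intro sum.cong refl)
        (simp add: Mij_def m_def u_def sum_distrib_left sum_distrib_right sum.If_cases atLeast_def
          ac_simps)
    also have "\<dots> = (\<Sum>i\<in>UNIV. \<Sum>a\<in>UNIV. \<Sum>j\<in>UNIV. if i \<le> a \<and> j \<le> a then m a * (u i \<bullet> u j) else 0)"
      by (rule sum.cong[OF refl]) (rule sum.swap)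
    also have "\<dots> = (\<Sum>a\<in>UNIV. \<Sum>i\<in>UNIV. \<Sum>j\<in>UNIV. if i \<le> a \<and> j \<le> a then m a * (u i \<bullet> u j) else 0)"
      by (rule sum.swap)
    also have "\<dots> = (\<Sum>a\<in>UNIV. \<Sum>i\<in>{..a}. \<Sum>j\<in>{..a}. m a * (u i \<bullet> u j))"
    proof (rule sum.cong[OF refl])
      fix a
      have "(\<Sum>i\<in>UNIV. \<Sum>j\<in>UNIV. if i \<le> a \<and> j \<le> a then m a * (u i \<bullet> u j) else 0)
         = (\<Sum>i\<in>UNIV. if i \<le> a then (\<Sum>j\<in>UNIV. if j \<le> a then m a * (u i \<bullet> u j) else 0) else 0)"
        by (auto intro!: sum.cong)
      then show "(\<Sum>i\<in>UNIV. \<Sum>j\<in>UNIV. if i \<le> a \<and> j \<le> a then m a * (u i \<bullet> u j) else 0)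
         = (\<Sum>i\<in>{..a}. \<Sum>j\<in>{..a}. m a * (u i \<bullet> u j))"
        by (simp add: sum.If_cases atMost_def)
    qed
    also have "\<dots> = (\<Sum>a\<in>UNIV. m a * (\<Sum>i\<in>{..a}. \<Sum>j\<in>{..a}. u i \<bullet> u j))"
      by (simp add: sum_distrib_left)
    finally show ?thesis unfolding inner_sum_left inner_sum_right
      by (simp add: inner_commute)
  qed
  have "(\<Sum>a\<in>UNIV. m a * (norm (v + (\<Sum>i\<in>{..a}. u i)))\<^sup>2)
     = (\<Sum>a\<in>UNIV. m a * (v \<bullet> v)) + 2 * (\<Sum>a\<in>UNIV. m a * (v \<bullet> (\<Sum>i\<in>{..a}. u i)))
       + (\<Sum>a\<in>UNIV. m a * ((\<Sum>i\<in>{..a}. u i) \<bullet> (\<Sum>i\<in>{..a}. u i)))"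
    unfolding sum_distrib_left sum.distrib[symmetric] power2_norm_eq_inner inner_add_left inner_add_right
    by (intro sum.cong refl) (simp add: inner_commute algebra_simps)
  then show ?thesis
    unfolding energy_def 1 2 M00_def by (simp add: m_def u_def sum_distrib_right distrib_right)
qed

text \<open>Without kinetic energy every mass is at rest: first the quadrotor, then each mass of the
  chain. So all partial sums of \<open>link_length P i *\<^sub>R p i\<close> vanish, and with them
  the summands.\<close>

lemma energy_pos:
  assumes "mass P > 0" and m: "\<And>i. link_mass P i > 0" and l: "\<And>i. link_length P i > 0"
    and "energy v p \<le> 0"
  shows "v = 0" "p i = 0"
proof -
  have nn: "0 \<le> link_mass P a * (norm (v + (\<Sum>i\<in>{..a}. link_length P i *\<^sub>R p i)))\<^sup>2" for a
    using m[of a] by simp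
  have "mass P * (v \<bullet> v) \<ge> 0" using assms(1) by simp
  moreover have S: "(\<Sum>a\<in>UNIV. link_mass P a * (norm (v + (\<Sum>i\<in>{..a}. link_length P i *\<^sub>R p i)))\<^sup>2) \<ge> 0"
    by (intro sum_nonneg nn)
  ultimately have "mass P * (v \<bullet> v) = 0"
    and S0: "(\<Sum>a\<in>UNIV. link_mass P a * (norm (v + (\<Sum>i\<in>{..a}. link_length P i *\<^sub>R p i)))\<^sup>2) = 0"
    using assms(4) unfolding energy_eq by linarith+
  then show v: "v = 0" using assms(1) by simp
  have z: "(\<Sum>i\<in>{..a}. link_length P i *\<^sub>R p i) = 0" for a
  proof -
    have "link_mass P a * (norm (v + (\<Sum>i\<in>{..a}. link_length P i *\<^sub>R p i)))\<^sup>2 \<le> 0"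
      unfolding S0[symmetric]
      using member_le_sum[of a UNIV "\<lambda>a. link_mass P a * (norm (v + (\<Sum>i\<in>{..a}. link_length P i *\<^sub>R p i)))\<^sup>2"] nn
      by simp
    then show ?thesis using m[of a] v by (simp add: mult_le_0_iff)
  qed
  show "p i = 0"
  proof (rule ccontr)
    assume "p i \<noteq> 0"
    \<comment> \<open>Up to the least index with a nonzero summand, the partial sum consists of that
      single summand.\<close>
    define k where "k = Min {i. p i \<noteq> 0}"
    have "k \<in> {i. p i \<noteq> 0}" unfolding k_def by (rule Min_in) (use \<open>p i \<noteq> 0\<close> in auto)
    moreover have below: "p j = 0" if "j < k" for j
    proof (rule ccontr)
      assume "p j \<noteq> 0"
      then have "k \<le> j" unfolding k_def by (intro Min_le) auto
      with that show False by simp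
    qed
    have "(\<Sum>i\<in>{..k}. link_length P i *\<^sub>R p i) = link_length P k *\<^sub>R p k"
    proof -
      have "(\<Sum>i\<in>{..k} - {k}. link_length P i *\<^sub>R p i) = 0"
        by (rule sum.neutral) (auto simp: below)
      then show ?thesis by (simp add: sum.remove[of "{..k}" k])
    qed
    ultimately show False using z[of k] l[of k] by auto
  qed
qed

lemma mass_matrix_mult:
  "mass_matrix P *v block_vector a p = block_vector
     (M00 P *\<^sub>R a - (\<Sum>j\<in>UNIV. M0 P j *\<^sub>R cross3 e3 (C32 *v p j)))
     (\<lambda>i. M0 P i *\<^sub>R (transpose C32 *v cross3 e3 a) + (\<Sum>j\<in>UNIV. Mij P i j *\<^sub>R p j))"
proof -
  have h: "transpose (hat e3) = - hat e3"
    by (simp add: hat_components transpose_def vec_eq_iff forall_3)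
  have "transpose (- (M0 P i *\<^sub>R (hat e3 ** C32))) *v a = M0 P i *\<^sub>R (transpose C32 *v cross3 e3 a)" for i
  proof -
    have "transpose (- (M0 P i *\<^sub>R (hat e3 ** C32))) = - (M0 P i *\<^sub>R transpose (hat e3 ** C32))"
      by (simp add: transpose_def vec_eq_iff)
    also have "\<dots> = - (M0 P i *\<^sub>R (transpose C32 ** (- hat e3)))" by (simp add: matrix_transpose_mul h)
    also have "\<dots> *v a = - (M0 P i *\<^sub>R (transpose C32 *v ((- hat e3) *v a)))"
      by (simp only: bounded_bilinear.minus_left[OF bounded_bilinear_matrix_vector]
          scaleR_matrix_vector_assoc[symmetric] matrix_vector_mul_assoc[symmetric])
    finally show ?thesis
      by (simp add: bounded_bilinear.minus_left[OF bounded_bilinear_matrix_vector]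
          bounded_bilinear.minus_right[OF bounded_bilinear_matrix_vector] hat_mult del: transpose_matrix_vector)
  qed
  then show ?thesis
    unfolding mass_matrix_def block_matrix_mult
    by (simp add: bounded_bilinear.minus_left[OF bounded_bilinear_matrix_vector] sum_negf
        scaleR_matrix_vector_assoc[symmetric] matrix_vector_mul_assoc[symmetric] hat_mult)
qed

lemma gravity_matrix_mult: "gravity_matrix P *v block_vector a p = block_vector 0 (\<lambda>i. Gi P i *\<^sub>R p i)"
proof -
  have "(\<Sum>j\<in>UNIV. (if i = j then Gi P i *\<^sub>R mat 1 else 0) *v p j) = Gi P i *\<^sub>R p i" for i
  proof -
    have "(\<Sum>j\<in>UNIV. (if i = j then Gi P i *\<^sub>R mat 1 else 0) *v p j)
        = (\<Sum>j\<in>UNIV. if i = j then Gi P i *\<^sub>R p j else 0)"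
      by (rule sum.cong) (auto simp: scaleR_matrix_vector_assoc[symmetric])
    then show ?thesis by simp
  qed
  then show ?thesis unfolding gravity_matrix_def block_matrix_mult by simp
qed

text \<open>The quadratic form of the mass matrix is the kinetic energy in the hanging
  configuration. Positivity of the energy leaves only the trivial kernel, and a square matrix with
  trivial kernel is invertible.\<close>

lemma mass_matrix_inverse:
  assumes "mass P > 0" "\<And>i. link_mass P i > 0" "\<And>i. link_length P i > 0"
  obtains Mi where "\<And>z. mass_matrix P *v (Mi *v z) = z" "\<And>z. Mi *v (mass_matrix P *v z) = z"
proof -
  have "z = 0" if z: "mass_matrix P *v z = 0" for z
  proof -
    obtain a p where zb: "z = block_vector a p" by (rule block_vector_surj)
    \<comment> \<open>A link along \<open>e3\<close> with angular velocity \<open>C32 *v p i\<close>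
      moves with velocity \<open>q i\<close>. The map from \<open>p i\<close> to \<open>q i\<close>
      preserves inner products, which turns the quadratic form into
      \<open>energy P a q\<close>.\<close>
    define q where "q i = - cross3 e3 (C32 *v p i)" for i
    have e3C: "cross3 e3 (C32 *v x) \<bullet> cross3 e3 (C32 *v y) = x \<bullet> y" for x y
      by (simp add: cross3_def inner_vec_def sum_3 sum_2 C32_nth axis_def)
    have aq: "a \<bullet> q i = (transpose C32 *v cross3 e3 a) \<bullet> p i" for i
      by (simp add: q_def cross3_def inner_vec_def sum_3 sum_2 C32_nth transpose_C32_nth axis_def algebra_simps
          del: transpose_matrix_vector)
    have qq: "q i \<bullet> q j = p i \<bullet> p j" for i j
      using e3C[of "p i" "p j"] by (simp add: q_def)
    have "a \<bullet> (M00 P *\<^sub>R a - (\<Sum>j\<in>UNIV. M0 P j *\<^sub>R cross3 e3 (C32 *v p j))) =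
        M00 P * (a \<bullet> a) + (\<Sum>j\<in>UNIV. M0 P j * (a \<bullet> q j))"
      by (simp add: inner_diff_right inner_sum_right q_def sum_negf)
    moreover have "p i \<bullet> (M0 P i *\<^sub>R (transpose C32 *v cross3 e3 a) + (\<Sum>j\<in>UNIV. Mij P i j *\<^sub>R p j)) =
        M0 P i * (a \<bullet> q i) + (\<Sum>j\<in>UNIV. Mij P i j * (q i \<bullet> q j))" for i
      unfolding inner_add_right inner_sum_right inner_scaleR_right aq qq by (simp add: inner_commute)
    ultimately have "z \<bullet> (mass_matrix P *v z) = energy a q"
      unfolding zb mass_matrix_mult inner_block_vector energy_def by (simp add: sum.distrib)
    then have "energy a q \<le> 0" using z by simp
    note e0 = energy_pos[OF assms this]
    have "p i = 0" for i using qq[of i i] e0(2)[of i] by simp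
    then have "p = (\<lambda>i. 0)" by blast
    then show "z = 0" using zb block_vector_zero e0(1) by simp
  qed
  then have "\<exists>B. B ** mass_matrix P = mat 1" by (simp add: matrix_left_invertible_ker)
  then obtain Mi where "Mi ** mass_matrix P = mat 1" by blast
  moreover from this have "mass_matrix P ** Mi = mat 1" by (simp add: matrix_left_right_inverse)
  ultimately show thesis by (intro that[of Mi]) (simp_all add: matrix_vector_mul_assoc)
qed

end

section \<open>Commanded attitude and attitude errors\<close>

lemma differentiable_bilinear:
  assumes h: "bounded_bilinear h" and "f differentiable (at x within S)" "g differentiable (at x within S)"
  shows "(\<lambda>t. h (f t) (g t)) differentiable (at x within S)"
proof -
  obtain f' g' where "(f has_derivative f') (at x within S)" "(g has_derivative g') (at x within S)"
    using assms(2,3) by (auto simp: differentiable_def)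
  from bounded_bilinear.FDERIV[OF h this] show ?thesis by (rule differentiableI)
qed

lemma differentiable_linear:
  assumes "bounded_linear h" "f differentiable F"
  shows "(\<lambda>t. h (f t)) differentiable F"
  using assms bounded_linear.has_derivative unfolding differentiable_def by blast

lemma norm_cross_le: "norm (cross3 x y) \<le> norm x * norm y"
proof -
  have "(norm (cross3 x y))\<^sup>2 \<le> (norm x * norm y)\<^sup>2"
    using norm_cross_dot[of x y] zero_le_power2[of "x \<bullet> y"] by linarith
  then show ?thesis by (rule power2_le_imp_le) simp
qed

text \<open>Being built from products of \<open>x\<close>, \<open>d\<close> and
  \<open>inverse (norm x)\<close>, this derivative can be differentiated once more by product
  rules.\<close>

definition sgn_deriv :: "'a::real_inner \<Rightarrow> 'a \<Rightarrow> 'a" where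
  "sgn_deriv x d = inverse (norm x) *\<^sub>R d - ((x \<bullet> d) * inverse (norm x) ^ 3) *\<^sub>R x"

lemma has_real_derivative_inverse_norm:
  fixes f :: "real \<Rightarrow> 'a::real_inner"
  assumes f: "(f has_vector_derivative f') (at t within T)" and "f t \<noteq> 0"
  shows "((\<lambda>t. inverse (norm (f t))) has_real_derivative - ((f t \<bullet> f') * inverse (norm (f t)) ^ 3)) (at t within T)"
proof -
  have pos: "f t \<bullet> f t > 0" "norm (f t) > 0" using \<open>f t \<noteq> 0\<close> by simp_all
  have "((\<lambda>t. f t \<bullet> f t) has_real_derivative 2 * (f t \<bullet> f')) (at t within T)"
    unfolding has_real_derivative_iff_has_vector_derivative
    using bounded_bilinear.has_vector_derivative[OF bounded_bilinear_inner f f] by (simp add: inner_commute)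
  from DERIV_chain2[OF DERIV_real_sqrt[OF pos(1)] this]
  have "((\<lambda>t. norm (f t)) has_real_derivative (f t \<bullet> f') * inverse (norm (f t))) (at t within T)"
    by (simp add: norm_eq_sqrt_inner field_simps)
  from DERIV_inverse'[OF this] pos(2) show ?thesis
    by (simp add: power3_eq_cube algebra_simps)
qed

lemma has_vector_derivative_sgn:
  fixes f :: "real \<Rightarrow> 'a::real_inner"
  assumes f: "(f has_vector_derivative f') (at t within T)" and "f t \<noteq> 0"
  shows "((\<lambda>t. sgn (f t)) has_vector_derivative sgn_deriv (f t) f') (at t within T)"
  using has_vector_derivative_scaleR[OF has_real_derivative_inverse_norm[OF assms] f]
  by (simp add: sgn_deriv_def sgn_div_norm scaleR_left_diff_distrib algebra_simps)

lemma norm_sgn_deriv_le: "norm (sgn_deriv x d) \<le> 2 / norm x * norm d"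
proof (cases "x = 0")
  case False
  have "norm (sgn_deriv x d) \<le> inverse (norm x) * norm d + \<bar>x \<bullet> d\<bar> * inverse (norm x) ^ 3 * norm x"
    unfolding sgn_deriv_def by (rule norm_triangle_le_diff) (simp add: abs_mult power_abs)
  also have "\<bar>x \<bullet> d\<bar> * inverse (norm x) ^ 3 * norm x \<le> (norm x * norm d) * inverse (norm x) ^ 3 * norm x"
    by (intro mult_right_mono Cauchy_Schwarz_ineq2) auto
  also have "\<dots> = inverse (norm x) * norm d" using False by (simp add: power3_eq_cube field_simps)
  finally show ?thesis by (simp add: divide_inverse mult.commute)
qed (simp add: sgn_deriv_def)

lemma differentiable_inverse_norm:
  fixes f :: "real \<Rightarrow> 'a::real_inner"
  assumes "f differentiable (at t within T)" "f t \<noteq> 0"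
  shows "(\<lambda>t. inverse (norm (f t))) differentiable (at t within T)"
proof -
  obtain f' where "(f has_vector_derivative f') (at t within T)"
    using assms(1) vector_derivative_works by blast
  from has_real_derivative_inverse_norm[OF this assms(2)] show ?thesis
    unfolding has_field_derivative_def by (rule differentiableI)
qed

lemma differentiable_sgn_deriv:
  fixes f g :: "real \<Rightarrow> 'a::real_inner"
  assumes "f differentiable (at t within T)" "g differentiable (at t within T)" "f t \<noteq> 0"
  shows "(\<lambda>t. sgn_deriv (f t) (g t)) differentiable (at t within T)"
    and "(\<lambda>t. sgn (f t)) differentiable (at t within T)"
  unfolding sgn_deriv_def sgn_div_norm power3_eq_cube
  by (intro differentiable_diff differentiable_bilinear[OF bounded_bilinear_scaleR] differentiable_mult
      differentiable_bilinear[OF bounded_bilinear_inner] differentiable_inverse_norm assms)+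

definition cols :: "real^3 \<Rightarrow> real^3 \<Rightarrow> real^3 \<Rightarrow> real^3^3" where
  "cols a b c = transpose (vector [a, b, c])"

lemma cols_nth: "cols a b c $ i $ 1 = a $ i" "cols a b c $ i $ 2 = b $ i" "cols a b c $ i $ 3 = c $ i"
  by (simp_all add: cols_def transpose_def)

lemma cols_e3: "cols a b c *v e3 = c"
  by (simp add: vec_eq_iff matrix_vector_mult_def sum_3 cols_nth axis_def)

lemma bounded_linear_cols: "bounded_linear (\<lambda>x. cols (fst x) (fst (snd x)) (snd (snd x)))"
  unfolding linear_conv_bounded_linear[symmetric]
  by (rule linearI) (simp_all add: vec_eq_iff forall_3 cols_nth)

lemma norm_cols_bound: obtains C where "0 < C" "\<And>a b c. norm (cols a b c) \<le> C * (norm a + norm b + norm c)"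
proof -
  obtain C where C: "0 < C" "\<And>x. norm (cols (fst x) (fst (snd x)) (snd (snd x))) \<le> norm x * C"
    using bounded_linear.pos_bounded[OF bounded_linear_cols] by blast
  have "norm (cols a b c) \<le> C * (norm a + norm b + norm c)" for a b c
  proof -
    have "norm (a, b, c) \<le> norm a + norm b + norm c"
      using norm_Pair_le[of a "(b, c)"] norm_Pair_le[of b c] by linarith
    then have "norm (a, b, c) * C \<le> (norm a + norm b + norm c) * C" using C(1) by simp
    with C(2)[of "(a, b, c)"] show ?thesis by (simp add: mult.commute)
  qed
  with C(1) show thesis by (rule that)
qed

text \<open>The determinant is the triple product of the columns, that is, the squared length of
  \<open>cross3 b c\<close>, which is 1 for orthonormal \<open>b\<close> and
  \<open>c\<close>.\<close>

lemma rotation_matrix_cols: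
  assumes "norm b = 1" "norm c = 1" "b \<bullet> c = 0"
  shows "rotation_matrix (cols (cross3 b c) b c)"
proof -
  have bb: "b \<bullet> b = 1" and cc: "c \<bullet> c = 1" using assms by (simp_all add: norm_eq_1)
  have aa: "cross3 b c \<bullet> cross3 b c = 1"
    using norm_cross_dot[of b c] assms by (simp add: power2_norm_eq_inner)
  have "transpose (cols (cross3 b c) b c) ** cols (cross3 b c) b c = mat 1"
    using bb cc aa assms(3) dot_cross_self[of b c] dot_cross_self[of c b]
    by (simp add: vec_eq_iff forall_3 matrix_matrix_mult_def sum_3 transpose_def cols_nth mat_def inner_vec_def
        algebra_simps)
  moreover have "det (cols (cross3 b c) b c) = 1"
    by (simp add: cols_def dot_cross_det[symmetric] aa)
  ultimately show ?thesis by (simp add: rotation_matrix_def orthogonal_matrix)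
qed

text \<open>The commanded attitude as a function of the virtual force \<open>A\<close>: since \<open>b\<^sub>3\<^sub>c\<close> is a unit vector
  orthogonal to \<open>b\<^sub>3\<^sub>c \<times> h\<close>, the first column is the cross product of the other two.\<close>

definition commanded :: "real^3 \<Rightarrow> real^3 \<Rightarrow> real^3^3" where
  "commanded h A = cols (cross3 (sgn (cross3 h A)) (sgn (- A))) (sgn (cross3 h A)) (sgn (- A))"

definition commanded_deriv :: "real^3 \<Rightarrow> real^3 \<Rightarrow> real^3 \<Rightarrow> real^3^3" where
  "commanded_deriv h A D = cols
     (cross3 (sgn (cross3 h A)) (sgn_deriv (- A) (- D)) + cross3 (sgn_deriv (cross3 h A) (cross3 h D)) (sgn (- A)))
     (sgn_deriv (cross3 h A) (cross3 h D)) (sgn_deriv (- A) (- D))"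

lemma rotation_matrix_commanded:
  assumes "cross3 h A \<noteq> 0"
  shows "rotation_matrix (commanded h A)"
proof -
  have "A \<noteq> 0" using assms by auto
  then show ?thesis
    unfolding commanded_def using assms
    by (intro rotation_matrix_cols) (simp_all add: norm_sgn sgn_div_norm dot_cross_self)
qed

lemma commanded_e3: "commanded h A *v e3 = sgn (- A)"
  by (simp add: commanded_def cols_e3)

lemma has_vector_derivative_commanded:
  assumes A: "(A has_vector_derivative A') (at t within T)" and "cross3 h (A t) \<noteq> 0"
  shows "((\<lambda>t. commanded h (A t)) has_vector_derivative commanded_deriv h (A t) A') (at t within T)"
proof -
  have "A t \<noteq> 0" using assms(2) by auto
  have b: "((\<lambda>t. sgn (- A t)) has_vector_derivative sgn_deriv (- A t) (- A')) (at t within T)"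
    by (rule has_vector_derivative_sgn) (use A \<open>A t \<noteq> 0\<close> in \<open>auto intro: derivative_intros\<close>)
  have "((\<lambda>t. cross3 h (A t)) has_vector_derivative cross3 h A') (at t within T)"
    by (rule bounded_linear.has_vector_derivative[OF bounded_bilinear.bounded_linear_right[OF bounded_bilinear_cross3] A])
  from has_vector_derivative_sgn[OF this assms(2)]
  have c: "((\<lambda>t. sgn (cross3 h (A t))) has_vector_derivative sgn_deriv (cross3 h (A t)) (cross3 h A')) (at t within T)" .
  have a: "((\<lambda>t. cross3 (sgn (cross3 h (A t))) (sgn (- A t))) has_vector_derivative
      (cross3 (sgn (cross3 h (A t))) (sgn_deriv (- A t) (- A')) + cross3 (sgn_deriv (cross3 h (A t)) (cross3 h A')) (sgn (- A t))))
      (at t within T)"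
    by (rule bounded_bilinear.has_vector_derivative[OF bounded_bilinear_cross3 c b])
  show ?thesis
    unfolding commanded_def commanded_deriv_def
    using bounded_linear.has_vector_derivative[OF bounded_linear_cols
        has_vector_derivative_Pair[OF a has_vector_derivative_Pair[OF c b]]] by simp
qed

text \<open>Existence of the second derivative of the commanded attitude is what the closed loop
  demands; its value cancels in the attitude error and is never computed.\<close>

lemma differentiable_commanded_deriv:
  fixes A D :: "real \<Rightarrow> real^3"
  assumes A: "A differentiable (at t within T)" "D differentiable (at t within T)" and "cross3 h (A t) \<noteq> 0"
  shows "(\<lambda>t. commanded_deriv h (A t) (D t)) differentiable (at t within T)"
    and "(\<lambda>t. commanded h (A t)) differentiable (at t within T)"
proof -
  have "A t \<noteq> 0" using assms(3) by auto
  note cross = differentiable_bilinear[OF bounded_bilinear_cross3]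
  have mA: "(\<lambda>t. - A t) differentiable (at t within T)" "(\<lambda>t. - D t) differentiable (at t within T)" "- A t \<noteq> 0"
    using A \<open>A t \<noteq> 0\<close> by auto
  have hA: "(\<lambda>t. cross3 h (A t)) differentiable (at t within T)" "(\<lambda>t. cross3 h (D t)) differentiable (at t within T)"
    by (intro cross differentiable_const A)+
  note s = differentiable_sgn_deriv[of "\<lambda>t. - A t" t T "\<lambda>t. - D t", OF mA]
    differentiable_sgn_deriv[of "\<lambda>t. cross3 h (A t)" t T "\<lambda>t. cross3 h (D t)", OF hA assms(3)]
  show "(\<lambda>t. commanded_deriv h (A t) (D t)) differentiable (at t within T)"
    unfolding commanded_deriv_def
    using differentiable_linear[OF bounded_linear_cols differentiable_Pair[OF
        differentiable_add[OF cross[OF s(4) s(1)] cross[OF s(3) s(2)]] differentiable_Pair[OF s(3) s(1)]]] by simp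
  show "(\<lambda>t. commanded h (A t)) differentiable (at t within T)"
    unfolding commanded_def
    using differentiable_linear[OF bounded_linear_cols differentiable_Pair[OF
        cross[OF s(4) s(2)] differentiable_Pair[OF s(4) s(2)]]] by simp
qed

lemma lip_commanded:
  assumes "0 < c" "bounded S" "\<And>A. A \<in> S \<Longrightarrow> c \<le> norm (cross3 h A)" "\<And>A. A \<in> S \<Longrightarrow> c \<le> norm A"
  shows "lip S (commanded h)"
proof -
  have s: "lip S (\<lambda>A. sgn (- A))"
    using assms by (intro lip_sgn[of _ _ c] lip_intros) auto
  have u: "lip S (\<lambda>A. sgn (cross3 h A))"
    using assms by (intro lip_sgn[of _ _ c] lip_cross3 lip_intros) auto
  have "lip S (\<lambda>A. cols (cross3 (sgn (cross3 h A)) (sgn (- A))) (sgn (cross3 h A)) (sgn (- A)))"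
    using lip_linear[OF bounded_linear_cols lip_Pair[OF lip_cross3[OF assms(2) u s] lip_Pair[OF u s]]] by simp
  then show ?thesis unfolding commanded_def[abs_def] .
qed

lemma norm_commanded_deriv_le:
  assumes "0 < c"
  obtains C where "0 < C" "\<And>A D. c \<le> norm (cross3 h A) \<Longrightarrow> c \<le> norm A \<Longrightarrow> norm (commanded_deriv h A D) \<le> C * norm D"
proof -
  obtain K where K: "0 < K" "\<And>a b c. norm (cols a b c) \<le> K * (norm a + norm b + norm c)"
    using norm_cols_bound by blast
  have "norm (commanded_deriv h A D) \<le> (K * (4 / c * (norm h + 1))) * norm D"
    if A: "c \<le> norm (cross3 h A)" "c \<le> norm A" for A D
  proof -
    have d: "norm (sgn_deriv x d) \<le> 2 / c * norm d" if "c \<le> norm x" for x d :: "real^3"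
    proof -
      have "2 / norm x * norm d \<le> 2 / c * norm d"
        using that assms by (intro mult_right_mono divide_left_mono mult_pos_pos) auto
      then show ?thesis using norm_sgn_deriv_le[of x d] by linarith
    qed
    have 1: "norm (sgn_deriv (- A) (- D)) \<le> 2 / c * norm D" using d[of "- A" "- D"] A by simp
    have "norm (sgn_deriv (cross3 h A) (cross3 h D)) \<le> 2 / c * norm (cross3 h D)" by (rule d[OF A(1)])
    also have "\<dots> \<le> 2 / c * (norm h * norm D)" using norm_cross_le[of h D] assms by (intro mult_left_mono) auto
    finally have 2: "norm (sgn_deriv (cross3 h A) (cross3 h D)) \<le> 2 / c * norm h * norm D" by simp
    have s: "norm (sgn x) \<le> 1" for x :: "real^3" by (simp add: norm_sgn)
    have 3: "norm (cross3 (sgn x) y) \<le> norm y" "norm (cross3 y (sgn x)) \<le> norm y" for x y :: "real^3"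
      using norm_cross_le[of "sgn x" y] norm_cross_le[of y "sgn x"] s[of x]
        mult_right_mono[OF s[of x], of "norm y"] by (auto simp: mult.commute)
    have "norm (commanded_deriv h A D) \<le> K * (norm (sgn_deriv (- A) (- D)) + norm (sgn_deriv (cross3 h A) (cross3 h D))
        + norm (sgn_deriv (cross3 h A) (cross3 h D)) + norm (sgn_deriv (- A) (- D)))"
      unfolding commanded_deriv_def
      by (rule order_trans[OF K(2) mult_left_mono])
        (use K(1) in \<open>auto intro!: norm_triangle_le add_mono 3\<close>)
    also have "\<dots> \<le> K * (2 / c * norm D + 2 / c * norm h * norm D + 2 / c * norm h * norm D + 2 / c * norm D)"
      using 1 2 K(1) by (intro mult_left_mono add_mono) auto
    finally show ?thesis by (simp add: algebra_simps add_divide_distrib)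
  qed
  moreover have "0 < K * (4 / c * (norm h + 1))"
    using K(1) assms by (auto intro!: mult_pos_pos divide_pos_pos add_nonneg_pos)
  ultimately show thesis using that by blast
qed

section \<open>Rotations and the kinematics of the attitude error\<close>

lemma rotation_matrix_inverse:
  assumes "rotation_matrix Q"
  shows "transpose Q ** Q = mat 1" "Q ** transpose Q = mat 1"
  using assms by (simp_all add: rotation_matrix_def orthogonal_matrix_def)

lemma rotation_matrix_mult:
  fixes A B :: "real^'n^'n"
  shows "rotation_matrix A \<Longrightarrow> rotation_matrix B \<Longrightarrow> rotation_matrix (A ** B)"
  using orthogonal_matrix_mul[of A B] by (simp add: rotation_matrix_def det_mul)

lemma rotation_matrix_transpose: "rotation_matrix A \<Longrightarrow> rotation_matrix (transpose A)"
  by (simp add: rotation_matrix_def)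

text \<open>Rotations preserve cross products, and \<open>v\<close> is the image under
  \<open>Q\<close> of \<open>transpose Q *v v\<close>.\<close>

lemma hat_mult_rotation:
  assumes "rotation_matrix Q"
  shows "hat v ** Q = Q ** hat (transpose Q *v v)"
proof -
  have "hat v *v (Q *v x) = Q *v (hat (transpose Q *v v) *v x)" for x
  proof -
    have "Q *v (transpose Q *v v) = v"
      using rotation_matrix_inverse(2)[OF assms] by (metis matrix_vector_mul_assoc matrix_vector_mul_lid)
    then show ?thesis
      unfolding hat_mult cross_rotation_matrix[OF assms, symmetric] by simp
  qed
  then show ?thesis by (simp add: matrix_eq matrix_vector_mul_assoc[symmetric] del: transpose_matrix_vector)
qed

lemma transpose_hat: "transpose (hat x) = - hat x"
  by (simp add: hat_components transpose_def vec_eq_iff forall_3)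

text \<open>Differentiate the constant product \<open>transpose (R t) ** R t\<close>. Skewness
  guarantees that \<open>vee\<close> loses nothing, so the angular velocity determines the
  derivative of the attitude.\<close>

lemma skew_of_orthogonal_curve:
  assumes "(R has_vector_derivative R') (at t within T)" "at t within T \<noteq> bot" "t \<in> T"
    and orth: "\<And>t. t \<in> T \<Longrightarrow> transpose (R t) ** R t = mat 1"
  shows "transpose (transpose (R t) ** R') = - (transpose (R t) ** R' :: real^3^3)"
proof -
  have "((\<lambda>t. transpose (R t) ** R t) has_vector_derivative (transpose (R t) ** R' + transpose R' ** R t)) (at t within T)"
    by (rule bounded_bilinear.has_vector_derivative[OF bounded_bilinear_matrix_mult
        bounded_linear.has_vector_derivative[OF bounded_linear_transpose assms(1)] assms(1)])
  moreover have "((\<lambda>t. transpose (R t) ** R t) has_vector_derivative 0) (at t within T)"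
    by (rule has_vector_derivative_transform[OF assms(3) _ has_vector_derivative_const[of "mat 1"]]) (simp add: orth)
  ultimately have "transpose (R t) ** R' + transpose R' ** R t = 0"
    by (rule vector_derivative_unique_within[OF assms(2)])
  then show ?thesis by (simp add: matrix_transpose_mul eq_neg_iff_add_eq_0 add.commute)
qed

text \<open>With \<open>Q\<close> for the attitude error, the product rule gives
  \<open>Q ** hat Om - hat Omd ** Q\<close>. Moving \<open>hat Omd\<close> across the rotation
  \<open>Q\<close> turns \<open>Omd\<close> into \<open>transpose Q *v Omd\<close>, the vector
  subtracted in \<open>e_Om\<close>.\<close>

lemma attitude_error_derivative:
  assumes "(Rd has_vector_derivative Rd t ** hat Omd) (at t within T)"
    and "(R has_vector_derivative R t ** hat Om) (at t within T)"
    and "rotation_matrix (Rd t)" "rotation_matrix (R t)"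
  shows "((\<lambda>t. transpose (Rd t) ** R t) has_vector_derivative
      (transpose (Rd t) ** R t) ** hat (e_Om (Rd t) Omd (R t) Om)) (at t within T)"
proof -
  define Q where "Q = transpose (Rd t) ** R t"
  have Q: "rotation_matrix Q"
    unfolding Q_def by (intro rotation_matrix_mult rotation_matrix_transpose assms)
  have "((\<lambda>t. transpose (Rd t) ** R t) has_vector_derivative
      (transpose (Rd t) ** (R t ** hat Om) + transpose (Rd t ** hat Omd) ** R t)) (at t within T)"
    by (rule bounded_bilinear.has_vector_derivative[OF bounded_bilinear_matrix_mult
        bounded_linear.has_vector_derivative[OF bounded_linear_transpose assms(1)] assms(2)])
  moreover have "transpose (Rd t ** hat Omd) ** R t = - (hat Omd ** Q)"
    by (simp add: Q_def matrix_transpose_mul transpose_hat matrix_mul_assoc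
        bounded_bilinear.minus_left[OF bounded_bilinear_matrix_mult])
  moreover have "transpose (Rd t) ** (R t ** hat Om) = Q ** hat Om" by (simp add: Q_def matrix_mul_assoc)
  moreover have "Q ** hat Om + - (hat Omd ** Q) = Q ** hat (e_Om (Rd t) Omd (R t) Om)"
  proof -
    have tQ: "transpose (R t) ** Rd t = transpose Q" by (simp add: Q_def matrix_transpose_mul)
    show ?thesis
      unfolding e_Om_def tQ hat_mult_rotation[OF Q] linear_diff[OF bounded_linear.linear[OF bounded_linear_hat]]
        bounded_bilinear.diff_right[OF bounded_bilinear_matrix_mult] by simp
  qed
  ultimately show ?thesis by (simp add: Q_def)
qed

text \<open>\<open>e_R\<close> sees only the skew part of \<open>X = Q - mat 1\<close>.
  Orthogonality of \<open>Q\<close> makes \<open>X + transpose X\<close> equal to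
  \<open>- (transpose X ** X)\<close>, which is quadratic, so for small \<open>X\<close> the skew
  part controls everything. The last estimate states that the derivative of \<open>e_R\<close> is
  \<open>e\<close> to first order.\<close>

lemma rotation_error_bound:
  obtains r C where "0 < r" "0 < C"
    "\<And>Rd R. rotation_matrix Rd \<Longrightarrow> rotation_matrix R \<Longrightarrow> norm (transpose Rd ** R - mat 1) \<le> r \<Longrightarrow>
      norm (transpose Rd ** R - mat 1) \<le> C * norm (e_R Rd R)"
    "\<And>Rd R. norm (e_R Rd R) \<le> C * norm (transpose Rd ** R - mat 1)"
    "\<And>Q e. norm ((1/2) *\<^sub>R vee (Q ** hat e + hat e ** transpose Q) - e) \<le> C * norm (Q - mat 1) * norm e"
proof -
  obtain m where m: "0 < m" "\<And>(A::real^3^3) (B::real^3^3). norm (A ** B) \<le> norm A * norm B * m"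
    using bounded_bilinear.pos_bounded[OF bounded_bilinear_matrix_mult] by blast
  obtain h where h: "0 < h" "\<And>x. norm (hat x) \<le> norm x * h"
    using bounded_linear.pos_bounded[OF bounded_linear_hat] by blast
  obtain v where v: "0 < v" "\<And>x. norm (vee x) \<le> norm x * v"
    using bounded_linear.pos_bounded[OF bounded_linear_vee] by blast
  obtain \<tau> where \<tau>: "0 < \<tau>" "\<And>x :: real^3^3. norm (transpose x) \<le> norm x * \<tau>"
    using bounded_linear.pos_bounded[OF bounded_linear_transpose] by blast
  define C where "C = max (2 * h) (max (v * (1 + \<tau>)) (v * h * m * (1 + \<tau>)))"
  have C: "0 < C" "2 * h \<le> C" "v * (1 + \<tau>) \<le> C" "v * h * m * (1 + \<tau>) \<le> C"
    using h(1) by (auto simp: C_def less_max_iff_disj)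
  have tr1: "transpose (Q - mat 1) = transpose Q - mat 1" for Q :: "real^3^3"
    by (simp add: linear_diff[OF bounded_linear.linear[OF bounded_linear_transpose]])
  \<comment> \<open>Within this radius \<open>norm (transpose X ** X) \<le> norm X\<close>, so the
    quadratic term is absorbed by one of the two copies of \<open>X\<close> in
    \<open>2 *\<^sub>R X\<close>.\<close>
  show thesis
  proof (rule that[of "1 / (\<tau> * m)" C])
    show "0 < 1 / (\<tau> * m)" using \<tau> m by simp
    fix Rd R :: "real^3^3"
    define Q X where "Q = transpose Rd ** R" and "X = Q - mat 1"
    have eR: "e_R Rd R = (1/2) *\<^sub>R vee (X - transpose X)"
      by (simp add: e_R_def X_def tr1 Q_def matrix_transpose_mul)
    have tX: "norm (transpose X) \<le> \<tau> * norm X" using \<tau>(2)[of X] by (simp add: mult.commute)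
    have "norm (vee (X - transpose X)) \<le> norm (X - transpose X) * v" by (rule v)
    also have "norm (X - transpose X) \<le> norm X + \<tau> * norm X"
      by (rule norm_triangle_le_diff) (use tX in simp)
    finally have "norm (vee (X - transpose X)) \<le> (v * (1 + \<tau>)) * norm X"
      using v(1) by (simp add: algebra_simps)
    also have "\<dots> \<le> C * norm X" using C by (intro mult_right_mono) auto
    finally have "norm (vee (X - transpose X)) \<le> C * norm X" .
    then show "norm (e_R Rd R) \<le> C * norm (transpose Rd ** R - mat 1)"
      unfolding eR Q_def[symmetric] X_def[symmetric] norm_scaleR
      using norm_ge_zero[of "vee (X - transpose X)"] by linarith
    assume rot: "rotation_matrix Rd" "rotation_matrix R" and small: "norm (transpose Rd ** R - mat 1) \<le> 1 / (\<tau> * m)"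
    have "transpose Q ** Q = mat 1"
      unfolding Q_def by (intro rotation_matrix_inverse rotation_matrix_mult rotation_matrix_transpose rot)
    then have "X + transpose X + transpose X ** X = 0"
      by (simp add: X_def tr1 bounded_bilinear.diff_left[OF bounded_bilinear_matrix_mult]
          bounded_bilinear.diff_right[OF bounded_bilinear_matrix_mult])
    then have "2 *\<^sub>R X = (X - transpose X) - transpose X ** X"
      by (simp add: scaleR_2 algebra_simps eq_neg_iff_add_eq_0)
    moreover have "X - transpose X = hat (2 *\<^sub>R e_R Rd R)"
      unfolding eR by (simp add: hat_vee linear_diff[OF bounded_linear.linear[OF bounded_linear_transpose]])
    ultimately have "2 * norm X \<le> norm (hat (2 *\<^sub>R e_R Rd R)) + norm (transpose X ** X)"
      using norm_triangle_ineq4[of "hat (2 *\<^sub>R e_R Rd R)" "transpose X ** X"] by (metis norm_scaleR abs_numeral)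
    also have "norm (hat (2 *\<^sub>R e_R Rd R)) \<le> 2 * h * norm (e_R Rd R)"
      using h(2)[of "2 *\<^sub>R e_R Rd R"] by (simp add: mult_ac)
    also have "norm (transpose X ** X) \<le> norm X"
    proof -
      have "norm (transpose X ** X) \<le> norm (transpose X) * norm X * m" by (rule m)
      also have "\<dots> \<le> (\<tau> * norm X) * norm X * m" using tX m(1) by (intro mult_right_mono) auto
      also have "\<dots> = norm X * ((\<tau> * m) * norm X)" by simp
      also have "\<dots> \<le> norm X * 1"
        using small \<tau> m unfolding Q_def[symmetric] X_def[symmetric]
        by (intro mult_left_mono) (auto simp: field_simps)
      finally show ?thesis by simp
    qed
    finally have "norm X \<le> 2 * h * norm (e_R Rd R)" by simp
    also have "\<dots> \<le> C * norm (e_R Rd R)" using C by (intro mult_right_mono) auto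
    finally show "norm (transpose Rd ** R - mat 1) \<le> C * norm (e_R Rd R)" by (simp add: X_def Q_def)
  next
    fix Q :: "real^3^3" and e
    define X where "X = Q - mat 1"
    have tX: "norm (transpose X) \<le> \<tau> * norm X" using \<tau>(2)[of X] by (simp add: mult.commute)
    have "Q ** hat e + hat e ** transpose Q = (X ** hat e + hat e ** transpose X) + (hat e + hat e)"
      by (simp add: X_def tr1 bounded_bilinear.diff_left[OF bounded_bilinear_matrix_mult]
          bounded_bilinear.diff_right[OF bounded_bilinear_matrix_mult])
    then have "(1/2) *\<^sub>R vee (Q ** hat e + hat e ** transpose Q) - e = (1/2) *\<^sub>R vee (X ** hat e + hat e ** transpose X)"
    proof -
      assume *: "Q ** hat e + hat e ** transpose Q = (X ** hat e + hat e ** transpose X) + (hat e + hat e)"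
      show ?thesis
        unfolding * linear_add[OF bounded_linear.linear[OF bounded_linear_vee]] vee_hat scaleR_2[symmetric]
        by (simp add: scaleR_add_right linear_scale[OF bounded_linear.linear[OF bounded_linear_vee]] vee_hat)
    qed
    moreover have "norm (vee (X ** hat e + hat e ** transpose X)) \<le> C * norm X * norm e"
    proof -
      have "norm (X ** hat e + hat e ** transpose X) \<le> norm X * (norm e * h) * m + (norm e * h) * (\<tau> * norm X) * m"
        by (rule norm_triangle_le)
          (use m(1) h(1) \<tau>(1) tX h(2)[of e] in \<open>auto intro!: add_mono order_trans[OF m(2)] mult_mono\<close>)
      then have "norm (X ** hat e + hat e ** transpose X) * v \<le> (norm X * (norm e * h) * m + (norm e * h) * (\<tau> * norm X) * m) * v"
        using v(1) by simp
      also have "\<dots> = (v * h * m * (1 + \<tau>)) * (norm X * norm e)" by (simp add: algebra_simps)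
      also have "\<dots> \<le> C * (norm X * norm e)" using C by (intro mult_right_mono) auto
      finally show ?thesis using v(2)[of "X ** hat e + hat e ** transpose X"] by simp
    qed
    ultimately show "norm ((1/2) *\<^sub>R vee (Q ** hat e + hat e ** transpose Q) - e) \<le> C * norm (Q - mat 1) * norm e"
      unfolding X_def[symmetric]
      using order_trans[of "norm ((1/2) *\<^sub>R y)" "norm y" "C * norm X * norm e" for y :: "real^3"] by auto
  qed (rule C)
qed

section \<open>Equations of motion near the equilibrium\<close>

lemma bounded_linear_block_vector:
  "bounded_linear (\<lambda>x. block_vector (fst x) (\<lambda>i. snd x $ i) :: real^(3 + 'n::finite \<times> 2))"
  unfolding linear_conv_bounded_linear[symmetric]
  by (rule linearI) (auto simp: block_vector_def vec_eq_iff split: sum.split)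

lemma lip_block_vector [lip_intros]:
  fixes f :: "'a::real_normed_vector \<Rightarrow> real^3"
  assumes "lip S f" "\<And>i. lip S (g i)"
  shows "lip S (\<lambda>s. block_vector (f s) (\<lambda>i. g i s))"
  using lip_linear[OF bounded_linear_block_vector lip_Pair[OF assms(1) lip_vec[of S g, OF assms(2)]]] by simp

lemma lip_matrix_right [lip_intros]: "lip S f \<Longrightarrow> lip S (\<lambda>s. A *v f s)"
  for f :: "'a::real_normed_vector \<Rightarrow> real^'m"
  by (rule lip_linear[OF bounded_bilinear.bounded_linear_right[OF bounded_bilinear_matrix_vector]])

lemma lip_cross_right [lip_intros]: "lip S f \<Longrightarrow> lip S (\<lambda>s. cross3 a (f s))"
  for f :: "'a::real_normed_vector \<Rightarrow> real^3"
  by (rule lip_linear[OF bounded_bilinear.bounded_linear_right[OF bounded_bilinear_cross3]])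

lemma lip_scaleR_right [lip_intros]: "lip S f \<Longrightarrow> lip S (\<lambda>s. r *\<^sub>R f s)"
  for f :: "'a::real_normed_vector \<Rightarrow> 'b::real_normed_vector"
  by (rule lip_linear[OF bounded_linear_scaleR_right])

abbreviation (input) sx :: "'n::finite state \<Rightarrow> real^3" where "sx s \<equiv> fst s"
abbreviation (input) sv :: "'n::finite state \<Rightarrow> real^3" where "sv s \<equiv> fst (snd s)"
abbreviation (input) sq :: "'n::finite state \<Rightarrow> (real^3, 'n) vec" where "sq s \<equiv> fst (snd (snd s))"
abbreviation (input) sw :: "'n::finite state \<Rightarrow> (real^3, 'n) vec" where "sw s \<equiv> fst (snd (snd (snd s)))"
abbreviation (input) sR :: "'n::finite state \<Rightarrow> real^3^3" where "sR s \<equiv> fst (snd (snd (snd (snd s))))"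
abbreviation (input) sOm :: "'n::finite state \<Rightarrow> real^3" where "sOm s \<equiv> snd (snd (snd (snd (snd s))))"

lemma norm_state_components:
  fixes d :: "'n::finite state"
  shows "norm (sx d) \<le> norm d" "norm (sv d) \<le> norm d" "norm (sq d) \<le> norm d" "norm (sw d) \<le> norm d"
    "norm (sR d) \<le> norm d" "norm (sOm d) \<le> norm d"
    "norm d \<le> norm (sx d) + norm (sv d) + norm (sq d) + norm (sw d) + norm (sR d) + norm (sOm d)"
proof -
  have f: "norm (fst p) \<le> norm p" and s: "norm (snd p) \<le> norm p" for p :: "'a::real_normed_vector \<times> 'b::real_normed_vector"
    by (cases p; simp add: norm_Pair)+
  have t: "norm p \<le> norm (fst p) + norm (snd p)" for p :: "'a::real_normed_vector \<times> 'b::real_normed_vector"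
    by (cases p) (simp add: norm_Pair_le)
  have 2: "norm (snd (snd d)) \<le> norm d" using s[of d] s[of "snd d"] by linarith
  have 3: "norm (snd (snd (snd d))) \<le> norm d" using 2 s[of "snd (snd d)"] by linarith
  have 4: "norm (snd (snd (snd (snd d)))) \<le> norm d" using 3 s[of "snd (snd (snd d))"] by linarith
  show "norm (sx d) \<le> norm d" by (rule f)
  show "norm (sv d) \<le> norm d" using s[of d] f[of "snd d"] by linarith
  show "norm (sq d) \<le> norm d" using 2 f[of "snd (snd d)"] by linarith
  show "norm (sw d) \<le> norm d" using 3 f[of "snd (snd (snd d))"] by linarith
  show "norm (sR d) \<le> norm d" using 4 f[of "snd (snd (snd (snd d)))"] by linarith
  show "norm (sOm d) \<le> norm d" using 4 s[of "snd (snd (snd (snd d)))"] by linarith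
  show "norm d \<le> norm (sx d) + norm (sv d) + norm (sq d) + norm (sw d) + norm (sR d) + norm (sOm d)"
    using t[of d] t[of "snd d"] t[of "snd (snd d)"] t[of "snd (snd (snd d))"] t[of "snd (snd (snd (snd d)))"]
    by linarith
qed

lemma lip_state [lip_intros]:
  "lip S sx" "lip S sv" "lip S sq" "lip S sw" "lip S sR" "lip S sOm"
  "lip S (\<lambda>s. sq s $ i)" "lip S (\<lambda>s. sw s $ i)"
  for S :: "'n::finite state set"
  by (intro lip_fst lip_snd lip_nth lip_ident)+

section \<open>The equilibrium and the equations of motion as a linear system for the
  accelerations\<close>

locale quadrotor_chain =
  fixes P :: "'n::{finite,linorder} quadrotor" and K :: "'n controller"
  assumes mass_pos: "mass P > 0"
    and inertia_sym: "transpose (inertia P) = inertia P"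
    and inertia_pos: "\<And>v. v \<noteq> 0 \<Longrightarrow> v \<bullet> (inertia P *v v) > 0"
    and link_mass_pos: "\<And>i. link_mass P i > 0"
    and link_length_pos: "\<And>i. link_length P i > 0"
    and gravity_pos: "gravity P > 0"
    and stable: "asymptotically_stable (linearized_dynamics P K) 0"
    and k_R_pos: "k_R K > 0"
    and k_Om_pos: "k_Om K > 0"
    and norm_heading: "norm (heading K) = 1"
    and heading_e3: "\<not> collinear {0, heading K, e3}"
begin

lemma M00_pos: "M00 P > 0"
  unfolding M00_def using mass_pos link_mass_pos by (intro add_pos_nonneg sum_nonneg) (auto simp: less_imp_le)

lemma Mii_pos: "Mij P i i > 0"
  unfolding Mij_def using link_mass_pos link_length_pos by (auto intro!: mult_pos_pos sum_pos)

definition pos_err :: "'n state \<Rightarrow> real^(3 + 'n \<times> 2)" where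
  "pos_err s = block_vector (sx s - target K) (\<lambda>i. transpose C32 *v cross3 e3 (sq s $ i))"

definition vel_err :: "'n state \<Rightarrow> real^(3 + 'n \<times> 2)" where
  "vel_err s = block_vector (sv s) (\<lambda>i. transpose C32 *v (sw s $ i))"

definition force :: "'n state \<Rightarrow> real^3" where
  "force s = - (Kx K *v pos_err s) - Kv K *v vel_err s - (M00 P * gravity P) *\<^sub>R e3"

lemma virtual_force_eq: "virtual_force P K s = force s"
  by (cases s) (simp add: virtual_force_def force_def pos_err_def vel_err_def)

definition force0 :: "real^3" where "force0 = - ((M00 P * gravity P) *\<^sub>R e3)"

lemma heading_force0: "cross3 (heading K) force0 \<noteq> 0"
  using heading_e3 M00_pos gravity_pos unfolding cross_eq_0[symmetric]
  by (simp add: force0_def cross_mult_right)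

abbreviation equilibrium :: "'n state" where "equilibrium \<equiv> desired_equilibrium P K"

text \<open>The nested normalizations reduce to \<open>sgn\<close> of expressions linear in the
  force, for which Lipschitz bounds and derivatives are available. The lengths agree because the
  unit vector \<open>b\<close> is orthogonal to \<open>u\<close>.\<close>

lemma Rc_eq:
  assumes "cross3 (heading K) (force s) \<noteq> 0"
  shows "Rc P K s = commanded (heading K) (force s)"
proof -
  define A where "A = force s"
  define b where "b = b3c P K s"
  define u where "u = cross3 b (heading K)"
  have hA: "cross3 (heading K) A \<noteq> 0" using assms by (simp add: A_def)
  then have A: "A \<noteq> 0" by auto
  have b: "b = sgn (- A)"
    by (simp add: b_def b3c_def virtual_force_eq A_def sgn_div_norm)
  have bb: "norm b = 1" using A by (simp add: b norm_sgn)
  have u: "u = cross3 (heading K) A /\<^sub>R norm A"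
    unfolding u_def b sgn_div_norm by (simp add: cross_mult_left cross_skew[of A "heading K"])
  have su: "u /\<^sub>R norm u = sgn (cross3 (heading K) A)"
    using A hA unfolding u by (simp add: sgn_div_norm)
  have "(norm (cross3 b u))\<^sup>2 = (norm u)\<^sup>2"
    using norm_cross_dot[of b u] bb by (simp add: u_def dot_cross_self)
  then have nu: "norm (cross3 b u) = norm u" by simp
  have "- (cross3 b u /\<^sub>R norm (cross3 b u)) = cross3 (u /\<^sub>R norm u) b"
    unfolding nu by (simp add: cross_mult_left cross_skew[of u b])
  moreover have "Rc P K s = transpose (vector [- (cross3 b u /\<^sub>R norm (cross3 b u)), u /\<^sub>R norm u, b])"
    unfolding Rc_def Let_def b_def[symmetric] matrix_vector_mul_assoc[symmetric] hat_mult u_def ..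
  ultimately show ?thesis
    unfolding commanded_def cols_def A_def[symmetric] su by (simp add: b)
qed

lemma equilibrium_components:
  "sx equilibrium = target K" "sv equilibrium = 0" "sq equilibrium = (\<chi> i. e3)" "sw equilibrium = 0"
  "sOm equilibrium = 0"
  by (simp_all add: desired_equilibrium_def)

lemma err_equilibrium: "pos_err equilibrium = 0" "vel_err equilibrium = 0" "force equilibrium = force0"
  by (simp_all add: pos_err_def vel_err_def force_def force0_def equilibrium_components block_vector_zero)

lemma sR_equilibrium: "sR equilibrium = commanded (heading K) force0"
proof -
  have "force (target K, 0, (\<chi> i. e3), 0, mat 1, 0) = force0"
    by (simp add: force_def pos_err_def vel_err_def block_vector_zero force0_def)
  then show ?thesis
    using Rc_eq[of "(target K, 0, (\<chi> i. e3), 0, mat 1, 0)"] heading_force0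
    by (simp add: desired_equilibrium_def)
qed

lemma equilibrium_in_states: "equilibrium \<in> states"
  using rotation_matrix_commanded[OF heading_force0]
  by (simp add: states_def desired_equilibrium_def sR_equilibrium[unfolded desired_equilibrium_def, simplified])

lemma lip_pos_err [lip_intros]: "lip S pos_err"
  and lip_vel_err [lip_intros]: "lip S vel_err"
  and lip_force [lip_intros]: "lip S force"
  unfolding pos_err_def[abs_def] vel_err_def[abs_def] force_def[abs_def] by (intro lip_intros)+

definition coupling :: "'n \<Rightarrow> (real^3) \<times> ((real^3, 'n) vec) \<Rightarrow> real^3" where
  "coupling i u = M0 P i *\<^sub>R fst u + (\<Sum>j\<in>UNIV - {i}. Mij P i j *\<^sub>R snd u $ j)"

text \<open>Left and right hand sides of the equations of motion, with \<open>u = (x'', q'')\<close>.\<close>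

definition inertia_op :: "(real^3, 'n) vec \<Rightarrow> (real^3) \<times> ((real^3, 'n) vec) \<Rightarrow> (real^3) \<times> ((real^3, 'n) vec)" where
  "inertia_op q u = (M00 P *\<^sub>R fst u + (\<Sum>i\<in>UNIV. M0 P i *\<^sub>R snd u $ i),
     \<chi> i. Mij P i i *\<^sub>R snd u $ i - cross3 (q $ i) (cross3 (q $ i) (coupling i u)))"

definition load :: "'n state \<Rightarrow> (real^3) \<times> ((real^3, 'n) vec)" where
  "load s = ((force s \<bullet> (sR s *v e3)) *\<^sub>R (sR s *v e3) + (M00 P * gravity P) *\<^sub>R e3,
     \<chi> i. - ((Mij P i i * (cross3 (sw s $ i) (sq s $ i) \<bullet> cross3 (sw s $ i) (sq s $ i))) *\<^sub>R sq s $ i)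
       - Gi P i *\<^sub>R cross3 (sq s $ i) (cross3 (sq s $ i) e3))"

lemma linear_coupling: "linear (coupling i)"
  by (rule linearI) (simp_all add: coupling_def algebra_simps sum.distrib scaleR_sum_right)

lemma linear_inertia_op: "linear (inertia_op q)"
proof (rule linearI)
  show "inertia_op q (u + v) = inertia_op q u + inertia_op q v" for u v
    by (simp add: inertia_op_def vec_eq_iff linear_add[OF linear_coupling] cross_add_right sum.distrib algebra_simps)
  show "inertia_op q (r *\<^sub>R u) = r *\<^sub>R inertia_op q u" for r u
    by (simp add: inertia_op_def vec_eq_iff linear_scale[OF linear_coupling] cross_mult_right scaleR_sum_right
        scaleR_diff_right mult.commute algebra_simps)
qed

text \<open>The inner product of the link equation with \<open>q $ i\<close> shows that
  \<open>p $ i\<close> is orthogonal to the link. On such vectors the double cross product acts as a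
  sign change, so pairing all equations with the unknowns yields the kinetic energy, which is
  therefore 0.\<close>

lemma inertia_op_ker:
  assumes q: "\<And>i. norm (q $ i) = 1" and zero: "inertia_op q u = 0"
  shows "u = 0"
proof -
  obtain a p where u: "u = (a, p)" by fastforce
  have qq: "q $ i \<bullet> q $ i = 1" for i using q[of i] by (simp add: norm_eq_1)
  have z1: "M00 P *\<^sub>R a + (\<Sum>i\<in>UNIV. M0 P i *\<^sub>R p $ i) = 0"
    using arg_cong[OF zero, of fst] by (simp add: inertia_op_def u)
  have z2: "Mij P i i *\<^sub>R p $ i = cross3 (q $ i) (cross3 (q $ i) (coupling i u))" for i
    using arg_cong[OF zero, of "\<lambda>z. snd z $ i"] by (simp add: inertia_op_def u)
  have z3: "p $ i \<bullet> (M0 P i *\<^sub>R a + (\<Sum>j\<in>UNIV. Mij P i j *\<^sub>R p $ j)) = 0" for i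
  proof -
    have "Mij P i i * (q $ i \<bullet> p $ i) = q $ i \<bullet> (Mij P i i *\<^sub>R p $ i)" by simp
    also have "\<dots> = 0" unfolding z2 by (simp add: dot_cross_self)
    finally have qp: "q $ i \<bullet> p $ i = 0" using Mii_pos[of i] by simp
    have "p $ i \<bullet> (Mij P i i *\<^sub>R p $ i) = - (p $ i \<bullet> coupling i u)"
      unfolding z2 Lagrange using qp qq[of i] by (simp add: inner_diff_right inner_commute)
    moreover have "M0 P i *\<^sub>R a + (\<Sum>j\<in>UNIV. Mij P i j *\<^sub>R p $ j) = coupling i u + Mij P i i *\<^sub>R p $ i"
      by (simp add: coupling_def u sum.remove[of UNIV i])
    ultimately show ?thesis by (simp add: inner_add_right)
  qed
  have "energy P a (\<lambda>i. p $ i) = a \<bullet> (M00 P *\<^sub>R a + (\<Sum>i\<in>UNIV. M0 P i *\<^sub>R p $ i))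
      + (\<Sum>i\<in>UNIV. p $ i \<bullet> (M0 P i *\<^sub>R a + (\<Sum>j\<in>UNIV. Mij P i j *\<^sub>R p $ j)))"
    unfolding energy_def inner_add_right inner_sum_right sum.distrib by (simp add: inner_commute)
  then have "energy P a (\<lambda>i. p $ i) \<le> 0" unfolding z1 z3 by simp
  from energy_pos[OF mass_pos link_mass_pos link_length_pos this]
  show ?thesis by (simp add: u vec_eq_iff zero_prod_def)
qed

text \<open>Only the double cross products depend on \<open>q\<close>, and they do so quadratically.
  The bound 2 on the link vectors covers the unit ball around the hanging configuration.\<close>

lemma inertia_op_lipschitz:
  obtains C where "0 < C" "\<And>q q' u. (\<And>i. norm (q $ i) \<le> 2) \<Longrightarrow> (\<And>i. norm (q' $ i) \<le> 2) \<Longrightarrow>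
    norm (inertia_op q u - inertia_op q' u) \<le> C * norm (q - q') * norm u"
proof -
  have "\<forall>i. \<exists>C>0. \<forall>u. norm (coupling i u) \<le> norm u * C"
    using bounded_linear.pos_bounded linear_coupling linear_conv_bounded_linear by blast
  then obtain C where C: "\<And>i. C i > 0" "\<And>i u. norm (coupling i u) \<le> norm u * C i" by metis
  show thesis
  proof (rule that)
    show "0 < 1 + (\<Sum>i\<in>UNIV. 4 * C i)" using C(1) by (intro add_pos_nonneg sum_nonneg) (auto simp: less_imp_le)
    fix q q' :: "(real^3, 'n) vec" and u
    assume q: "\<And>i. norm (q $ i) \<le> 2" and q': "\<And>i. norm (q' $ i) \<le> 2"
    have b: "norm (cross3 (q $ i) (cross3 (q $ i) y) - cross3 (q' $ i) (cross3 (q' $ i) y)) \<le> 4 * norm (q - q') * norm y" for i y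
    proof -
      have eq: "cross3 (q $ i) (cross3 (q $ i) y) - cross3 (q' $ i) (cross3 (q' $ i) y)
         = cross3 ((q - q') $ i) (cross3 (q $ i) y) + cross3 (q' $ i) (cross3 ((q - q') $ i) y)"
        by (simp add: Cross3.left_diff_distrib Cross3.right_diff_distrib)
      have n: "norm ((q - q') $ i) \<le> norm (q - q')" by (rule Finite_Cartesian_Product.norm_nth_le)
      have "norm (cross3 ((q - q') $ i) (cross3 (q $ i) y)) \<le> norm (q - q') * (2 * norm y)"
        by (intro order_trans[OF norm_cross_le] mult_mono n order_trans[OF norm_cross_le] mult_right_mono q) auto
      moreover have "norm (cross3 (q' $ i) (cross3 ((q - q') $ i) y)) \<le> 2 * (norm (q - q') * norm y)"
        by (intro order_trans[OF norm_cross_le] mult_mono q' order_trans[OF norm_cross_le] mult_right_mono n) auto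
      ultimately show ?thesis unfolding eq by (intro norm_triangle_le) simp
    qed
    have "norm (inertia_op q u - inertia_op q' u)
        = norm (\<chi> i. - (cross3 (q $ i) (cross3 (q $ i) (coupling i u)) - cross3 (q' $ i) (cross3 (q' $ i) (coupling i u))))"
      by (simp add: inertia_op_def norm_Pair algebra_simps)
        (rule arg_cong[of _ _ norm], simp add: vec_eq_iff)
    also have "\<dots> \<le> (\<Sum>i\<in>UNIV. norm (cross3 (q $ i) (cross3 (q $ i) (coupling i u)) - cross3 (q' $ i) (cross3 (q' $ i) (coupling i u))))"
      by (rule order_trans[OF norm_vec_le_sum]) (simp add: norm_minus_commute)
    also have "\<dots> \<le> (\<Sum>i\<in>UNIV. 4 * norm (q - q') * (norm u * C i))"
      by (intro sum_mono order_trans[OF b] mult_left_mono C) auto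
    also have "\<dots> = (\<Sum>i\<in>UNIV. 4 * C i) * (norm (q - q') * norm u)"
      by (simp add: sum_distrib_left sum_distrib_right mult_ac)
    also have "\<dots> \<le> (1 + (\<Sum>i\<in>UNIV. 4 * C i)) * (norm (q - q') * norm u)"
      by (rule mult_right_mono) auto
    finally show "norm (inertia_op q u - inertia_op q' u) \<le> (1 + (\<Sum>i\<in>UNIV. 4 * C i)) * norm (q - q') * norm u"
      by (simp add: mult.assoc)
  qed
qed

text \<open>Injectivity in the hanging configuration gives a lower bound \<open>B\<close>, of which
  a perturbation of \<open>q\<close> by at most \<open>B / (2 * C)\<close> destroys at most half.
  The ball contains vectors \<open>q\<close> whose components do not have length 1, so the
  accelerations are also determined off the constraint set.\<close>

lemma inertia_op_coercive:
  obtains r c where "0 < r" "r \<le> 1" "0 < c" "\<And>q u. norm (q - (\<chi> i. e3)) \<le> r \<Longrightarrow> c * norm u \<le> norm (inertia_op q u)"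
proof -
  define e :: "(real^3, 'n) vec" where "e = (\<chi> i. e3)"
  have "inj (inertia_op e)"
    unfolding linear_injective_0[OF linear_inertia_op] using inertia_op_ker[of e] by (auto simp: e_def norm_axis_1)
  then obtain B where B: "B > 0" "\<And>u. B * norm u \<le> norm (inertia_op e u)"
    using linear_inj_bounded_below_pos[OF linear_inertia_op] by blast
  obtain C where C: "0 < C" "\<And>q q' u. (\<And>i. norm (q $ i) \<le> 2) \<Longrightarrow> (\<And>i. norm (q' $ i) \<le> 2) \<Longrightarrow>
    norm (inertia_op q u - inertia_op q' u) \<le> C * norm (q - q') * norm u"
    using inertia_op_lipschitz by blast
  define r where "r = min 1 (B / (2 * C))"
  show thesis
  proof (rule that)
    show "0 < r" "r \<le> 1" "0 < B / 2" using B C by (auto simp: r_def)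
    fix q :: "(real^3, 'n) vec" and u assume q: "norm (q - (\<chi> i. e3)) \<le> r"
    have "norm (q $ i) \<le> 2" for i
      using Finite_Cartesian_Product.norm_nth_le[of "q - e" i] q norm_triangle_sub[of "q $ i" e3]
      by (simp add: e_def r_def norm_axis_1)
    then have "norm (inertia_op e u - inertia_op q u) \<le> C * norm (e - q) * norm u"
      by (intro C) (auto simp: e_def norm_axis_1)
    also have "\<dots> \<le> C * (B / (2 * C)) * norm u"
      using q C(1) by (intro mult_right_mono mult_left_mono) (auto simp: e_def r_def norm_minus_commute)
    also have "\<dots> = B / 2 * norm u" using C(1) by simp
    finally have "norm (inertia_op e u - inertia_op q u) \<le> B / 2 * norm u" .
    moreover have "norm (inertia_op e u) \<le> norm (inertia_op q u) + norm (inertia_op e u - inertia_op q u)"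
      by (rule norm_triangle_sub)
    ultimately show "B / 2 * norm u \<le> norm (inertia_op q u)" using B(2)[of u] by simp
  qed
qed

lemma lip_load: "bounded S \<Longrightarrow> lip S load"
  unfolding load_def[abs_def]
  by (intro lip_intros lip_scaleR lip_inner lip_matrix_vector lip_cross3 lip_bilinear[OF bounded_bilinear_mult])
     (auto intro!: lip_intros)

lemma load_equilibrium: "load equilibrium = 0"
proof -
  have Re3: "sR equilibrium *v e3 = e3"
    unfolding sR_equilibrium commanded_e3 using M00_pos gravity_pos
    by (simp add: force0_def sgn_scaleR sgn_div_norm norm_axis_1 field_simps)
  show ?thesis
  proof (rule prod_eqI)
    show "fst (load equilibrium) = fst 0"
      by (simp add: load_def err_equilibrium Re3 force0_def norm_eq_1[symmetric] norm_axis_1 inner_axis_axis)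
    show "snd (load equilibrium) = snd 0"
      by (simp add: load_def equilibrium_components vec_eq_iff)
  qed
qed

text \<open>One radius on which the accelerations are determined and the commanded attitude is
  defined, both with uniform bounds. The pair \<open>r\<close>, \<open>c\<close> is then fixed as a
  locale.\<close>

lemma neighbourhood:
  obtains r c where "0 < r" "0 < c" "r \<le> 1"
    "\<And>s u. norm (s - equilibrium) \<le> r \<Longrightarrow> c * norm u \<le> norm (inertia_op (sq s) u)"
    "\<And>s. norm (s - equilibrium) \<le> r \<Longrightarrow> c \<le> norm (cross3 (heading K) (force s))"
    "\<And>s. norm (s - equilibrium) \<le> r \<Longrightarrow> c \<le> norm (force s)"
proof -
  obtain r1 c1 where r1: "0 < r1" "r1 \<le> 1" "0 < c1" "\<And>q u. norm (q - (\<chi> i. e3)) \<le> r1 \<Longrightarrow> c1 * norm u \<le> norm (inertia_op q u)"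
    using inertia_op_coercive by blast
  obtain L where L: "0 < L" "\<And>s t. norm (force s - force t) \<le> L * norm (s - t)"
    using lipD[OF lip_force[of UNIV]] by auto
  \<comment> \<open>Half of the value at the equilibrium: a force error of at most \<open>c2\<close>
    leaves at least \<open>c2\<close>, as the heading has length 1. For the same reason the bound
    carries over to the force itself.\<close>
  define c2 where "c2 = norm (cross3 (heading K) force0) / 2"
  have c2: "c2 > 0" using heading_force0 by (simp add: c2_def)
  show thesis
  proof (rule that)
    show "0 < min r1 (c2 / L)" "0 < min c1 c2" "min r1 (c2 / L) \<le> 1" using r1 L c2 by auto
    fix s assume s: "norm (s - equilibrium) \<le> min r1 (c2 / L)"
    have "norm (sq s - sq equilibrium) \<le> norm (s - equilibrium)"
      using norm_state_components(3)[of "s - equilibrium"] by simp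
    then have "c1 * norm u \<le> norm (inertia_op (sq s) u)" for u
      using s by (intro r1(4)) (simp add: equilibrium_components)
    then show "min c1 c2 * norm u \<le> norm (inertia_op (sq s) u)" for u
      by (rule order_trans[rotated]) (simp add: mult_right_mono)
    have "L * norm (s - equilibrium) \<le> L * (c2 / L)" using s L(1) by (intro mult_left_mono) auto
    then have "norm (force s - force0) \<le> c2"
      using L(2)[of s equilibrium] L(1) by (simp add: err_equilibrium)
    then have "norm (cross3 (heading K) (force s - force0)) \<le> c2"
      using norm_cross_le[of "heading K" "force s - force0"] norm_heading by simp
    moreover have "norm (cross3 (heading K) force0) \<le> norm (cross3 (heading K) (force s)) + norm (cross3 (heading K) (force s - force0))"
      using norm_triangle_sub[of "cross3 (heading K) force0" "cross3 (heading K) (force s)"]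
      by (simp add: Cross3.right_diff_distrib norm_minus_commute)
    ultimately have "c2 \<le> norm (cross3 (heading K) (force s))" by (simp add: c2_def)
    moreover have "norm (cross3 (heading K) (force s)) \<le> norm (force s)"
      using norm_cross_le[of "heading K" "force s"] norm_heading by simp
    ultimately show "min c1 c2 \<le> norm (cross3 (heading K) (force s))" "min c1 c2 \<le> norm (force s)" by auto
  qed
qed

end

section \<open>Linearization of the translational dynamics\<close>

lemma norm_transpose_C32_le: "norm (transpose C32 *v x) \<le> norm x"
proof (rule power2_le_imp_le)
  show "(norm (transpose C32 *v x))\<^sup>2 \<le> (norm x)\<^sup>2"
    by (simp add: power2_norm_eq_inner inner_vec_def sum_2 sum_3 transpose_C32_nth del: transpose_matrix_vector)
qed simp

lemma cross_e3_C32: "cross3 e3 (C32 *v (transpose C32 *v x)) = cross3 e3 x"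
  by (simp add: cross3_def vec_eq_iff forall_3 C32_nth transpose_C32_nth axis_def del: transpose_matrix_vector)

text \<open>For \<open>q = e3\<close> the two vectors agree; expanding the triple product leaves
  only terms that are linear in \<open>q - e3\<close>.\<close>

lemma transpose_C32_cross_le:
  "norm (transpose C32 *v cross3 e3 (cross3 w q) - transpose C32 *v w) \<le> 2 * (norm w * norm (q - e3))"
proof -
  have "transpose C32 *v cross3 e3 (cross3 w q) - transpose C32 *v w
      = transpose C32 *v ((e3 \<bullet> (q - e3)) *\<^sub>R w - (e3 \<bullet> w) *\<^sub>R (q - e3))"
    by (simp add: vec_eq_iff forall_2 transpose_C32_nth cross3_def inner_vec_def sum_3 axis_def algebra_simps
        del: transpose_matrix_vector)
  also have "norm \<dots> \<le> norm ((e3 \<bullet> (q - e3)) *\<^sub>R w - (e3 \<bullet> w) *\<^sub>R (q - e3))" by (rule norm_transpose_C32_le)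
  also have "\<dots> \<le> norm (q - e3) * norm w + norm w * norm (q - e3)"
  proof (rule norm_triangle_le_diff, rule add_mono)
    show "norm ((e3 \<bullet> (q - e3)) *\<^sub>R w) \<le> norm (q - e3) * norm w"
      using Cauchy_Schwarz_ineq2[of e3 "q - e3"] by (simp add: norm_axis_1 mult_right_mono)
    show "norm ((e3 \<bullet> w) *\<^sub>R (q - e3)) \<le> norm w * norm (q - e3)"
      using Cauchy_Schwarz_ineq2[of e3 w] by (simp add: norm_axis_1 mult_right_mono)
  qed
  finally show ?thesis by simp
qed

text \<open>The errors record the horizontal components only. Near \<open>e3\<close> one has
  \<open>q $ 3 \<ge> 1/2\<close>, which excludes the inverted link; the unit length then determines
  the third component of \<open>q\<close>, and orthogonality to \<open>q\<close> that of
  \<open>w\<close>.\<close>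

lemma norm_link_le:
  assumes "norm q = 1" "norm (q - e3) \<le> 1"
  shows "norm (q - e3) \<le> 2 * norm (transpose C32 *v cross3 e3 q)"
    and "q \<bullet> w = 0 \<Longrightarrow> norm w \<le> 3 * norm (transpose C32 *v w)"
proof -
  have qq: "(q$1)\<^sup>2 + (q$2)\<^sup>2 + (q$3)\<^sup>2 = 1"
    using assms(1) by (simp add: norm_eq_1 inner_vec_def sum_3 power2_eq_square)
  have d: "(norm (q - e3))\<^sup>2 = 2 * (1 - q$3)"
  proof -
    have "(norm (q - e3))\<^sup>2 = (q$1)\<^sup>2 + (q$2)\<^sup>2 + (q$3)\<^sup>2 + 1 - 2 * q$3"
      unfolding power2_norm_eq_inner by (simp add: inner_vec_def sum_3 axis_def power2_eq_square algebra_simps)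
    then show ?thesis using qq by simp
  qed
  have "(norm (q - e3))\<^sup>2 \<le> 1" using assms(2) by (simp add: power_le_one)
  then have q3: "1/2 \<le> q$3" using d by simp
  have "0 \<le> 2 * (1 - q$3)" unfolding d[symmetric] by simp
  then have "q$3 \<le> 1" by simp
  have c: "(norm (transpose C32 *v cross3 e3 q))\<^sup>2 = (q$1)\<^sup>2 + (q$2)\<^sup>2"
    unfolding power2_norm_eq_inner inner_vec_def sum_2 transpose_C32_nth
    by (simp add: cross3_def axis_def power2_eq_square)
  have "(1 - q$3) * 1 \<le> (1 - q$3) * (1 + q$3)" using q3 \<open>q$3 \<le> 1\<close> by (intro mult_left_mono) auto
  also have "\<dots> = (q$1)\<^sup>2 + (q$2)\<^sup>2" using qq by (simp add: power2_eq_square algebra_simps)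
  finally have "(norm (q - e3))\<^sup>2 \<le> (2 * norm (transpose C32 *v cross3 e3 q))\<^sup>2"
    unfolding d power_mult_distrib c using \<open>q$3 \<le> 1\<close> by simp
  then show "norm (q - e3) \<le> 2 * norm (transpose C32 *v cross3 e3 q)"
    by (rule power2_le_imp_le) simp
  assume "q \<bullet> w = 0"
  define u where "u = transpose C32 *v w"
  have uu: "(norm u)\<^sup>2 = (w$1)\<^sup>2 + (w$2)\<^sup>2"
    unfolding power2_norm_eq_inner inner_vec_def sum_2 u_def transpose_C32_nth
    by (simp add: power2_eq_square)
  have "q$3 * w$3 = - (q$1 * w$1 + q$2 * w$2)"
    using \<open>q \<bullet> w = 0\<close> by (simp add: inner_vec_def sum_3)
  then have "(q$3 * w$3)\<^sup>2 = (q$1 * w$1 + q$2 * w$2)\<^sup>2" by (simp only: power2_minus)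
  also have "\<dots> \<le> ((q$1)\<^sup>2 + (q$2)\<^sup>2) * ((w$1)\<^sup>2 + (w$2)\<^sup>2)"
  proof -
    have "0 \<le> (q$1 * w$2 - q$2 * w$1)\<^sup>2" by simp
    then show ?thesis by (simp add: power2_eq_square algebra_simps)
  qed
  also have "\<dots> \<le> 1 * ((w$1)\<^sup>2 + (w$2)\<^sup>2)"
  proof (rule mult_right_mono)
    show "(q$1)\<^sup>2 + (q$2)\<^sup>2 \<le> 1" using qq zero_le_power2[of "q$3"] by linarith
  qed simp
  finally have "(q$3)\<^sup>2 * (w$3)\<^sup>2 \<le> (norm u)\<^sup>2" by (simp add: uu power_mult_distrib)
  moreover have "(1/2)\<^sup>2 * (w$3)\<^sup>2 \<le> (q$3)\<^sup>2 * (w$3)\<^sup>2"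
    using q3 by (intro mult_right_mono power_mono) auto
  ultimately have "(w$3)\<^sup>2 \<le> 4 * (norm u)\<^sup>2" by (simp add: power2_eq_square)
  moreover have "(norm w)\<^sup>2 = (norm u)\<^sup>2 + (w$3)\<^sup>2"
    unfolding uu unfolding power2_norm_eq_inner inner_vec_def sum_3 by (simp add: power2_eq_square)
  moreover have "(3 * norm u)\<^sup>2 = 9 * (norm u)\<^sup>2" "0 \<le> (norm u)\<^sup>2" by (simp_all add: power_mult_distrib)
  ultimately have "(norm w)\<^sup>2 \<le> (3 * norm u)\<^sup>2" by linarith
  then show "norm w \<le> 3 * norm (transpose C32 *v w)"
    unfolding u_def[symmetric] by (rule power2_le_imp_le) simp
qed

lemma norm_rotation_mult:
  fixes R :: "real^'n^'n"
  shows "rotation_matrix R \<Longrightarrow> norm (R *v x) = norm x"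
proof -
  assume "rotation_matrix R"
  then have "(transpose R ** R) *v x = x" using rotation_matrix_inverse(1)[of R] by simp
  then have "(R *v x) v* R = x" by (simp only: matrix_vector_mul_assoc[symmetric] transpose_matrix_vector)
  then show ?thesis using dot_lmul_matrix[of "R *v x" R x] by (simp add: norm_eq_sqrt_inner)
qed

section \<open>Accelerations and error rates on a ball around the equilibrium\<close>

locale quadrotor_ball = quadrotor_chain P K
  for P :: "'n::{finite,linorder} quadrotor" and K :: "'n controller" +
  fixes r c :: real
  assumes r_pos: "0 < r" and r_le: "r \<le> 1" and c_pos: "0 < c"
    and coercive: "\<And>s u. norm (s - equilibrium) \<le> r \<Longrightarrow> c * norm u \<le> norm (inertia_op (sq s) u)"
    and heading_force: "\<And>s. norm (s - equilibrium) \<le> r \<Longrightarrow> c \<le> norm (cross3 (heading K) (force s))"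
    and force_lower: "\<And>s. norm (s - equilibrium) \<le> r \<Longrightarrow> c \<le> norm (force s)"
begin

definition "S = {s. norm (s - equilibrium) \<le> r}"

abbreviation D :: "'n state \<Rightarrow> real" where "D s \<equiv> norm (s - equilibrium)"

lemma equilibrium_in_S: "equilibrium \<in> S" using r_pos by (simp add: S_def)

lemma bounded_S: "bounded S"
proof -
  have "S = cball equilibrium r" by (auto simp: S_def dist_norm norm_minus_commute)
  then show ?thesis by simp
qed

lemma component_bounds:
  "norm (sx s - target K) \<le> D s" "norm (sv s) \<le> D s" "norm (sq s $ i - e3) \<le> D s" "norm (sw s $ i) \<le> D s"
  "norm (sR s - sR equilibrium) \<le> D s" "norm (sOm s) \<le> D s"
proof -
  note n = norm_state_components[of "s - equilibrium"]
  show "norm (sx s - target K) \<le> D s" "norm (sv s) \<le> D s" "norm (sR s - sR equilibrium) \<le> D s" "norm (sOm s) \<le> D s"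
    using n by (simp_all add: equilibrium_components)
  have "norm ((sq s - sq equilibrium) $ i) \<le> norm (sq s - sq equilibrium)" "norm (sw s $ i) \<le> norm (sw s)"
    by (rule Finite_Cartesian_Product.norm_nth_le)+
  then show "norm (sq s $ i - e3) \<le> D s" "norm (sw s $ i) \<le> D s"
    using n by (simp_all add: equilibrium_components)
qed

text \<open>The equations of motion determine the accelerations only implicitly. On \<open>S\<close>
  the choice is unique, also at points of the ball that violate the constraints.\<close>

definition acc :: "'n state \<Rightarrow> (real^3) \<times> ((real^3, 'n) vec)" where
  "acc s = (SOME u. inertia_op (sq s) u = load s)"

lemma acc_unique:
  assumes "s \<in> S" "inertia_op (sq s) u = inertia_op (sq s) v" shows "u = v"
proof -
  have "c * norm (u - v) \<le> 0"
    using coercive[of s "u - v"] assms by (simp add: S_def linear_diff[OF linear_inertia_op])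
  then show ?thesis using c_pos by (simp add: mult_le_0_iff)
qed

lemma acc: "s \<in> S \<Longrightarrow> inertia_op (sq s) (acc s) = load s"
proof -
  assume "s \<in> S"
  then have "inj (inertia_op (sq s))" by (intro injI) (rule acc_unique)
  then have "surj (inertia_op (sq s))" using linear_injective_imp_surjective[OF linear_inertia_op] by blast
  then have "\<exists>u. inertia_op (sq s) u = load s" by (metis surjD)
  then show ?thesis unfolding acc_def by (rule someI_ex)
qed

lemma acc_eqI: "s \<in> S \<Longrightarrow> inertia_op (sq s) u = load s \<Longrightarrow> u = acc s"
  using acc acc_unique by metis

lemma lip_acc: "lip S acc"
proof -
  obtain C where C: "0 < C" "\<And>q q' u. (\<And>i. norm (q $ i) \<le> 2) \<Longrightarrow> (\<And>i. norm (q' $ i) \<le> 2) \<Longrightarrow>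
    norm (inertia_op q u - inertia_op q' u) \<le> C * norm (q - q') * norm u"
    using inertia_op_lipschitz by blast
  have q2: "norm (sq s $ i) \<le> 2" if "s \<in> S" for s i
    using component_bounds(3)[of s i] that r_le norm_triangle_sub[of "sq s $ i" e3] by (simp add: S_def norm_axis_1)
  show ?thesis
  proof (rule lip_solve[OF linear_inertia_op c_pos less_imp_le[OF C(1)] _ _ lip_load[OF bounded_S] bounded_S acc])
    show "c * norm u \<le> norm (inertia_op (sq s) u)" if "s \<in> S" for s u
      using coercive that by (simp add: S_def)
    show "norm (inertia_op (sq s) u - inertia_op (sq t) u) \<le> C * norm (s - t) * norm u" if "s \<in> S" "t \<in> S" for s t u
    proof -
      have "norm (sq s - sq t) \<le> norm (s - t)" using norm_state_components(3)[of "s - t"] by simp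
      then have "C * norm (sq s - sq t) * norm u \<le> C * norm (s - t) * norm u"
        using C(1) by (intro mult_right_mono mult_left_mono) auto
      then show ?thesis using C(2)[OF q2[OF that(1)] q2[OF that(2)], of u] by linarith
    qed
  qed
qed

lemma acc_equilibrium: "acc equilibrium = 0"
  using acc_eqI[OF equilibrium_in_S, of 0] by (simp add: load_equilibrium linear_0[OF linear_inertia_op])

lemma acc_bound: obtains C where "0 < C" "\<And>s. s \<in> S \<Longrightarrow> norm (acc s) \<le> C * D s"
  using lipD[OF lip_acc] equilibrium_in_S acc_equilibrium by (metis diff_zero)

lemma rotation_commanded: "s \<in> S \<Longrightarrow> rotation_matrix (Rc P K s)"
  and Rc_commanded: "s \<in> S \<Longrightarrow> Rc P K s = commanded (heading K) (force s)"
proof -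
  assume "s \<in> S"
  then have h: "cross3 (heading K) (force s) \<noteq> 0" using heading_force[of s] c_pos by (auto simp: S_def)
  from Rc_eq[OF h] show "Rc P K s = commanded (heading K) (force s)" .
  with rotation_matrix_commanded[OF h] show "rotation_matrix (Rc P K s)" by simp
qed

lemma commanded_lipschitz:
  obtains C where "0 < C" "\<And>s. s \<in> S \<Longrightarrow> norm (Rc P K s - sR equilibrium) \<le> C * norm (force s - force0)"
proof -
  obtain B where "0 < B" "\<And>s. s \<in> S \<Longrightarrow> norm (force s) \<le> B" using lip_bounded[OF lip_force bounded_S] by blast
  then have "bounded (force ` S)" unfolding bounded_pos by auto
  then have "lip (force ` S) (commanded (heading K))"
    using heading_force force_lower by (intro lip_commanded[OF c_pos]) (auto simp: S_def)
  from lipD[OF this] obtain C where C: "0 < C"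
    "\<And>A B. A \<in> force ` S \<Longrightarrow> B \<in> force ` S \<Longrightarrow> norm (commanded (heading K) A - commanded (heading K) B) \<le> C * norm (A - B)"
    by blast
  have "force0 \<in> force ` S" using equilibrium_in_S err_equilibrium(3) by (metis imageI)
  with C show thesis by (intro that[of C]) (simp_all add: Rc_commanded sR_equilibrium)
qed

lemma force_err: "force s - force0 = - (Kx K *v pos_err s) - Kv K *v vel_err s"
  by (simp add: force_def force0_def)

definition pos_rate :: "'n state \<Rightarrow> real^(3 + 'n \<times> 2)" where
  "pos_rate s = block_vector (sv s) (\<lambda>i. transpose C32 *v cross3 e3 (cross3 (sw s $ i) (sq s $ i)))"

text \<open>On the constraint set \<open>w\<close> is the cross product of \<open>q\<close> and
  \<open>q'\<close>, so its derivative is the cross product of \<open>q\<close> and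
  \<open>q''\<close>.\<close>

definition vel_rate :: "'n state \<Rightarrow> real^(3 + 'n \<times> 2)" where
  "vel_rate s = block_vector (fst (acc s)) (\<lambda>i. transpose C32 *v cross3 (sq s $ i) (snd (acc s) $ i))"

definition force_rate :: "'n state \<Rightarrow> real^3" where
  "force_rate s = - (Kx K *v pos_rate s) - Kv K *v vel_rate s"

definition mass_inv :: "real^(3 + 'n \<times> 2)^(3 + 'n \<times> 2)" where
  "mass_inv = (SOME Mi. (\<forall>z. mass_matrix P *v (Mi *v z) = z) \<and> (\<forall>z. Mi *v (mass_matrix P *v z) = z))"

lemma mass_inv: "mass_matrix P *v (mass_inv *v z) = z" "mass_inv *v (mass_matrix P *v z) = z"
proof -
  have "\<exists>Mi. (\<forall>z. mass_matrix P *v (Mi *v z) = z) \<and> (\<forall>z. Mi *v (mass_matrix P *v z) = z)"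
    using mass_matrix_inverse[OF mass_pos link_mass_pos link_length_pos] by metis
  from someI_ex[OF this] show "mass_matrix P *v (mass_inv *v z) = z" "mass_inv *v (mass_matrix P *v z) = z"
    unfolding mass_inv_def[symmetric] by blast+
qed

text \<open>The linearized dynamics under feedback, solved for \<open>z''\<close> and written as a
  first order system for the pair of \<open>z\<close> and \<open>z'\<close>.\<close>

definition lin :: "(real^(3 + 'n \<times> 2)) \<times> (real^(3 + 'n \<times> 2)) \<Rightarrow> (real^(3 + 'n \<times> 2)) \<times> (real^(3 + 'n \<times> 2))" where
  "lin y = (snd y, mass_inv *v (input_matrix *v (- (Kx K *v fst y) - Kv K *v snd y) - gravity_matrix P *v fst y))"

lemma bounded_linear_lin: "bounded_linear lin"
  unfolding linear_conv_bounded_linear[symmetric] lin_def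
  by (rule linearI) (simp_all add: matrix_vector_right_distrib matrix_vector_mult_scaleR
      matrix_vector_mult_diff_distrib scaleR_diff_right scaleR_minus_right
      bounded_bilinear.minus_right[OF bounded_bilinear_matrix_vector])

definition err :: "'n state \<Rightarrow> (real^(3 + 'n \<times> 2)) \<times> (real^(3 + 'n \<times> 2))" where
  "err s = (pos_err s, vel_err s)"

definition err_rate :: "'n state \<Rightarrow> (real^(3 + 'n \<times> 2)) \<times> (real^(3 + 'n \<times> 2))" where
  "err_rate s = (pos_rate s, vel_rate s)"

definition att :: "'n state \<Rightarrow> real^3^3" where "att s = transpose (Rc P K s) ** sR s"

text \<open>The force actually applied is the projection of \<open>A\<close> to the third body axis.
  \<open>A\<close> is a multiple of the commanded axis \<open>b\<close>, so for the unit vectors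
  \<open>b\<close> and \<open>\<beta>\<close> the defect is at most twice their distance, scaled by
  the length of \<open>A\<close>.\<close>

lemma thrust_error:
  obtains C where "0 < C" "\<And>s. s \<in> S \<Longrightarrow> s \<in> states \<Longrightarrow>
    norm ((force s \<bullet> (sR s *v e3)) *\<^sub>R (sR s *v e3) - force s) \<le> C * norm (att s - mat 1)"
proof -
  obtain B where B: "0 < B" "\<And>s. s \<in> S \<Longrightarrow> norm (force s) \<le> B" using lip_bounded[OF lip_force bounded_S] by blast
  obtain m where m: "0 < m" "\<And>(X::real^3^3) (v::real^3). norm (X *v v) \<le> norm X * norm v * m"
    using bounded_bilinear.pos_bounded[OF bounded_bilinear_matrix_vector] by blast
  show thesis
  proof (rule that)
    show "0 < B * (2 * m)" using B m by simp
    fix s assume s: "s \<in> S" "s \<in> states"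
    define A b \<beta> where "A = force s" and "b = Rc P K s *v e3" and "\<beta> = sR s *v e3"
    have A0: "A \<noteq> 0" using force_lower[of s] s(1) c_pos by (auto simp: A_def S_def)
    have "b = sgn (- A)" unfolding b_def Rc_commanded[OF s(1)] commanded_e3 A_def ..
    then have A: "A = - (norm A *\<^sub>R b)" using A0 by (simp add: sgn_div_norm)
    have "rotation_matrix (sR s)" using s(2) by (auto simp: states_def)
    then have \<beta>1: "norm \<beta> = 1" by (simp add: \<beta>_def norm_rotation_mult norm_axis_1)
    have b1: "norm b = 1" using rotation_commanded[OF s(1)] by (simp add: b_def norm_rotation_mult norm_axis_1)
    have "Rc P K s ** att s = sR s"
      using rotation_matrix_inverse(2)[OF rotation_commanded[OF s(1)]] by (simp add: att_def matrix_mul_assoc)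
    then have "\<beta> - b = Rc P K s *v ((att s - mat 1) *v e3)"
      by (simp add: \<beta>_def b_def matrix_vector_mult_diff_rdistrib matrix_vector_mult_diff_distrib matrix_vector_mul_assoc)
    then have "norm (\<beta> - b) = norm ((att s - mat 1) *v e3)"
      using rotation_commanded[OF s(1)] by (simp add: norm_rotation_mult)
    also have "\<dots> \<le> m * norm (att s - mat 1)"
      using m(2)[of "att s - mat 1" e3] by (simp add: norm_axis_1 mult.commute)
    finally have d: "norm (\<beta> - b) \<le> m * norm (att s - mat 1)" .
    have "(b \<bullet> \<beta>) *\<^sub>R \<beta> - b = (b \<bullet> (\<beta> - b)) *\<^sub>R \<beta> + (\<beta> - b)"
      using b1 by (simp add: inner_diff_right norm_eq_1 algebra_simps)
    also have "norm \<dots> \<le> norm (\<beta> - b) + norm (\<beta> - b)"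
      by (rule norm_triangle_le) (use Cauchy_Schwarz_ineq2[of b "\<beta> - b"] b1 \<beta>1 in simp)
    finally have e: "norm ((b \<bullet> \<beta>) *\<^sub>R \<beta> - b) \<le> 2 * norm (\<beta> - b)" by simp
    have "(A \<bullet> \<beta>) *\<^sub>R \<beta> - A = - (norm A *\<^sub>R ((b \<bullet> \<beta>) *\<^sub>R \<beta> - b))"
      by (subst (1 2) A) (simp add: algebra_simps)
    then have "norm ((A \<bullet> \<beta>) *\<^sub>R \<beta> - A) = norm A * norm ((b \<bullet> \<beta>) *\<^sub>R \<beta> - b)" by simp
    also have "\<dots> \<le> B * (2 * (m * norm (att s - mat 1)))"
      using B(2)[OF s(1)] B(1) e d by (intro mult_mono) (auto simp: A_def)
    finally show "norm ((force s \<bullet> (sR s *v e3)) *\<^sub>R (sR s *v e3) - force s) \<le> B * (2 * m) * norm (att s - mat 1)"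
      by (simp add: A_def \<beta>_def mult.assoc)
  qed
qed

text \<open>With \<open>w' = q \<times> q''\<close> and \<open>q'' = w' \<times> q + (q \<bullet> q'') q\<close>, the equations of motion agree with the
  linear ones up to terms of second order and the misalignment of the thrust.\<close>

lemma acc_equations:
  assumes s: "s \<in> S" "s \<in> states"
  defines "a \<equiv> fst (acc s)" and "p \<equiv> \<lambda>i. snd (acc s) $ i" and "q \<equiv> \<lambda>i. sq s $ i"
  shows "M00 P *\<^sub>R a + (\<Sum>i\<in>UNIV. M0 P i *\<^sub>R p i) = (force s \<bullet> (sR s *v e3)) *\<^sub>R (sR s *v e3) + (M00 P * gravity P) *\<^sub>R e3"
    and "q i \<bullet> p i = - (norm (sw s $ i))\<^sup>2"
    and "M0 P i *\<^sub>R cross3 (q i) a + (\<Sum>j\<in>UNIV. Mij P i j *\<^sub>R cross3 (q i) (p j)) + Gi P i *\<^sub>R cross3 e3 (q i) = 0"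
    and "p i = cross3 (cross3 (q i) (p i)) (q i) + (q i \<bullet> p i) *\<^sub>R q i"
proof -
  define w where "w i = sw s $ i" for i
  have "norm (q i) = 1" "q i \<bullet> w i = 0" for i using s(2) by (auto simp: states_def q_def w_def)
  then have qq: "q i \<bullet> q i = 1" and qw: "q i \<bullet> w i = 0" for i by (auto simp: norm_eq_1)
  have eq: "inertia_op (sq s) (acc s) = load s" by (rule acc[OF s(1)])
  show "M00 P *\<^sub>R a + (\<Sum>i\<in>UNIV. M0 P i *\<^sub>R p i) = (force s \<bullet> (sR s *v e3)) *\<^sub>R (sR s *v e3) + (M00 P * gravity P) *\<^sub>R e3"
    using arg_cong[OF eq, of fst] by (simp add: inertia_op_def load_def a_def p_def)
  define F where "F = coupling i (acc s)"
  have e2: "Mij P i i *\<^sub>R p i - cross3 (q i) (cross3 (q i) F)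
      = - ((Mij P i i * (cross3 (w i) (q i) \<bullet> cross3 (w i) (q i))) *\<^sub>R q i) - Gi P i *\<^sub>R cross3 (q i) (cross3 (q i) e3)"
    using arg_cong[OF eq, of "\<lambda>z. snd z $ i"] by (simp add: inertia_op_def load_def p_def q_def w_def F_def)
  have ww: "cross3 (w i) (q i) \<bullet> cross3 (w i) (q i) = (norm (w i))\<^sup>2"
    using norm_cross_dot[of "w i" "q i"] qw[of i] qq[of i]
    by (simp add: power2_norm_eq_inner[symmetric] inner_commute power_mult_distrib)
  have "Mij P i i * (q i \<bullet> p i) = - (Mij P i i * (norm (w i))\<^sup>2)"
    using arg_cong[OF e2, of "\<lambda>y. q i \<bullet> y"] qq[of i] by (simp add: inner_diff_right dot_cross_self ww)
  then have "Mij P i i * (q i \<bullet> p i) = Mij P i i * - (norm (w i))\<^sup>2" by simp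
  then show "q i \<bullet> p i = - (norm (sw s $ i))\<^sup>2"
    unfolding w_def[symmetric] mult_left_cancel[OF less_imp_neq[OF Mii_pos, symmetric]] .
  have q3: "cross3 (q i) (cross3 (q i) (cross3 (q i) y)) = - cross3 (q i) y" for y
    unfolding Lagrange[of "q i" "q i" "cross3 (q i) y"] using qq[of i] by (simp add: dot_cross_self)
  have m: "Mij P i i *\<^sub>R cross3 (q i) (p i) + cross3 (q i) F = Gi P i *\<^sub>R cross3 (q i) e3"
    using arg_cong[OF e2, of "cross3 (q i)"]
    by (simp add: Cross3.right_diff_distrib cross_mult_right q3)
  have cF: "cross3 (q i) F = M0 P i *\<^sub>R cross3 (q i) a + (\<Sum>j\<in>UNIV - {i}. Mij P i j *\<^sub>R cross3 (q i) (p j))"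
    unfolding F_def coupling_def
    by (simp add: cross_add_right cross_mult_right a_def p_def
        linear_sum[OF bounded_linear.linear[OF bounded_bilinear.bounded_linear_right[OF bounded_bilinear_cross3]]])
  have sm: "(\<Sum>j\<in>UNIV. Mij P i j *\<^sub>R cross3 (q i) (p j))
      = Mij P i i *\<^sub>R cross3 (q i) (p i) + (\<Sum>j\<in>UNIV - {i}. Mij P i j *\<^sub>R cross3 (q i) (p j))"
    by (rule sum.remove) auto
  have "M0 P i *\<^sub>R cross3 (q i) a + (\<Sum>j\<in>UNIV. Mij P i j *\<^sub>R cross3 (q i) (p j))
      = Mij P i i *\<^sub>R cross3 (q i) (p i) + cross3 (q i) F"
    unfolding cF sm by (simp only: ac_simps)
  then show "M0 P i *\<^sub>R cross3 (q i) a + (\<Sum>j\<in>UNIV. Mij P i j *\<^sub>R cross3 (q i) (p j)) + Gi P i *\<^sub>R cross3 e3 (q i) = 0"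
    unfolding m by (simp add: cross_skew[of "q i" e3])
  show "p i = cross3 (cross3 (q i) (p i)) (q i) + (q i \<bullet> p i) *\<^sub>R q i"
    using qq[of i] Lagrange[of "q i" "q i" "p i"] cross_skew[of "cross3 (q i) (p i)" "q i"] by simp
qed

text \<open>The kinematic part compares link velocities with angular velocities. The dynamic part is
  measured by the residual that the true rates leave in the linear equations; subtracting the exact
  equations of motion from it removes all first order terms except the misalignment of the
  thrust.\<close>

lemma err_rate_bound:
  obtains C where "0 < C" "\<And>s. s \<in> S \<Longrightarrow> s \<in> states \<Longrightarrow>
    norm (err_rate s - lin (err s)) \<le> C * norm (att s - mat 1) + C * (D s)\<^sup>2"
proof -
  obtain Ca where Ca: "0 < Ca" "\<And>s. s \<in> S \<Longrightarrow> norm (acc s) \<le> Ca * D s" using acc_bound by blast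
  obtain Ct where Ct: "0 < Ct" "\<And>s. s \<in> S \<Longrightarrow> s \<in> states \<Longrightarrow>
    norm ((force s \<bullet> (sR s *v e3)) *\<^sub>R (sR s *v e3) - force s) \<le> Ct * norm (att s - mat 1)"
    using thrust_error by blast
  obtain Cm where Cm: "0 < Cm" "\<And>z. norm (mass_inv *v z) \<le> norm z * Cm"
    using bounded_linear.pos_bounded[OF bounded_bilinear.bounded_linear_right[OF bounded_bilinear_matrix_vector]] by blast
  define C0 where "C0 = (\<Sum>j\<in>UNIV. \<bar>M0 P j\<bar> * (Ca + 1))"
  define C1 where "C1 = (\<Sum>i\<in>UNIV. \<bar>M0 P i\<bar> * Ca + (\<Sum>j\<in>UNIV. \<bar>Mij P i j\<bar> * (3 * Ca + 1)))"
  have C01: "0 \<le> C0" "0 \<le> C1" unfolding C0_def C1_def using Ca(1) by (auto intro!: sum_nonneg add_nonneg_nonneg)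
  define N where "N = real CARD('n) * 2"
  show thesis
  proof (rule that)
    show "0 < N + Cm * (Ct + C0 + C1)" using Cm Ct C01 by (simp add: N_def add_pos_pos add_nonneg_pos)
    fix s assume s: "s \<in> S" "s \<in> states"
    define a p q w w' where "a = fst (acc s)" and "p i = snd (acc s) $ i" and "q i = sq s $ i" and "w i = sw s $ i"
      and "w' i = cross3 (q i) (p i)" for i
    note eqs = acc_equations[OF s, folded a_def]
    define d where "d = D s"
    have d0: "0 \<le> d" by (simp add: d_def)
    have dr: "d \<le> 1" using s(1) r_le by (simp add: S_def d_def)
    have q: "norm (q i - e3) \<le> d" and w: "norm (w i) \<le> d" for i
      using component_bounds(3,4)[of s i] by (auto simp: q_def w_def d_def)
    have q1: "norm (q i) = 1" for i using s(2) by (auto simp: states_def q_def)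
    have accd: "norm (acc s) \<le> Ca * d" using Ca(2)[OF s(1)] by (simp add: d_def)
    have a: "norm a \<le> Ca * d" using accd norm_fst_le[of "fst (acc s)" "snd (acc s)"] by (simp add: a_def)
    have p: "norm (p i) \<le> Ca * d" for i
      using accd norm_snd_le[of "snd (acc s)" "fst (acc s)"] Finite_Cartesian_Product.norm_nth_le[of "snd (acc s)" i] by (simp add: p_def)
    have w': "norm (w' i) \<le> Ca * d" for i
      using norm_cross_le[of "q i" "p i"] p[of i] q1[of i] by (simp add: w'_def)
    have qp: "q i \<bullet> p i = - (norm (w i))\<^sup>2" for i using eqs(2) by (simp add: q_def p_def w_def)
    have ww: "(norm (w i))\<^sup>2 \<le> d\<^sup>2" for i using w[of i] by (intro power_mono) auto
    have pw: "p i = cross3 (w' i) (q i) + (q i \<bullet> p i) *\<^sub>R q i" for i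
      using eqs(4)[of i] by (simp add: q_def p_def w'_def)
    have R1: "norm (pos_rate s - vel_err s) \<le> N * d\<^sup>2"
    proof -
      have "pos_rate s - vel_err s = block_vector 0 (\<lambda>i. transpose C32 *v cross3 e3 (cross3 (w i) (q i)) - transpose C32 *v w i)"
        unfolding pos_rate_def vel_err_def w_def q_def block_vector_diff[symmetric] by simp
      also have "norm \<dots> \<le> (\<Sum>i\<in>(UNIV::'n set). 2 * d\<^sup>2)"
      proof (rule order_trans[OF norm_block_vector_le], simp only: norm_zero add_0, rule sum_mono)
        fix i
        have "norm (transpose C32 *v cross3 e3 (cross3 (w i) (q i)) - transpose C32 *v w i) \<le> 2 * (norm (w i) * norm (q i - e3))"
          by (rule transpose_C32_cross_le)
        also have "\<dots> \<le> 2 * (d * d)" using w[of i] q[of i] d0 by (intro mult_left_mono mult_mono) auto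
        finally show "norm (transpose C32 *v cross3 e3 (cross3 (w i) (q i)) - transpose C32 *v w i) \<le> 2 * d\<^sup>2"
          by (simp add: power2_eq_square)
      qed
      finally show ?thesis by (simp add: N_def)
    qed
    \<comment> \<open>The residual of the linear equations at the true rates. It is estimated
      without the inverse of the mass matrix, which enters only through the factor
      \<open>Cm\<close>.\<close>
    define \<rho> where "\<rho> = mass_matrix P *v vel_rate s + gravity_matrix P *v pos_err s
       - input_matrix *v (- (Kx K *v pos_err s) - Kv K *v vel_err s)"
    have "vel_rate s - snd (lin (err s)) = mass_inv *v \<rho>"
      unfolding \<rho>_def lin_def err_def
      by (simp add: matrix_vector_right_distrib matrix_vector_mult_diff_distrib mass_inv)
    then have R2: "norm (vel_rate s - snd (lin (err s))) \<le> norm \<rho> * Cm" using Cm(2) by simp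
    \<comment> \<open>The linear model takes \<open>- cross3 e3 (w' j)\<close> for the link
      acceleration \<open>p j\<close>. By \<open>pw\<close> the gap is
      \<open>cross3 (w' j) (q j - e3)\<close> plus the centripetal term, both of second
      order.\<close>
    define \<rho>0 where "\<rho>0 = ((force s \<bullet> (sR s *v e3)) *\<^sub>R (sR s *v e3) - force s) - (\<Sum>j\<in>UNIV. M0 P j *\<^sub>R (p j + cross3 e3 (w' j)))"
    \<comment> \<open>The linear link equation minus the exact one, in which \<open>q i\<close>
      stands in the place of \<open>e3\<close>. The gravity terms of the two coincide.\<close>
    define \<rho>i where "\<rho>i i = transpose C32 *v (M0 P i *\<^sub>R cross3 (e3 - q i) a
       + (\<Sum>j\<in>UNIV. Mij P i j *\<^sub>R (w' j - cross3 (q i) (p j))))" for i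
    have \<rho>: "\<rho> = block_vector \<rho>0 \<rho>i"
    proof -
      have 1: "M00 P *\<^sub>R a - (\<Sum>j\<in>UNIV. M0 P j *\<^sub>R cross3 e3 (w' j)) - (- (Kx K *v pos_err s) - Kv K *v vel_err s) = \<rho>0"
      proof -
        have "- (Kx K *v pos_err s) - Kv K *v vel_err s = force s + (M00 P * gravity P) *\<^sub>R e3"
          by (simp add: force_def)
        moreover have "M00 P *\<^sub>R a = (force s \<bullet> (sR s *v e3)) *\<^sub>R (sR s *v e3) + (M00 P * gravity P) *\<^sub>R e3 - (\<Sum>i\<in>UNIV. M0 P i *\<^sub>R p i)"
          using eqs(1) by (simp add: p_def eq_diff_eq)
        ultimately show ?thesis by (simp add: \<rho>0_def scaleR_add_right sum.distrib)
      qed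
      have 2: "M0 P i *\<^sub>R (transpose C32 *v cross3 e3 a) + (\<Sum>j\<in>UNIV. Mij P i j *\<^sub>R (transpose C32 *v w' j))
          + Gi P i *\<^sub>R (transpose C32 *v cross3 e3 (q i)) = \<rho>i i" for i
      proof -
        have "M0 P i *\<^sub>R (transpose C32 *v cross3 e3 a) + (\<Sum>j\<in>UNIV. Mij P i j *\<^sub>R (transpose C32 *v w' j))
          + Gi P i *\<^sub>R (transpose C32 *v cross3 e3 (q i))
          = transpose C32 *v (M0 P i *\<^sub>R cross3 e3 a + (\<Sum>j\<in>UNIV. Mij P i j *\<^sub>R w' j) + Gi P i *\<^sub>R cross3 e3 (q i))"
          by (simp add: matrix_vector_right_distrib matrix_vector_mult_scaleR
              linear_sum[OF matrix_vector_mul_linear] del: transpose_matrix_vector)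
        also have "M0 P i *\<^sub>R cross3 e3 a + (\<Sum>j\<in>UNIV. Mij P i j *\<^sub>R w' j) + Gi P i *\<^sub>R cross3 e3 (q i)
          = M0 P i *\<^sub>R cross3 (e3 - q i) a + (\<Sum>j\<in>UNIV. Mij P i j *\<^sub>R (w' j - cross3 (q i) (p j)))"
          using eqs(3)[of i]
          by (simp add: q_def[symmetric] p_def[symmetric] Cross3.left_diff_distrib scaleR_diff_right sum_subtractf algebra_simps)
        finally show ?thesis by (simp only: \<rho>i_def)
      qed
      have "\<rho> = block_vector (M00 P *\<^sub>R a - (\<Sum>j\<in>UNIV. M0 P j *\<^sub>R cross3 e3 (w' j)))
             (\<lambda>i. M0 P i *\<^sub>R (transpose C32 *v cross3 e3 a) + (\<Sum>j\<in>UNIV. Mij P i j *\<^sub>R (transpose C32 *v w' j)))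
          + block_vector 0 (\<lambda>i. Gi P i *\<^sub>R (transpose C32 *v cross3 e3 (q i)))
          - block_vector (- (Kx K *v pos_err s) - Kv K *v vel_err s) (\<lambda>i. 0)"
        unfolding \<rho>_def vel_rate_def mass_matrix_mult cross_e3_C32 input_matrix_mult a_def w'_def q_def p_def
        by (simp only: pos_err_def[of s] gravity_matrix_mult)
      then show ?thesis
        unfolding block_vector_add[symmetric] block_vector_diff[symmetric] by (simp add: 1 2 del: transpose_matrix_vector)
    qed
    have "norm \<rho>0 \<le> Ct * norm (att s - mat 1) + C0 * d\<^sup>2"
      unfolding \<rho>0_def
    proof (rule norm_triangle_le_diff, rule add_mono)
      show "norm ((force s \<bullet> (sR s *v e3)) *\<^sub>R (sR s *v e3) - force s) \<le> Ct * norm (att s - mat 1)" by (rule Ct(2)[OF s])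
      have "norm (M0 P j *\<^sub>R (p j + cross3 e3 (w' j))) \<le> \<bar>M0 P j\<bar> * (Ca + 1) * d\<^sup>2" for j
      proof -
        have "p j + cross3 e3 (w' j) = cross3 (w' j) (q j - e3) + (q j \<bullet> p j) *\<^sub>R q j"
          using pw[of j] cross_skew[of e3 "w' j"] by (simp add: Cross3.right_diff_distrib)
        also have "norm \<dots> \<le> (Ca * d) * d + d\<^sup>2"
          by (intro norm_triangle_le add_mono order_trans[OF norm_cross_le] mult_mono w' q)
            (use Ca d0 qp q1 ww in auto)
        finally have "norm (p j + cross3 e3 (w' j)) \<le> (Ca + 1) * d\<^sup>2" by (simp add: power2_eq_square algebra_simps)
        then show ?thesis by (simp add: mult.assoc mult_left_mono)
      qed
      then have "norm (\<Sum>j\<in>UNIV. M0 P j *\<^sub>R (p j + cross3 e3 (w' j))) \<le> (\<Sum>j\<in>UNIV. \<bar>M0 P j\<bar> * (Ca + 1) * d\<^sup>2)"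
        by (intro sum_norm_le) auto
      then show "norm (\<Sum>j\<in>UNIV. M0 P j *\<^sub>R (p j + cross3 e3 (w' j))) \<le> C0 * d\<^sup>2"
        by (simp add: C0_def sum_distrib_right)
    qed
    moreover have "(\<Sum>i\<in>UNIV. norm (\<rho>i i)) \<le> C1 * d\<^sup>2"
    proof -
      have "norm (\<rho>i i) \<le> (\<bar>M0 P i\<bar> * Ca + (\<Sum>j\<in>UNIV. \<bar>Mij P i j\<bar> * (3 * Ca + 1))) * d\<^sup>2" for i
      proof -
        have A: "norm (transpose C32 *v (w' j - cross3 (q i) (p j))) \<le> (3 * Ca + 1) * d\<^sup>2" for j
        proof -
          \<comment> \<open>The first bracket is of second order under \<open>transpose C32\<close>
            by \<open>transpose_C32_cross_le\<close>. The other terms arise from replacing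
            \<open>q i\<close> by \<open>e3\<close> and inserting the decomposition
            \<open>pw\<close> of \<open>p j\<close>; each has at least two small factors.\<close>
          have eq: "w' j - cross3 (q i) (p j) = (w' j - cross3 e3 (cross3 (w' j) (q j)))
              + (cross3 (e3 - q i) (p j) - (q j \<bullet> p j) *\<^sub>R cross3 e3 (q j - e3))"
          proof -
            have "cross3 e3 (p j) = cross3 e3 (cross3 (w' j) (q j)) + (q j \<bullet> p j) *\<^sub>R cross3 e3 (q j)"
              by (subst pw) (simp add: cross_add_right cross_mult_right)
            then show ?thesis by (simp add: Cross3.left_diff_distrib Cross3.right_diff_distrib)
          qed
          have "norm (transpose C32 *v (w' j - cross3 e3 (cross3 (w' j) (q j)))) \<le> 2 * (norm (w' j) * norm (q j - e3))"
            using transpose_C32_cross_le[of "w' j" "q j"]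
            by (simp add: matrix_vector_mult_diff_distrib norm_minus_commute del: transpose_matrix_vector)
          also have "\<dots> \<le> 2 * ((Ca * d) * d)" using w'[of j] q[of j] Ca d0 by (intro mult_left_mono mult_mono) auto
          finally have b1: "norm (transpose C32 *v (w' j - cross3 e3 (cross3 (w' j) (q j)))) \<le> 2 * ((Ca * d) * d)" .
          have "norm (cross3 (e3 - q i) (p j)) \<le> d * (Ca * d)"
            by (rule order_trans[OF norm_cross_le]) (use q[of i] p[of j] d0 in \<open>auto intro!: mult_mono simp: norm_minus_commute\<close>)
          moreover have "norm ((q j \<bullet> p j) *\<^sub>R cross3 e3 (q j - e3)) \<le> d\<^sup>2 * 1"
            unfolding norm_scaleR
            using norm_cross_le[of e3 "q j - e3"] q[of j] dr ww[of j] by (intro mult_mono) (auto simp: qp norm_axis_1)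
          ultimately have "norm (cross3 (e3 - q i) (p j) - (q j \<bullet> p j) *\<^sub>R cross3 e3 (q j - e3)) \<le> d * (Ca * d) + d\<^sup>2"
            by (intro norm_triangle_le_diff) simp
          then have b2: "norm (transpose C32 *v (cross3 (e3 - q i) (p j) - (q j \<bullet> p j) *\<^sub>R cross3 e3 (q j - e3))) \<le> d * (Ca * d) + d\<^sup>2"
            by (rule order_trans[OF norm_transpose_C32_le])
          have "norm (transpose C32 *v (w' j - cross3 (q i) (p j))) \<le> 2 * ((Ca * d) * d) + (d * (Ca * d) + d\<^sup>2)"
            unfolding eq matrix_vector_right_distrib by (rule norm_triangle_le[OF add_mono[OF b1 b2]])
          then show ?thesis by (simp add: power2_eq_square algebra_simps)
        qed
        have "norm (transpose C32 *v cross3 (e3 - q i) a) \<le> Ca * d\<^sup>2"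
        proof -
          have "norm (cross3 (e3 - q i) a) \<le> d * (Ca * d)"
            by (rule order_trans[OF norm_cross_le]) (use q[of i] a d0 in \<open>auto intro!: mult_mono simp: norm_minus_commute\<close>)
          then have "norm (transpose C32 *v cross3 (e3 - q i) a) \<le> d * (Ca * d)"
            by (rule order_trans[OF norm_transpose_C32_le])
          then show ?thesis by (simp add: power2_eq_square algebra_simps)
        qed
        then have "norm (M0 P i *\<^sub>R (transpose C32 *v cross3 (e3 - q i) a)) \<le> \<bar>M0 P i\<bar> * (Ca * d\<^sup>2)"
          unfolding norm_scaleR by (rule mult_left_mono) simp
        moreover have "norm (\<Sum>j\<in>UNIV. Mij P i j *\<^sub>R (transpose C32 *v (w' j - cross3 (q i) (p j))))
            \<le> (\<Sum>j\<in>UNIV. \<bar>Mij P i j\<bar> * ((3 * Ca + 1) * d\<^sup>2))"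
          by (rule sum_norm_le) (unfold norm_scaleR, rule mult_left_mono[OF A], simp)
        moreover have "\<rho>i i = M0 P i *\<^sub>R (transpose C32 *v cross3 (e3 - q i) a)
            + (\<Sum>j\<in>UNIV. Mij P i j *\<^sub>R (transpose C32 *v (w' j - cross3 (q i) (p j))))"
          unfolding \<rho>i_def matrix_vector_right_distrib linear_sum[OF matrix_vector_mul_linear] matrix_vector_mult_scaleR ..
        ultimately have "norm (\<rho>i i) \<le> \<bar>M0 P i\<bar> * (Ca * d\<^sup>2) + (\<Sum>j\<in>UNIV. \<bar>Mij P i j\<bar> * ((3 * Ca + 1) * d\<^sup>2))"
          by (simp only:) (rule norm_triangle_le, rule add_mono)
        then show ?thesis by (simp add: distrib_right sum_distrib_right mult.assoc)
      qed
      then show ?thesis unfolding C1_def sum_distrib_right by (rule sum_mono)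
    qed
    ultimately have "norm \<rho> \<le> Ct * norm (att s - mat 1) + C0 * d\<^sup>2 + C1 * d\<^sup>2"
      unfolding \<rho> using norm_block_vector_le[of \<rho>0 \<rho>i] by linarith
    then have "norm \<rho> * Cm \<le> (Ct * norm (att s - mat 1) + C0 * d\<^sup>2 + C1 * d\<^sup>2) * Cm" using Cm(1) by simp
    moreover have "err_rate s - lin (err s) = (pos_rate s - vel_err s, vel_rate s - snd (lin (err s)))"
      by (simp add: err_rate_def lin_def err_def)
    then have "norm (err_rate s - lin (err s)) \<le> norm (pos_rate s - vel_err s) + norm (vel_rate s - snd (lin (err s)))"
      by (simp add: norm_Pair_le)
    ultimately have "norm (err_rate s - lin (err s)) \<le> N * d\<^sup>2 + (Ct * norm (att s - mat 1) + C0 * d\<^sup>2 + C1 * d\<^sup>2) * Cm"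
      using R1 R2 by linarith
    also have "\<dots> = (Cm * Ct) * norm (att s - mat 1) + (N + Cm * (C0 + C1)) * d\<^sup>2" by (simp add: algebra_simps)
    also have "\<dots> \<le> (N + Cm * (Ct + C0 + C1)) * norm (att s - mat 1) + (N + Cm * (Ct + C0 + C1)) * d\<^sup>2"
      using Cm Ct C01 by (intro add_mono mult_right_mono) (auto simp: N_def distrib_left)
    finally show "norm (err_rate s - lin (err s)) \<le> (N + Cm * (Ct + C0 + C1)) * norm (att s - mat 1)
        + (N + Cm * (Ct + C0 + C1)) * (D s)\<^sup>2" by (simp add: d_def)
  qed
qed

end

section \<open>Error coordinates\<close>

lemma e_R_derivative:
  fixes Rd R :: "real \<Rightarrow> real^3^3"
  assumes "((\<lambda>t. transpose (Rd t) ** R t) has_vector_derivative (transpose (Rd t) ** R t) ** hat e) (at t within T)"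
  shows "((\<lambda>t. e_R (Rd t) (R t)) has_vector_derivative
    (1/2) *\<^sub>R vee ((transpose (Rd t) ** R t) ** hat e + hat e ** transpose (transpose (Rd t) ** R t))) (at t within T)"
proof -
  have eR: "e_R Rd R = (1/2) *\<^sub>R vee (transpose Rd ** R - transpose (transpose Rd ** R))" for Rd R
    by (simp add: e_R_def matrix_transpose_mul)
  have tr: "transpose (Q ** hat e) = - (hat e ** transpose Q)" for Q :: "real^3^3"
    by (simp add: matrix_transpose_mul transpose_hat bounded_bilinear.minus_left[OF bounded_bilinear_matrix_mult])
  show ?thesis
    unfolding eR
    using bounded_linear.has_vector_derivative[OF bounded_linear_scaleR_right bounded_linear.has_vector_derivative[OF bounded_linear_vee
      has_vector_derivative_diff[OF assms bounded_linear.has_vector_derivative[OF bounded_linear_transpose assms]]], of "1/2"]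
    unfolding tr by simp
qed

text \<open>The feedback terms of the moment cancel the drift of the commanded attitude.\<close>

lemma e_Om_derivative:
  fixes Rd R :: "real \<Rightarrow> real^3^3" and J Ji :: "real^3^3"
  assumes Q: "((\<lambda>t. transpose (Rd t) ** R t) has_vector_derivative
      (transpose (Rd t) ** R t) ** hat (e_Om (Rd t) (Omd t) (R t) (Om t))) (at t within T)"
    and Omd: "(Omd has_vector_derivative Omd') (at t within T)" and Om: "(Om has_vector_derivative Om') (at t within T)"
    and J: "\<And>v. Ji *v (J *v v) = v"
    and eq: "J *v Om' + hat (Om t) *v (J *v Om t) = - (a *\<^sub>R e_R (Rd t) (R t)) - b *\<^sub>R e_Om (Rd t) (Omd t) (R t) (Om t)
      + cross3 (Om t) (J *v Om t)
      - J *v (hat (Om t) *v ((transpose (R t) ** Rd t) *v Omd t) - (transpose (R t) ** Rd t) *v Omd')"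
  shows "((\<lambda>t. e_Om (Rd t) (Omd t) (R t) (Om t)) has_vector_derivative
    - (Ji *v (a *\<^sub>R e_R (Rd t) (R t) + b *\<^sub>R e_Om (Rd t) (Omd t) (R t) (Om t)))) (at t within T)"
proof -
  define e where "e t = e_Om (Rd t) (Omd t) (R t) (Om t)" for t
  define q where "q = (transpose (R t) ** Rd t) *v Omd t"
  have tQ: "transpose (transpose Rd ** R) = transpose R ** Rd" for Rd R :: "real^3^3"
    by (simp add: matrix_transpose_mul)
  have "((\<lambda>t. transpose (R t) ** Rd t) has_vector_derivative transpose ((transpose (Rd t) ** R t) ** hat (e t))) (at t within T)"
    using bounded_linear.has_vector_derivative[OF bounded_linear_transpose Q] unfolding tQ e_def .
  moreover have "transpose ((transpose (Rd t) ** R t) ** hat (e t)) = - (hat (e t) ** (transpose (R t) ** Rd t))"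
    by (simp add: matrix_transpose_mul transpose_hat bounded_bilinear.minus_left[OF bounded_bilinear_matrix_mult])
  ultimately have d: "((\<lambda>t. transpose (R t) ** Rd t) has_vector_derivative - (hat (e t) ** (transpose (R t) ** Rd t))) (at t within T)"
    by simp
  have "((\<lambda>t. (transpose (R t) ** Rd t) *v Omd t) has_vector_derivative
      ((transpose (R t) ** Rd t) *v Omd' + (- (hat (e t) ** (transpose (R t) ** Rd t))) *v Omd t)) (at t within T)"
    by (rule bounded_bilinear.has_vector_derivative[OF bounded_bilinear_matrix_vector d Omd])
  \<comment> \<open>Since \<open>e t = Om t - q\<close>, the cross products of \<open>e t\<close>
    and of \<open>Om t\<close> with \<open>q\<close> agree. This is the term that the moment feeds
    back.\<close>
  moreover have "(- (hat (e t) ** (transpose (R t) ** Rd t))) *v Omd t = - cross3 (Om t) q"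
  proof -
    have "(- (hat (e t) ** (transpose (R t) ** Rd t))) *v Omd t = - cross3 (e t) q"
      by (simp only: bounded_bilinear.minus_left[OF bounded_bilinear_matrix_vector] q_def matrix_vector_mul_assoc[symmetric] hat_mult)
    moreover have "e t = Om t - q" by (simp add: e_def e_Om_def q_def)
    ultimately show ?thesis by (simp add: Cross3.left_diff_distrib)
  qed
  ultimately have "((\<lambda>t. (transpose (R t) ** Rd t) *v Omd t) has_vector_derivative
      ((transpose (R t) ** Rd t) *v Omd' - cross3 (Om t) q)) (at t within T)" by simp
  from has_vector_derivative_diff[OF Om this]
  have "(e has_vector_derivative Om' - ((transpose (R t) ** Rd t) *v Omd' - cross3 (Om t) q)) (at t within T)"
    unfolding e_def e_Om_def .
  moreover have "Om' - ((transpose (R t) ** Rd t) *v Omd' - cross3 (Om t) q) = - (Ji *v (a *\<^sub>R e_R (Rd t) (R t) + b *\<^sub>R e t))"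
  proof -
    have "J *v (Om' - ((transpose (R t) ** Rd t) *v Omd' - cross3 (Om t) q)) = - (a *\<^sub>R e_R (Rd t) (R t) + b *\<^sub>R e t)"
      using eq unfolding hat_mult q_def[symmetric] e_def[symmetric]
      by (simp add: matrix_vector_mult_diff_distrib algebra_simps)
    from arg_cong[OF this, of "(*v) Ji"] show ?thesis
      by (simp only: J bounded_bilinear.minus_right[OF bounded_bilinear_matrix_vector])
  qed
  ultimately show ?thesis by (simp add: e_def[abs_def])
qed

text \<open>Provides uniqueness of derivatives within \<open>T\<close> at every point, including the
  endpoint 0.\<close>

lemma interval_limit_point:
  fixes T :: "real set"
  assumes "T = {0..} \<or> (\<exists>b>0. T = {0..<b})" "t \<in> T"
  shows "at t within T \<noteq> bot"
proof -
  obtain u where u: "t < u" "{t<..<u} \<subseteq> T"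
  proof (cases "T = {0..}")
    case True
    with assms(2) show ?thesis by (intro that[of "t + 1"]) auto
  next
    case False
    then obtain b where "T = {0..<b}" using assms(1) by blast
    with assms(2) show ?thesis by (intro that[of b]) auto
  qed
  have "t islimpt T" using islimpt_subset[OF islimpt_greaterThanLessThan1[OF u(1)] u(2)] .
  then show ?thesis by (simp add: trivial_limit_within)
qed

context quadrotor_ball
begin

lemma linearized_dynamics_of_lin:
  assumes "\<And>t. 0 \<le> t \<Longrightarrow> (\<phi> has_vector_derivative lin (\<phi> t)) (at t within {0..})"
  shows "linearized_dynamics P K {0..} \<phi>"
proof -
  define z'' where "z'' t = snd (lin (\<phi> t))" for t
  have "\<phi> t = (fst (\<phi> t), snd (\<phi> t)) \<and>
     ((\<lambda>t. fst (\<phi> t)) has_vector_derivative snd (\<phi> t)) (at t within {0..}) \<and>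
     ((\<lambda>t. snd (\<phi> t)) has_vector_derivative z'' t) (at t within {0..}) \<and>
     mass_matrix P *v z'' t + gravity_matrix P *v fst (\<phi> t)
       = input_matrix *v (- (Kx K *v fst (\<phi> t)) - Kv K *v snd (\<phi> t))" if "t \<in> {0..}" for t
  proof -
    have d: "(\<phi> has_vector_derivative lin (\<phi> t)) (at t within {0..})" using assms that by simp
    show ?thesis
      using bounded_linear.has_vector_derivative[OF bounded_linear_fst d]
        bounded_linear.has_vector_derivative[OF bounded_linear_snd d]
      by (simp add: z''_def lin_def mass_inv)
  qed
  then show ?thesis unfolding linearized_dynamics_def
    by (intro exI[of _ "\<lambda>t. fst (\<phi> t)"] exI[of _ "\<lambda>t. snd (\<phi> t)"] exI[of _ z''] ballI)
qed

text \<open>A linear equation turns local attraction into global attraction: any solution is scaled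
  into the region of attraction, and the limit 0 is scaled back.\<close>

lemma lin_converges:
  assumes "\<And>t. 0 \<le> t \<Longrightarrow> (\<phi> has_vector_derivative lin (\<phi> t)) (at t within {0..})"
  shows "(\<phi> \<longlongrightarrow> 0) at_top"
proof -
  obtain \<delta> where \<delta>: "\<delta> > 0" "\<And>\<psi>. linearized_dynamics P K {0..} \<psi> \<Longrightarrow> dist (\<psi> 0) 0 < \<delta> \<Longrightarrow> (\<psi> \<longlongrightarrow> 0) at_top"
    using stable unfolding asymptotically_stable_def by blast
  define n where "n = norm (\<phi> 0) + 1"
  have n: "0 < n" unfolding n_def by (intro add_nonneg_pos) auto
  define k where "k = \<delta> / (2 * n)"
  have k: "k > 0" using \<delta>(1) n by (simp add: k_def)
  have "linearized_dynamics P K {0..} (\<lambda>t. k *\<^sub>R \<phi> t)"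
  proof (rule linearized_dynamics_of_lin)
    fix t :: real assume "0 \<le> t"
    from bounded_linear.has_vector_derivative[OF bounded_linear_scaleR_right assms[OF this], of k]
    show "((\<lambda>t. k *\<^sub>R \<phi> t) has_vector_derivative lin (k *\<^sub>R \<phi> t)) (at t within {0..})"
      by (simp add: linear_scale[OF bounded_linear.linear[OF bounded_linear_lin]])
  qed
  moreover have "norm (k *\<^sub>R \<phi> 0) < \<delta>"
  proof -
    have "norm (k *\<^sub>R \<phi> 0) \<le> k * n" using k by (simp add: n_def)
    also have "\<dots> = \<delta> / 2" using n by (simp add: k_def)
    finally show ?thesis using \<delta>(1) by simp
  qed
  ultimately have "((\<lambda>t. k *\<^sub>R \<phi> t) \<longlongrightarrow> 0) at_top" by (intro \<delta>(2)) simp_all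
  from tendsto_scaleR[OF tendsto_const this, of "inverse k"] show ?thesis using k by simp
qed

text \<open>The commanded angular velocity as a function of the state. Through \<open>acc\<close> it
  depends on the attitude, but not on the angular velocity.\<close>

definition omc :: "'n state \<Rightarrow> real^3" where
  "omc s = vee (transpose (Rc P K s) ** commanded_deriv (heading K) (force s) (force_rate s))"

definition eta :: "'n state \<Rightarrow> (real^3) \<times> (real^3)" where
  "eta s = (e_R (Rc P K s) (sR s), e_Om (Rc P K s) (omc s) (sR s) (sOm s))"

lemma err_bound: obtains C where "0 < C" "\<And>s. norm (err s) \<le> C * D s"
proof -
  have "lip UNIV err" unfolding err_def[abs_def] by (intro lip_intros)
  from lipD[OF this] obtain C where C: "0 < C" "\<And>s t. norm (err s - err t) \<le> C * norm (s - t)" by auto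
  have "err equilibrium = 0" by (simp add: err_def err_equilibrium zero_prod_def)
  with C(2)[of _ equilibrium] have "norm (err s) \<le> C * D s" for s by simp
  with C(1) show thesis by (rule that)
qed

lemma force_linear_bound:
  obtains C where "0 < C" "\<And>z y :: real^(3 + 'n \<times> 2). norm (- (Kx K *v z) - Kv K *v y) \<le> C * norm (z, y)"
proof -
  have "bounded_linear (\<lambda>x :: (real^(3 + 'n \<times> 2)) \<times> (real^(3 + 'n \<times> 2)). - (Kx K *v fst x) - Kv K *v snd x)"
    by (intro bounded_linear_sub bounded_linear_minus
        bounded_linear_compose[OF bounded_bilinear.bounded_linear_right[OF bounded_bilinear_matrix_vector]]
        bounded_linear_fst bounded_linear_snd)
  from bounded_linear.pos_bounded[OF this] obtain C where C: "0 < C"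
    "\<And>x :: (real^(3 + 'n \<times> 2)) \<times> (real^(3 + 'n \<times> 2)). norm (- (Kx K *v fst x) - Kv K *v snd x) \<le> norm x * C" by blast
  show thesis by (rule that[OF C(1)]) (use C(2)[of "(_, _)"] in \<open>simp add: mult.commute\<close>)
qed

lemma Rc_bounded: obtains B where "0 < B" "\<And>s. s \<in> S \<Longrightarrow> norm (Rc P K s) \<le> B" "\<And>s. s \<in> S \<Longrightarrow> norm (transpose (Rc P K s)) \<le> B"
proof -
  obtain C where C: "0 < C" "\<And>s. s \<in> S \<Longrightarrow> norm (Rc P K s - sR equilibrium) \<le> C * norm (force s - force0)"
    using commanded_lipschitz by blast
  obtain B where B: "0 < B" "\<And>s. s \<in> S \<Longrightarrow> norm (force s) \<le> B" using lip_bounded[OF lip_force bounded_S] by blast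
  obtain \<tau> where \<tau>: "0 < \<tau>" "\<And>x :: real^3^3. norm (transpose x) \<le> norm x * \<tau>"
    using bounded_linear.pos_bounded[OF bounded_linear_transpose] by blast
  define B' where "B' = norm (sR equilibrium) + C * (B + norm force0)"
  have B'0: "0 < B'" unfolding B'_def using B C by (intro add_nonneg_pos mult_pos_pos add_pos_nonneg) auto
  have b: "norm (Rc P K s) \<le> B'" if "s \<in> S" for s
  proof -
    have "norm (Rc P K s) \<le> norm (sR equilibrium) + norm (Rc P K s - sR equilibrium)" by (rule norm_triangle_sub)
    also have "norm (Rc P K s - sR equilibrium) \<le> C * (B + norm force0)"
      using C(1) B(2)[OF that] by (intro order_trans[OF C(2)[OF that]] mult_left_mono order_trans[OF norm_triangle_ineq4]) auto
    finally show ?thesis by (simp add: B'_def)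
  qed
  show thesis
  proof (rule that)
    show "0 < B' * (1 + \<tau>)" using B'0 \<tau> by simp
    fix s assume s: "s \<in> S"
    show "norm (Rc P K s) \<le> B' * (1 + \<tau>)"
      using b[OF s] mult_pos_pos[OF B'0 \<tau>(1)] by (simp add: distrib_left)
    have "norm (Rc P K s) * \<tau> \<le> B' * \<tau>" using b[OF s] \<tau>(1) by simp
    then show "norm (transpose (Rc P K s)) \<le> B' * (1 + \<tau>)" using \<tau>(2)[of "Rc P K s"] B'0 by (simp add: distrib_left)
  qed
qed

text \<open>The commanded attitude moves only as fast as the force, whose rate is linear in
  \<open>err_rate\<close>; that in turn is the linear field at \<open>err s\<close> up to the
  attitude error and a quadratic remainder.\<close>

lemma omc_bound:
  obtains C where "0 < C" "\<And>s. s \<in> S \<Longrightarrow> s \<in> states \<Longrightarrow> norm (omc s) \<le> C * (norm (err s) + norm (att s - mat 1) + (D s)\<^sup>2)"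
proof -
  obtain Cl where Cl: "0 < Cl" "\<And>y. norm (lin y) \<le> norm y * Cl" using bounded_linear.pos_bounded[OF bounded_linear_lin] by blast
  obtain Cr where Cr: "0 < Cr" "\<And>s. s \<in> S \<Longrightarrow> s \<in> states \<Longrightarrow>
    norm (err_rate s - lin (err s)) \<le> Cr * norm (att s - mat 1) + Cr * (D s)\<^sup>2" using err_rate_bound by blast
  obtain Cf where Cf: "0 < Cf" "\<And>z y :: real^(3 + 'n \<times> 2). norm (- (Kx K *v z) - Kv K *v y) \<le> Cf * norm (z, y)"
    using force_linear_bound by blast
  obtain Cd where Cd: "0 < Cd" "\<And>A A'. c \<le> norm (cross3 (heading K) A) \<Longrightarrow> c \<le> norm A \<Longrightarrow>
    norm (commanded_deriv (heading K) A A') \<le> Cd * norm A'"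
    by (rule norm_commanded_deriv_le[OF c_pos]) (rule that)
  obtain B where B: "0 < B" "\<And>s. s \<in> S \<Longrightarrow> norm (transpose (Rc P K s)) \<le> B" by (rule Rc_bounded) (rule that)
  obtain m where m: "0 < m" "\<And>(X::real^3^3) (Y::real^3^3). norm (X ** Y) \<le> norm X * norm Y * m"
    using bounded_bilinear.pos_bounded[OF bounded_bilinear_matrix_mult] by blast
  obtain v where v: "0 < v" "\<And>x. norm (vee x) \<le> norm x * v" using bounded_linear.pos_bounded[OF bounded_linear_vee] by blast
  show thesis
  proof (rule that)
    show "0 < B * (Cd * (Cf * (Cl + Cr))) * m * v" using B Cd Cf Cl Cr m v by simp
    fix s assume s: "s \<in> S" "s \<in> states"
    define E where "E = norm (err s) + norm (att s - mat 1) + (D s)\<^sup>2"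
    have "norm (err_rate s) \<le> norm (lin (err s)) + norm (err_rate s - lin (err s))" by (rule norm_triangle_sub)
    also have "\<dots> \<le> norm (err s) * Cl + (Cr * norm (att s - mat 1) + Cr * (D s)\<^sup>2)"
      by (rule add_mono[OF Cl(2) Cr(2)[OF s]])
    also have "\<dots> \<le> (Cl + Cr) * E"
    proof -
      have "0 \<le> Cl * norm (att s - mat 1)" "0 \<le> Cl * (D s)\<^sup>2" "0 \<le> Cr * norm (err s)" using Cl Cr by auto
      then show ?thesis unfolding E_def by (simp add: algebra_simps)
    qed
    finally have 1: "norm (err_rate s) \<le> (Cl + Cr) * E" .
    have "norm (force_rate s) \<le> Cf * norm (err_rate s)" unfolding force_rate_def err_rate_def by (rule Cf(2))
    also have "\<dots> \<le> Cf * ((Cl + Cr) * E)" using 1 Cf(1) by simp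
    finally have 2: "norm (force_rate s) \<le> Cf * (Cl + Cr) * E" by simp
    have "norm (commanded_deriv (heading K) (force s) (force_rate s)) \<le> Cd * norm (force_rate s)"
      using heading_force[of s] force_lower[of s] s(1) by (intro Cd) (auto simp: S_def)
    also have "\<dots> \<le> Cd * (Cf * (Cl + Cr) * E)" using 2 Cd(1) by simp
    finally have 3: "norm (commanded_deriv (heading K) (force s) (force_rate s)) \<le> Cd * (Cf * (Cl + Cr)) * E" by simp
    have "norm (transpose (Rc P K s) ** commanded_deriv (heading K) (force s) (force_rate s))
        \<le> norm (transpose (Rc P K s)) * norm (commanded_deriv (heading K) (force s) (force_rate s)) * m" by (rule m)
    also have "\<dots> \<le> B * (Cd * (Cf * (Cl + Cr)) * E) * m"
      using 3 B(2)[OF s(1)] B(1) m(1) by (intro mult_right_mono mult_mono) auto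
    finally have "norm (transpose (Rc P K s) ** commanded_deriv (heading K) (force s) (force_rate s)) * v
        \<le> B * (Cd * (Cf * (Cl + Cr)) * E) * m * v" using v(1) by simp
    then show "norm (omc s) \<le> B * (Cd * (Cf * (Cl + Cr))) * m * v * (norm (err s) + norm (att s - mat 1) + (D s)\<^sup>2)"
      unfolding omc_def E_def[symmetric]
      using v(2)[of "transpose (Rc P K s) ** commanded_deriv (heading K) (force s) (force_rate s)"]
      by (simp add: mult_ac)
  qed
qed

text \<open>Near the equilibrium and on the constraint set, the Lyapunov variables are equivalent to
  the distance \<open>D\<close>. The upper bound on \<open>D\<close> is delicate: \<open>sOm\<close>
  is recovered from \<open>eta\<close> by adding the commanded angular velocity, whose bound again
  contains the square of \<open>D\<close>.\<close>

lemma coordinates: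
  obtains r' C where "0 < r'" "r' \<le> r" "0 < C"
    "\<And>s. s \<in> states \<Longrightarrow> D s \<le> r' \<Longrightarrow> norm (err s) + norm (eta s) \<le> C * D s"
    "\<And>s. s \<in> states \<Longrightarrow> D s \<le> r' \<Longrightarrow> D s \<le> C * (norm (err s) + norm (eta s))"
    "\<And>s. s \<in> states \<Longrightarrow> D s \<le> r' \<Longrightarrow> norm (att s - mat 1) \<le> C * norm (eta s)"
    "\<And>s. s \<in> states \<Longrightarrow> D s \<le> r' \<Longrightarrow> norm (att s - mat 1) \<le> C * D s"
    "\<And>Q e. norm ((1/2) *\<^sub>R vee (Q ** hat e + hat e ** transpose Q) - e) \<le> C * norm (Q - mat 1) * norm e"
proof -
  obtain C1 where C1: "0 < C1" "\<And>s. norm (err s) \<le> C1 * D s" using err_bound by blast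
  obtain B where B: "0 < B" "\<And>s. s \<in> S \<Longrightarrow> norm (Rc P K s) \<le> B" "\<And>s. s \<in> S \<Longrightarrow> norm (transpose (Rc P K s)) \<le> B"
    by (rule Rc_bounded) (rule that)
  obtain m where m: "0 < m" "\<And>(X::real^3^3) (Y::real^3^3). norm (X ** Y) \<le> norm X * norm Y * m"
    using bounded_bilinear.pos_bounded[OF bounded_bilinear_matrix_mult] by blast
  obtain Cc where Cc: "0 < Cc" "\<And>s. s \<in> S \<Longrightarrow> norm (Rc P K s - sR equilibrium) \<le> Cc * norm (force s - force0)"
    using commanded_lipschitz by blast
  obtain Cf where Cf: "0 < Cf" "\<And>z y :: real^(3 + 'n \<times> 2). norm (- (Kx K *v z) - Kv K *v y) \<le> Cf * norm (z, y)"
    using force_linear_bound by blast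
  obtain rr C3 where C3: "0 < rr" "0 < C3"
    "\<And>Rd R. rotation_matrix Rd \<Longrightarrow> rotation_matrix R \<Longrightarrow> norm (transpose Rd ** R - mat 1) \<le> rr \<Longrightarrow>
      norm (transpose Rd ** R - mat 1) \<le> C3 * norm (e_R Rd R)"
    "\<And>Rd R. norm (e_R Rd R) \<le> C3 * norm (transpose Rd ** R - mat 1)"
    "\<And>Q e. norm ((1/2) *\<^sub>R vee (Q ** hat e + hat e ** transpose Q) - e) \<le> C3 * norm (Q - mat 1) * norm e"
    by (rule rotation_error_bound) (rule that)
  obtain C4 where C4: "0 < C4" "\<And>s. s \<in> S \<Longrightarrow> s \<in> states \<Longrightarrow> norm (omc s) \<le> C4 * (norm (err s) + norm (att s - mat 1) + (D s)\<^sup>2)"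
    using omc_bound by blast
  define C2 where "C2 = B * (1 + Cc * Cf * C1) * m"
  have C2: "0 < C2" using B Cc Cf C1 m by (simp add: C2_def add_pos_pos)
  have fe: "norm (force s - force0) \<le> Cf * norm (err s)" for s
    unfolding force_err err_def by (rule Cf(2))
  have Re: "norm (Rc P K s - sR equilibrium) \<le> Cc * Cf * norm (err s)" if "s \<in> S" for s
    using order_trans[OF Cc(2)[OF that] mult_left_mono[OF fe[of s]]] Cc(1) by simp
  have att1: "norm (att s - mat 1) \<le> C2 * D s" if s: "s \<in> S" for s
  proof -
    have "att s - mat 1 = transpose (Rc P K s) ** (sR s - Rc P K s)"
      using rotation_matrix_inverse(1)[OF rotation_commanded[OF s]]
      by (simp add: att_def bounded_bilinear.diff_right[OF bounded_bilinear_matrix_mult])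
    then have "norm (att s - mat 1) \<le> norm (transpose (Rc P K s)) * norm (sR s - Rc P K s) * m" using m(2) by simp
    also have "\<dots> \<le> B * (D s + Cc * Cf * (C1 * D s)) * m"
    proof (intro mult_right_mono mult_mono B s)
      have "norm (sR s - Rc P K s) \<le> norm (sR s - sR equilibrium) + norm (Rc P K s - sR equilibrium)"
        using norm_triangle_ineq4[of "sR s - sR equilibrium" "Rc P K s - sR equilibrium"] by simp
      also have "\<dots> \<le> D s + Cc * Cf * (C1 * D s)"
      proof -
        have "Cc * Cf * norm (err s) \<le> Cc * Cf * (C1 * D s)"
          using C1(2)[of s] Cc(1) Cf(1) by (intro mult_left_mono) auto
        then show ?thesis using component_bounds(5)[of s] Re[OF s] by linarith
      qed
      finally show "norm (sR s - Rc P K s) \<le> D s + Cc * Cf * (C1 * D s)" .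
    qed (use B m in auto)
    finally show ?thesis by (simp add: C2_def algebra_simps)
  qed
  \<comment> \<open>The bound \<open>rr / C2\<close> keeps the attitude error in the range where
    \<open>e_R\<close> controls it; \<open>1 / (2 * C4)\<close> makes the quadratic term of
    \<open>omc_bound\<close> at most half of \<open>D\<close>.\<close>
  define r' where "r' = min r (min (rr / C2) (1 / (2 * C4)))"
  have r': "0 < r'" "r' \<le> r" "C2 * r' \<le> rr" "C4 * r' \<le> 1 / 2"
  proof -
    show "0 < r'" "r' \<le> r" using r_pos C2 C3 C4 by (auto simp: r'_def)
    have "r' \<le> rr / C2" "r' \<le> 1 / (2 * C4)" by (auto simp: r'_def)
    then show "C2 * r' \<le> rr" "C4 * r' \<le> 1 / 2" using C2 C4(1) by (simp_all add: field_simps)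
  qed
  define N where "N = real CARD('n)"
  define C6 where "C6 = 2 + 5 * N + B * m + Cc * Cf + 1 + C4"
  have C6: "0 < C6" using B m Cc Cf C4 by (simp add: C6_def N_def add_pos_pos)
  define C where "C = max (C1 + C3 * C2 + 1 + C4 * (C1 + C2 + 1)) (max (2 * C6 * (C3 + 1)) (max C3 C2))"
  have C: "0 < C" "C1 + C3 * C2 + 1 + C4 * (C1 + C2 + 1) \<le> C" "2 * C6 * (C3 + 1) \<le> C" "C3 \<le> C" "C2 \<le> C"
    using C3(2) by (auto simp: C_def less_max_iff_disj)
  have eta_norms: "norm (fst (eta s)) \<le> norm (eta s)" "norm (snd (eta s)) \<le> norm (eta s)"
      "norm (eta s) \<le> norm (fst (eta s)) + norm (snd (eta s))" for s
    using norm_fst_le[of "fst (eta s)" "snd (eta s)"] norm_snd_le[of "snd (eta s)" "fst (eta s)"]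
      norm_Pair_le[of "fst (eta s)" "snd (eta s)"] by simp_all
  have main: "norm (err s) + norm (eta s) \<le> C * D s \<and> D s \<le> C * (norm (err s) + norm (eta s))
      \<and> norm (att s - mat 1) \<le> C * norm (eta s) \<and> norm (att s - mat 1) \<le> C * D s"
    if s: "s \<in> states" "D s \<le> r'" for s
  proof -
    define d where "d = D s"
    define E where "E = norm (err s)"
    define X where "X = norm (att s - mat 1)"
    have nn: "0 \<le> d" "0 \<le> E" "0 \<le> X" by (auto simp: d_def E_def X_def)
    have sS: "s \<in> S" using s(2) r'(2) by (simp add: S_def)
    have d1: "d \<le> 1" using s(2) r'(2) r_le by (simp add: d_def)
    then have dd: "d\<^sup>2 \<le> d" using nn(1) by (simp add: power2_eq_square mult_left_le)
    have rotR: "rotation_matrix (sR s)" using s(1) by (auto simp: states_def)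
    have rotC: "rotation_matrix (Rc P K s)" by (rule rotation_commanded[OF sS])
    have E: "E \<le> C1 * d" using C1(2) by (simp add: E_def d_def)
    have X: "X \<le> C2 * d" using att1[OF sS] by (simp add: X_def d_def)
    have "C2 * d \<le> C2 * r'" using s(2) C2 unfolding d_def by (intro mult_left_mono) auto
    then have "X \<le> rr" using X r'(3) by linarith
    then have X3: "X \<le> C3 * norm (fst (eta s))"
      using C3(3)[OF rotC rotR] by (simp add: X_def att_def eta_def)
    have om: "norm (omc s) \<le> C4 * (E + X + d\<^sup>2)" using C4(2)[OF sS s(1)] by (simp add: E_def X_def d_def)
    have eta2: "snd (eta s) = sOm s - (transpose (sR s) ** Rc P K s) *v omc s" by (simp add: eta_def e_Om_def)
    have rot: "norm ((transpose (sR s) ** Rc P K s) *v omc s) = norm (omc s)"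
      by (intro norm_rotation_mult rotation_matrix_mult rotation_matrix_transpose rotR rotC)
    have f: "norm (fst (eta s)) \<le> C3 * X" using C3(4) by (simp add: eta_def X_def att_def)
    have "norm (snd (eta s)) \<le> d + norm (omc s)"
      unfolding eta2 using norm_triangle_ineq4[of "sOm s" "(transpose (sR s) ** Rc P K s) *v omc s"] rot component_bounds(6)[of s]
      by (simp add: d_def)
    also have "norm (omc s) \<le> C4 * (C1 * d + C2 * d + d)"
      by (rule order_trans[OF om]) (use E X dd C4(1) in \<open>auto intro!: mult_left_mono add_mono\<close>)
    finally have sn: "norm (snd (eta s)) \<le> d + C4 * (C1 * d + C2 * d + d)" by simp
    have "E + norm (eta s) \<le> C1 * d + C3 * (C2 * d) + (d + C4 * (C1 * d + C2 * d + d))"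
      using E f sn eta_norms(3)[of s] mult_left_mono[OF X, of C3] C3(2) by linarith
    also have "\<dots> = (C1 + C3 * C2 + 1 + C4 * (C1 + C2 + 1)) * d" by (simp add: algebra_simps)
    also have "\<dots> \<le> C * d" using C nn by (intro mult_right_mono) auto
    finally have R1: "E + norm (eta s) \<le> C * d" .
    have x1: "norm (sx s - target K) \<le> E" and v1: "norm (sv s) \<le> E"
      and q1: "norm (transpose C32 *v cross3 e3 (sq s $ i)) \<le> E" and w1: "norm (transpose C32 *v (sw s $ i)) \<le> E" for i
    proof -
      have pe: "norm (pos_err s) \<le> E" "norm (vel_err s) \<le> E"
        unfolding E_def err_def by (simp_all add: norm_Pair)
      show "norm (sx s - target K) \<le> E" "norm (transpose C32 *v cross3 e3 (sq s $ i)) \<le> E"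
        by (rule order_trans[OF norm_le_block_vector(1) pe(1)[unfolded pos_err_def]],
            rule order_trans[OF norm_le_block_vector(2) pe(1)[unfolded pos_err_def]])
      show "norm (sv s) \<le> E" "norm (transpose C32 *v (sw s $ i)) \<le> E"
        by (rule order_trans[OF norm_le_block_vector(1) pe(2)[unfolded vel_err_def]],
            rule order_trans[OF norm_le_block_vector(2) pe(2)[unfolded vel_err_def]])
    qed
    have link: "norm (sq s $ i) = 1" "sq s $ i \<bullet> sw s $ i = 0" "norm (sq s $ i - e3) \<le> 1" for i
      using s(1) component_bounds(3)[of s i] d1 by (auto simp: states_def d_def)
    have "norm (sq s - sq equilibrium) \<le> (\<Sum>i\<in>(UNIV::'n set). 2 * E)"
    proof (rule order_trans[OF norm_vec_le_sum sum_mono])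
      fix i show "norm ((sq s - sq equilibrium) $ i) \<le> 2 * E"
        using norm_link_le(1)[OF link(1,3), of i] q1[of i] by (simp add: equilibrium_components)
    qed
    then have q2: "norm (sq s - sq equilibrium) \<le> 2 * N * E" by (simp add: N_def)
    have "norm (sw s) \<le> (\<Sum>i\<in>(UNIV::'n set). 3 * E)"
    proof (rule order_trans[OF norm_vec_le_sum sum_mono])
      fix i show "norm (sw s $ i) \<le> 3 * E" using norm_link_le(2)[OF link(1,3,2), of i] w1[of i] by simp
    qed
    then have w2: "norm (sw s) \<le> 3 * N * E" by (simp add: N_def)
    have R2: "norm (sR s - sR equilibrium) \<le> B * m * X + Cc * Cf * E"
    proof -
      have "Rc P K s ** att s = sR s"
        using rotation_matrix_inverse(2)[OF rotC] by (simp add: att_def matrix_mul_assoc)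
      then have "sR s - sR equilibrium = Rc P K s ** (att s - mat 1) + (Rc P K s - sR equilibrium)"
        by (simp add: bounded_bilinear.diff_right[OF bounded_bilinear_matrix_mult])
      also have "norm \<dots> \<le> norm (Rc P K s ** (att s - mat 1)) + norm (Rc P K s - sR equilibrium)" by (rule norm_triangle_ineq)
      also have "norm (Rc P K s ** (att s - mat 1)) \<le> norm (Rc P K s) * X * m" unfolding X_def by (rule m)
      also have "\<dots> \<le> B * X * m" using B(2)[OF sS] nn m by (intro mult_right_mono) auto
      finally show ?thesis using Re[OF sS] by (simp add: E_def mult_ac)
    qed
    have Om2: "norm (sOm s) \<le> norm (snd (eta s)) + C4 * (E + X + d\<^sup>2)"
    proof -
      have "sOm s = snd (eta s) + (transpose (sR s) ** Rc P K s) *v omc s" by (simp add: eta2)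
      then have "norm (sOm s) \<le> norm (snd (eta s)) + norm ((transpose (sR s) ** Rc P K s) *v omc s)"
        by (metis norm_triangle_ineq)
      with om rot show ?thesis by linarith
    qed
    \<comment> \<open>Moved to the left side below, this leaves \<open>d / 2\<close> there, which
      resolves the recursion in the estimate of \<open>d\<close>.\<close>
    have "C4 * d\<^sup>2 \<le> d / 2"
    proof -
      have "C4 * d \<le> C4 * r'" using s(2) C4(1) unfolding d_def by (intro mult_left_mono) auto
      then have "C4 * d \<le> 1 / 2" using r'(4) by linarith
      from mult_right_mono[OF this nn(1)] show ?thesis by (simp add: power2_eq_square mult_ac)
    qed
    moreover have "d \<le> E + E + 2 * N * E + 3 * N * E + (B * m * X + Cc * Cf * E) + (norm (snd (eta s)) + C4 * (E + X + d\<^sup>2))"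
    proof -
      have "D s \<le> norm (sx s - target K) + norm (sv s) + norm (sq s - sq equilibrium) + norm (sw s)
          + norm (sR s - sR equilibrium) + norm (sOm s)"
        using norm_state_components(7)[of "s - equilibrium"] by (simp add: equilibrium_components)
      then show ?thesis using x1 v1 q2 w2 R2 Om2 unfolding d_def by linarith
    qed
    ultimately have "d / 2 \<le> E + E + 2 * N * E + 3 * N * E + (B * m * X + Cc * Cf * E) + (norm (snd (eta s)) + C4 * (E + X))"
      by (simp add: distrib_left)
    also have "\<dots> \<le> C6 * (E + X + norm (snd (eta s)))"
    proof -
      have "0 \<le> B * m * E" "0 \<le> Cc * Cf * X" "0 \<le> N * X" "0 \<le> B * m * norm (snd (eta s))"
        "0 \<le> Cc * Cf * norm (snd (eta s))" "0 \<le> N * norm (snd (eta s))" "0 \<le> C4 * norm (snd (eta s))"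
        using B m Cc Cf C4 nn by (auto simp: N_def)
      then show ?thesis using nn norm_ge_zero[of "snd (eta s)"] unfolding C6_def by (simp add: algebra_simps)
    qed
    also have "\<dots> \<le> C6 * ((C3 + 1) * (E + norm (eta s)))"
    proof (rule mult_left_mono)
      have "X + norm (snd (eta s)) \<le> (C3 + 1) * norm (eta s)"
      proof -
        have "C3 * norm (fst (eta s)) \<le> C3 * norm (eta s)" using eta_norms(1) C3(2) by simp
        then show ?thesis using X3 eta_norms(2)[of s] unfolding distrib_right by linarith
      qed
      then show "E + X + norm (snd (eta s)) \<le> (C3 + 1) * (E + norm (eta s))"
        using mult_nonneg_nonneg[OF less_imp_le[OF C3(2)] nn(2)] by (simp add: algebra_simps)
    qed (use C6 in simp)
    finally have "d \<le> 2 * C6 * (C3 + 1) * (E + norm (eta s))" by simp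
    also have "\<dots> \<le> C * (E + norm (eta s))" using C nn by (intro mult_right_mono) auto
    finally have R3: "d \<le> C * (E + norm (eta s))" .
    have "X \<le> C3 * norm (eta s)" using X3 mult_left_mono[OF eta_norms(1)[of s], of C3] C3(2) by linarith
    also have "\<dots> \<le> C * norm (eta s)" using C by (intro mult_right_mono) auto
    finally have R4: "X \<le> C * norm (eta s)" .
    have "C2 * d \<le> C * d" using C nn by (intro mult_right_mono) auto
    then have "X \<le> C * d" using X by linarith
    with R1 R3 R4 show ?thesis unfolding X_def d_def E_def by blast
  qed
  have "norm ((1/2) *\<^sub>R vee (Q ** hat e + hat e ** transpose Q) - e) \<le> C * norm (Q - mat 1) * norm e" for Q e
    by (rule order_trans[OF C3(5)]) (use C(4) in \<open>auto intro!: mult_right_mono\<close>)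
  note err5 = this
  show thesis
  proof (rule that[OF r'(1,2) C(1)])
    fix s assume "s \<in> states" "D s \<le> r'"
    note m = main[OF this]
    show "norm (err s) + norm (eta s) \<le> C * D s" using m by blast
    show "D s \<le> C * (norm (err s) + norm (eta s))" using m by blast
    show "norm (att s - mat 1) \<le> C * norm (eta s)" using m by blast
    show "norm (att s - mat 1) \<le> C * D s" using m by blast
  qed (rule err5)
qed

lemma equations_of_motion:
  "(M00 P *\<^sub>R a + (\<Sum>i\<in>UNIV. M0 P i *\<^sub>R p $ i) = - (thrust P K s *\<^sub>R (sR s *v e3)) + (M00 P * gravity P) *\<^sub>R e3 \<and>
   (\<forall>i. Mij P i i *\<^sub>R p $ i - (hat (sq s $ i) ** hat (sq s $ i)) *v
               (M0 P i *\<^sub>R a + (\<Sum>j\<in>UNIV - {i}. Mij P i j *\<^sub>R p $ j))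
         = - ((Mij P i i * (norm (cross3 (sw s $ i) (sq s $ i)))\<^sup>2) *\<^sub>R sq s $ i)
           - Gi P i *\<^sub>R ((hat (sq s $ i) ** hat (sq s $ i)) *v e3)))
   \<longleftrightarrow> inertia_op (sq s) (a, p) = load s"
proof -
  have "thrust P K s = - (force s \<bullet> (sR s *v e3))"
    by (cases s) (simp add: thrust_def virtual_force_eq)
  then show ?thesis
    by (simp add: inertia_op_def load_def coupling_def matrix_vector_mul_assoc[symmetric] hat_mult vec_eq_iff[of "\<chi> i. _ i"]
        power2_norm_eq_inner)
qed

end

section \<open>Decay along trajectories\<close>

lemma left_limit_le:
  fixes g :: "real \<Rightarrow> real"
  assumes "0 < b" "continuous_on {0..b} g" "\<And>t. t \<in> {0..<b} \<Longrightarrow> g t \<le> k"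
  shows "g b \<le> k"
proof (rule tendsto_upperbound)
  show "(g \<longlongrightarrow> g b) (at_left b)" by (rule continuous_on_Icc_at_leftD[OF assms(2,1)])
  show "\<forall>\<^sub>F t in at_left b. g t \<le> k"
    using eventually_at_left_real[OF assms(1)] by eventually_elim (use assms(3) in auto)
qed simp

text \<open>Up to the first time at which the level \<open>r\<close> is reached, \<open>step\<close>
  gives the stronger bound \<open>k\<close>. By continuity it persists at that time, which
  contradicts \<open>k < r\<close>.\<close>

lemma trapped:
  fixes g :: "real \<Rightarrow> real"
  assumes cont: "continuous_on {0..t1} g" and "g 0 < r" "0 \<le> t1" "k < r"
    and step: "\<And>b. 0 < b \<Longrightarrow> b \<le> t1 \<Longrightarrow> (\<And>t. t \<in> {0..<b} \<Longrightarrow> g t < r) \<Longrightarrow> (\<And>t. t \<in> {0..<b} \<Longrightarrow> g t \<le> k)"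
  shows "g t1 < r"
proof (rule ccontr)
  assume "\<not> g t1 < r"
  then have "r \<le> g t1" by simp
  from first_exit[OF cont \<open>g 0 < r\<close> this \<open>0 \<le> t1\<close>]
  obtain b where b: "0 < b" "b \<le> t1" "r \<le> g b" "\<And>t. t \<in> {0..<b} \<Longrightarrow> g t < r" by metis
  have "g b \<le> k"
  proof (rule left_limit_le[OF b(1)])
    show "continuous_on {0..b} g" using continuous_on_subset[OF cont] b by simp
  qed (rule step[OF b(1,2,4)])
  with b(3) \<open>k < r\<close> show False by simp
qed

text \<open>\<open>full_dynamics\<close> does not assert a derivative of \<open>w\<close>. The
  constraints express \<open>w\<close> as the cross product of \<open>q\<close> and
  \<open>q'\<close>, and this determines the derivative.\<close>

lemma full_dynamicsE:
  fixes \<phi> :: "real \<Rightarrow> 'n::{finite,linorder} state"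
  assumes "full_dynamics P f M T \<phi>"
  obtains a p Om' where "\<And>t. t \<in> T \<Longrightarrow> \<phi> t \<in> states"
    "\<And>t. t \<in> T \<Longrightarrow> ((\<lambda>t. sx (\<phi> t)) has_vector_derivative sv (\<phi> t)) (at t within T)"
    "\<And>t. t \<in> T \<Longrightarrow> ((\<lambda>t. sv (\<phi> t)) has_vector_derivative a t) (at t within T)"
    "\<And>t i. t \<in> T \<Longrightarrow> ((\<lambda>t. sq (\<phi> t) $ i) has_vector_derivative cross3 (sw (\<phi> t) $ i) (sq (\<phi> t) $ i)) (at t within T)"
    "\<And>t i. t \<in> T \<Longrightarrow> ((\<lambda>t. sw (\<phi> t) $ i) has_vector_derivative cross3 (sq (\<phi> t) $ i) (p t $ i)) (at t within T)"
    "\<And>t. t \<in> T \<Longrightarrow> ((\<lambda>t. sR (\<phi> t)) has_vector_derivative sR (\<phi> t) ** hat (sOm (\<phi> t))) (at t within T)"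
    "\<And>t. t \<in> T \<Longrightarrow> ((\<lambda>t. sOm (\<phi> t)) has_vector_derivative Om' t) (at t within T)"
    "\<And>t. t \<in> T \<Longrightarrow> M00 P *\<^sub>R a t + (\<Sum>i\<in>UNIV. M0 P i *\<^sub>R p t $ i) = - (f t *\<^sub>R (sR (\<phi> t) *v e3)) + (M00 P * gravity P) *\<^sub>R e3"
    "\<And>t. t \<in> T \<Longrightarrow> (\<forall>i. Mij P i i *\<^sub>R p t $ i - (hat (sq (\<phi> t) $ i) ** hat (sq (\<phi> t) $ i)) *v
               (M0 P i *\<^sub>R a t + (\<Sum>j\<in>UNIV - {i}. Mij P i j *\<^sub>R p t $ j))
         = - ((Mij P i i * (norm (cross3 (sw (\<phi> t) $ i) (sq (\<phi> t) $ i)))\<^sup>2) *\<^sub>R sq (\<phi> t) $ i)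
           - Gi P i *\<^sub>R ((hat (sq (\<phi> t) $ i) ** hat (sq (\<phi> t) $ i)) *v e3))"
    "\<And>t. t \<in> T \<Longrightarrow> inertia P *v Om' t + hat (sOm (\<phi> t)) *v (inertia P *v sOm (\<phi> t)) = M t"
proof -
  obtain x x' x'' q q' q'' w R Om Om' where H: "\<forall>t\<in>T.
     \<phi> t = (x t, x' t, q t, w t, R t, Om t) \<and>
     \<phi> t \<in> states \<and>
     (x has_vector_derivative x' t) (at t within T) \<and>
     (x' has_vector_derivative x'' t) (at t within T) \<and>
     (q has_vector_derivative q' t) (at t within T) \<and>
     (q' has_vector_derivative q'' t) (at t within T) \<and>
     (R has_vector_derivative R t ** hat (Om t)) (at t within T) \<and>
     (Om has_vector_derivative Om' t) (at t within T) \<and>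
     (\<forall>i. q' t $ i = cross3 (w t $ i) (q t $ i)) \<and>
     M00 P *\<^sub>R x'' t + (\<Sum>i\<in>UNIV. M0 P i *\<^sub>R q'' t $ i)
       = - (f t *\<^sub>R (R t *v e3)) + (M00 P * gravity P) *\<^sub>R e3 \<and>
     (\<forall>i. Mij P i i *\<^sub>R q'' t $ i
           - (hat (q t $ i) ** hat (q t $ i)) *v
               (M0 P i *\<^sub>R x'' t + (\<Sum>j\<in>UNIV - {i}. Mij P i j *\<^sub>R q'' t $ j))
         = - ((Mij P i i * (norm (q' t $ i))\<^sup>2) *\<^sub>R q t $ i)
           - Gi P i *\<^sub>R ((hat (q t $ i) ** hat (q t $ i)) *v e3)) \<and>
     inertia P *v Om' t + hat (Om t) *v (inertia P *v Om t) = M t"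
    using assms unfolding full_dynamics_def by (elim exE) (rule that)
  have \<phi>: "\<phi> t = (x t, x' t, q t, w t, R t, Om t)" if "t \<in> T" for t using H that by blast
  have tr: "((\<lambda>t. g (\<phi> t)) has_vector_derivative d) (at t within T)"
    if "t \<in> T" "(h has_vector_derivative d) (at t within T)" "\<And>t. t \<in> T \<Longrightarrow> g (\<phi> t) = h t"
    for g :: "_ \<Rightarrow> 'b::real_normed_vector" and h d t
    by (rule has_vector_derivative_transform[OF that(1) _ that(2)]) (rule that(3))
  show thesis
  proof (rule that)
    fix t assume t: "t \<in> T"
    note Ht = H[rule_format, OF t]
    note \<phi>t = \<phi>[OF t]
    show st: "\<phi> t \<in> states" using Ht by blast
    show "((\<lambda>t. sx (\<phi> t)) has_vector_derivative sv (\<phi> t)) (at t within T)"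
      by (rule tr[OF t, of x]) (use Ht \<phi> in \<open>simp_all add: \<phi>t\<close>)
    show "((\<lambda>t. sv (\<phi> t)) has_vector_derivative x'' t) (at t within T)"
      by (rule tr[OF t, of x']) (use Ht \<phi> in simp_all)
    have q': "q' t = (\<chi> i. cross3 (w t $ i) (q t $ i))" if "t \<in> T" for t
      using H that by (auto simp: vec_eq_iff)
    have dq: "((\<lambda>t. q t $ i) has_vector_derivative q' t $ i) (at t within T)"
      and dq': "((\<lambda>t. q' t $ i) has_vector_derivative q'' t $ i) (at t within T)" for i
      using Ht bounded_linear.has_vector_derivative[OF bounded_linear_vec_nth] by blast+
    show "((\<lambda>t. sq (\<phi> t) $ i) has_vector_derivative cross3 (sw (\<phi> t) $ i) (sq (\<phi> t) $ i)) (at t within T)" for i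
      by (rule tr[OF t, of "\<lambda>t. q t $ i"]) (use dq[of i] \<phi> q'[OF t] in \<open>simp_all add: \<phi>t\<close>)
    show "((\<lambda>t. sw (\<phi> t) $ i) has_vector_derivative cross3 (sq (\<phi> t) $ i) (q'' t $ i)) (at t within T)" for i
    proof (rule tr[OF t, of "\<lambda>t. cross3 (q t $ i) (q' t $ i)"])
      show "((\<lambda>t. cross3 (q t $ i) (q' t $ i)) has_vector_derivative cross3 (sq (\<phi> t) $ i) (q'' t $ i)) (at t within T)"
        using bounded_bilinear.has_vector_derivative[OF bounded_bilinear_cross3 dq[of i] dq'[of i]] by (simp add: \<phi>t)
      fix t assume t: "t \<in> T"
      have "\<phi> t \<in> states" using H t by blast
      then have "norm (q t $ i) = 1" "q t $ i \<bullet> w t $ i = 0" using \<phi>[OF t] by (auto simp: states_def)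
      then show "sw (\<phi> t) $ i = cross3 (q t $ i) (q' t $ i)"
        using \<phi>[OF t] q'[OF t] by (simp add: Lagrange norm_eq_1)
    qed
    show "((\<lambda>t. sR (\<phi> t)) has_vector_derivative sR (\<phi> t) ** hat (sOm (\<phi> t))) (at t within T)"
      by (rule tr[OF t, of R]) (use Ht \<phi> in \<open>simp_all add: \<phi>t\<close>)
    show "((\<lambda>t. sOm (\<phi> t)) has_vector_derivative Om' t) (at t within T)"
      by (rule tr[OF t, of Om]) (use Ht \<phi> in simp_all)
    show "M00 P *\<^sub>R x'' t + (\<Sum>i\<in>UNIV. M0 P i *\<^sub>R q'' t $ i) = - (f t *\<^sub>R (sR (\<phi> t) *v e3)) + (M00 P * gravity P) *\<^sub>R e3"
      using Ht by (simp add: \<phi>t)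
    show "\<forall>i. Mij P i i *\<^sub>R q'' t $ i - (hat (sq (\<phi> t) $ i) ** hat (sq (\<phi> t) $ i)) *v
               (M0 P i *\<^sub>R x'' t + (\<Sum>j\<in>UNIV - {i}. Mij P i j *\<^sub>R q'' t $ j))
         = - ((Mij P i i * (norm (cross3 (sw (\<phi> t) $ i) (sq (\<phi> t) $ i)))\<^sup>2) *\<^sub>R sq (\<phi> t) $ i)
           - Gi P i *\<^sub>R ((hat (sq (\<phi> t) $ i) ** hat (sq (\<phi> t) $ i)) *v e3)"
      unfolding \<phi>t fst_conv snd_conv using Ht by simp
    show "inertia P *v Om' t + hat (sOm (\<phi> t)) *v (inertia P *v sOm (\<phi> t)) = M t"
      using Ht by (simp add: \<phi>t)
  qed
qed

lemma has_vector_derivative_vec: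
  fixes f :: "real \<Rightarrow> 'a::real_normed_vector ^ 'n"
  assumes "\<And>i. ((\<lambda>t. f t $ i) has_vector_derivative f' $ i) (at t within T)"
  shows "(f has_vector_derivative f') (at t within T)"
  unfolding has_vector_derivative_def has_derivative_within
proof
  show "bounded_linear (\<lambda>x. x *\<^sub>R f')" by (rule bounded_linear_scaleR_left)
  show "((\<lambda>y. (1 / norm (y - t)) *\<^sub>R (f y - (f t + (y - t) *\<^sub>R f'))) \<longlongrightarrow> 0) (at t within T)"
    by (rule vec_tendstoI) (use assms in \<open>simp add: has_vector_derivative_def has_derivative_within\<close>)
qed

text \<open>Continuation arguments apply the decay estimate to initial segments of a
  trajectory.\<close>

lemma closed_loop_subset:
  assumes "closed_loop P K \<epsilon> T \<phi>" "T' \<subseteq> T"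
  shows "closed_loop P K \<epsilon> T' \<phi>"
proof -
  have sub: "(f has_vector_derivative d) (at t within T')" if "(f has_vector_derivative d) (at t within T)"
    for f :: "real \<Rightarrow> 'b::real_normed_vector" and d t
    by (rule has_vector_derivative_within_subset[OF that assms(2)])
  have fd_subset: "full_dynamics P f M T' \<phi>" if fd: "full_dynamics P f M T \<phi>" for f M
  proof -
    obtain x x' x'' q q' q'' w R Om Om' where H: "\<forall>t\<in>T.
       \<phi> t = (x t, x' t, q t, w t, R t, Om t) \<and>
       \<phi> t \<in> states \<and>
       (x has_vector_derivative x' t) (at t within T) \<and>
       (x' has_vector_derivative x'' t) (at t within T) \<and>
       (q has_vector_derivative q' t) (at t within T) \<and>
       (q' has_vector_derivative q'' t) (at t within T) \<and>
       (R has_vector_derivative R t ** hat (Om t)) (at t within T) \<and>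
       (Om has_vector_derivative Om' t) (at t within T) \<and>
       (\<forall>i. q' t $ i = cross3 (w t $ i) (q t $ i)) \<and>
       M00 P *\<^sub>R x'' t + (\<Sum>i\<in>UNIV. M0 P i *\<^sub>R q'' t $ i)
         = - (f t *\<^sub>R (R t *v e3)) + (M00 P * gravity P) *\<^sub>R e3 \<and>
       (\<forall>i. Mij P i i *\<^sub>R q'' t $ i
             - (hat (q t $ i) ** hat (q t $ i)) *v
                 (M0 P i *\<^sub>R x'' t + (\<Sum>j\<in>UNIV - {i}. Mij P i j *\<^sub>R q'' t $ j))
           = - ((Mij P i i * (norm (q' t $ i))\<^sup>2) *\<^sub>R q t $ i)
             - Gi P i *\<^sub>R ((hat (q t $ i) ** hat (q t $ i)) *v e3)) \<and>
       inertia P *v Om' t + hat (Om t) *v (inertia P *v Om t) = M t"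
      using fd unfolding full_dynamics_def by (elim exE) (rule that)
    show ?thesis
      unfolding full_dynamics_def
    proof (rule exI[of _ x], rule exI[of _ x'], rule exI[of _ x''], rule exI[of _ q], rule exI[of _ q'],
        rule exI[of _ q''], rule exI[of _ w], rule exI[of _ R], rule exI[of _ Om], rule exI[of _ Om'], rule ballI, goal_cases)
      case (1 t)
      note Ht = H[rule_format, OF subsetD[OF assms(2) 1]]
      show ?case
        by (insert Ht, elim conjE, intro conjI) (assumption | rule sub, assumption)+
    qed
  qed
  obtain Rc' Omc Omc' where H: "\<forall>t\<in>T. virtual_force P K (\<phi> t) \<noteq> 0 \<and>
        \<not> collinear {0, heading K, b3c P K (\<phi> t)} \<and>
        ((\<lambda>s. Rc P K (\<phi> s)) has_vector_derivative Rc' t) (at t within T) \<and>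
        Omc t = vee (transpose (Rc P K (\<phi> t)) ** Rc' t) \<and>
        (Omc has_vector_derivative Omc' t) (at t within T)"
    and fd: "full_dynamics P (\<lambda>t. thrust P K (\<phi> t)) (\<lambda>t. moment P K \<epsilon> (Omc t) (Omc' t) (\<phi> t)) T \<phi>"
    using assms(1) unfolding closed_loop_def by (elim exE conjE) (rule that)
  show ?thesis
    unfolding closed_loop_def
  proof (rule exI[of _ Rc'], rule exI[of _ Omc], rule exI[of _ Omc'], rule conjI[OF ballI fd_subset[OF fd]])
    fix t assume "t \<in> T'"
    note Ht = H[rule_format, OF subsetD[OF assms(2) this]]
    show "virtual_force P K (\<phi> t) \<noteq> 0 \<and>
        \<not> collinear {0, heading K, b3c P K (\<phi> t)} \<and>
        ((\<lambda>s. Rc P K (\<phi> s)) has_vector_derivative Rc' t) (at t within T') \<and>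
        Omc t = vee (transpose (Rc P K (\<phi> t)) ** Rc' t) \<and>
        (Omc has_vector_derivative Omc' t) (at t within T')"
      by (insert Ht, elim conjE, intro conjI) (assumption | rule sub, assumption)+
  qed
qed

context quadrotor_ball
begin

section \<open>Lyapunov estimate along closed-loop trajectories\<close>

lemma continuous_on_trajectory:
  assumes "closed_loop P K \<epsilon> T \<phi>"
  shows "continuous_on T \<phi>" "\<And>t. t \<in> T \<Longrightarrow> \<phi> t \<in> states"
proof -
  obtain Omc Omc' where fd: "full_dynamics P (\<lambda>t. thrust P K (\<phi> t)) (\<lambda>t. moment P K \<epsilon> (Omc t) (Omc' t) (\<phi> t)) T \<phi>"
    using assms unfolding closed_loop_def by blast
  obtain a p Om' where d: "\<And>t. t \<in> T \<Longrightarrow> \<phi> t \<in> states"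
    "\<And>t. t \<in> T \<Longrightarrow> ((\<lambda>t. sx (\<phi> t)) has_vector_derivative sv (\<phi> t)) (at t within T)"
    "\<And>t. t \<in> T \<Longrightarrow> ((\<lambda>t. sv (\<phi> t)) has_vector_derivative a t) (at t within T)"
    "\<And>t i. t \<in> T \<Longrightarrow> ((\<lambda>t. sq (\<phi> t) $ i) has_vector_derivative cross3 (sw (\<phi> t) $ i) (sq (\<phi> t) $ i)) (at t within T)"
    "\<And>t i. t \<in> T \<Longrightarrow> ((\<lambda>t. sw (\<phi> t) $ i) has_vector_derivative cross3 (sq (\<phi> t) $ i) (p t $ i)) (at t within T)"
    "\<And>t. t \<in> T \<Longrightarrow> ((\<lambda>t. sR (\<phi> t)) has_vector_derivative sR (\<phi> t) ** hat (sOm (\<phi> t))) (at t within T)"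
    "\<And>t. t \<in> T \<Longrightarrow> ((\<lambda>t. sOm (\<phi> t)) has_vector_derivative Om' t) (at t within T)"
    by (rule full_dynamicsE[OF fd]) (rule that)
  have c: "continuous_on T f" if "\<And>t. t \<in> T \<Longrightarrow> (f has_vector_derivative f' t) (at t within T)"
    for f :: "real \<Rightarrow> 'b::real_normed_vector" and f'
    using that has_vector_derivative_continuous continuous_on_eq_continuous_within by blast
  have v: "continuous_on T (\<lambda>t. g t)" if "\<And>i. continuous_on T (\<lambda>t. g t $ i)" for g :: "real \<Rightarrow> (real^3, 'n) vec"
  proof -
    have "continuous_on T (\<lambda>t. \<chi> i. g t $ i)" by (intro continuous_on_vec_lambda that)
    then show ?thesis by simp
  qed
  have "continuous_on T (\<lambda>t. (sx (\<phi> t), sv (\<phi> t), sq (\<phi> t), sw (\<phi> t), sR (\<phi> t), sOm (\<phi> t)))"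
    by (intro continuous_on_Pair c[OF d(2)] c[OF d(3)] v[OF c[OF d(4)]] v[OF c[OF d(5)]] c[OF d(6)] c[OF d(7)])
  then show "continuous_on T \<phi>" by simp
  show "\<And>t. t \<in> T \<Longrightarrow> \<phi> t \<in> states" by (rule d(1))
qed

text \<open>Stated for an arbitrary curve with the right derivatives, because it also serves for the
  constructed curve with angular velocity component 0, which is not itself a trajectory.\<close>

lemma err_derivative:
  assumes d: "((\<lambda>t. sx (\<phi> t)) has_vector_derivative sv (\<phi> t)) (at t within T)"
      "((\<lambda>t. sv (\<phi> t)) has_vector_derivative a) (at t within T)"
      "\<And>i. ((\<lambda>t. sq (\<phi> t) $ i) has_vector_derivative cross3 (sw (\<phi> t) $ i) (sq (\<phi> t) $ i)) (at t within T)"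
      "\<And>i. ((\<lambda>t. sw (\<phi> t) $ i) has_vector_derivative cross3 (sq (\<phi> t) $ i) (p $ i)) (at t within T)"
    and acc: "acc (\<phi> t) = (a, p)"
  shows "((\<lambda>t. err (\<phi> t)) has_vector_derivative err_rate (\<phi> t)) (at t within T)"
    and "((\<lambda>t. force (\<phi> t)) has_vector_derivative force_rate (\<phi> t)) (at t within T)"
proof -
  have bv: "((\<lambda>t. block_vector (f t) (\<lambda>i. g t i)) has_vector_derivative block_vector f' g') (at t within T)"
    if "(f has_vector_derivative f') (at t within T)" "\<And>i. ((\<lambda>t. g t i) has_vector_derivative g' i) (at t within T)"
    for f f' and g :: "real \<Rightarrow> 'n \<Rightarrow> real^2" and g'
  proof -
    have "((\<lambda>t. \<chi> i. g t i) has_vector_derivative (\<chi> i. g' i)) (at t within T)"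
      by (rule has_vector_derivative_vec) (simp add: that(2))
    from bounded_linear.has_vector_derivative[OF bounded_linear_block_vector has_vector_derivative_Pair[OF that(1) this]]
    show ?thesis by simp
  qed
  have C: "((\<lambda>t. A *v f t) has_vector_derivative A *v f') (at t within T)"
    if "(f has_vector_derivative f') (at t within T)" for A :: "real^'k^'l" and f f'
    by (rule bounded_linear.has_vector_derivative[OF bounded_bilinear.bounded_linear_right[OF bounded_bilinear_matrix_vector] that])
  have X: "((\<lambda>t. cross3 b (f t)) has_vector_derivative cross3 b f') (at t within T)"
    if "(f has_vector_derivative f') (at t within T)" for b f f'
    by (rule bounded_linear.has_vector_derivative[OF bounded_bilinear.bounded_linear_right[OF bounded_bilinear_cross3] that])
  have "((\<lambda>t. sx (\<phi> t) - target K) has_vector_derivative sv (\<phi> t)) (at t within T)"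
    using has_vector_derivative_diff[OF d(1) has_vector_derivative_const[of "target K"]] by simp
  then have p: "((\<lambda>t. pos_err (\<phi> t)) has_vector_derivative pos_rate (\<phi> t)) (at t within T)"
    unfolding pos_err_def pos_rate_def by (rule bv) (intro C X d(3))
  have v: "((\<lambda>t. vel_err (\<phi> t)) has_vector_derivative vel_rate (\<phi> t)) (at t within T)"
    unfolding vel_err_def vel_rate_def acc fst_conv snd_conv by (rule bv[OF d(2)]) (intro C d(4))
  show "((\<lambda>t. err (\<phi> t)) has_vector_derivative err_rate (\<phi> t)) (at t within T)"
    unfolding err_def err_rate_def by (rule has_vector_derivative_Pair[OF p v])
  show "((\<lambda>t. force (\<phi> t)) has_vector_derivative force_rate (\<phi> t)) (at t within T)"
    unfolding force_def force_rate_def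
    using has_vector_derivative_diff[OF has_vector_derivative_diff[OF has_vector_derivative_minus[OF C[OF p]] C[OF v]]
      has_vector_derivative_const] by simp
qed

lemma inertia_inverse: obtains Ji where "\<And>v. inertia P *v (Ji *v v) = v" "\<And>v. Ji *v (inertia P *v v) = v"
proof -
  have "v = 0" if "inertia P *v v = 0" for v using inertia_pos[of v] that by force
  then have "\<exists>B. B ** inertia P = mat 1" by (simp add: matrix_left_invertible_ker)
  then obtain Ji where "Ji ** inertia P = mat 1" by blast
  moreover from this have "inertia P ** Ji = mat 1" by (simp add: matrix_left_right_inverse)
  ultimately show thesis by (intro that[of Ji]) (simp_all add: matrix_vector_mul_assoc)
qed

definition eta_rate :: "real \<Rightarrow> real \<Rightarrow> real^3^3 \<Rightarrow> 'n state \<Rightarrow> (real^3) \<times> (real^3)" where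
  "eta_rate a b Ji s = ((1/2) *\<^sub>R vee (att s ** hat (snd (eta s)) + hat (snd (eta s)) ** transpose (att s)),
     - (Ji *v (a *\<^sub>R fst (eta s) + b *\<^sub>R snd (eta s))))"

text \<open>The closed loop only asserts that some derivatives exist. Uniqueness of derivatives
  identifies them with \<open>commanded_deriv\<close> and \<open>omc\<close>, and skewness recovers
  \<open>Rc'\<close> from \<open>Omc\<close>; after that the equations for the attitude errors
  apply.\<close>

lemma trajectory_derivatives:
  assumes cl: "closed_loop P K \<epsilon> T \<phi>" and T: "T = {0..} \<or> (\<exists>b>0. T = {0..<b})"
    and S: "\<And>t. t \<in> T \<Longrightarrow> \<phi> t \<in> S" and Ji: "\<And>v. Ji *v (inertia P *v v) = v" and t: "t \<in> T"
  shows "((\<lambda>t. err (\<phi> t)) has_vector_derivative err_rate (\<phi> t)) (at t within T)"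
    and "((\<lambda>t. eta (\<phi> t)) has_vector_derivative eta_rate (k_R K / \<epsilon>\<^sup>2) (k_Om K / \<epsilon>) Ji (\<phi> t)) (at t within T)"
proof -
  obtain Rc' Omc Omc' where c: "\<And>t. t \<in> T \<Longrightarrow> ((\<lambda>s. Rc P K (\<phi> s)) has_vector_derivative Rc' t) (at t within T) \<and>
        Omc t = vee (transpose (Rc P K (\<phi> t)) ** Rc' t) \<and>
        (Omc has_vector_derivative Omc' t) (at t within T)"
    and fd: "full_dynamics P (\<lambda>t. thrust P K (\<phi> t)) (\<lambda>t. moment P K \<epsilon> (Omc t) (Omc' t) (\<phi> t)) T \<phi>"
    using cl unfolding closed_loop_def by blast
  obtain a p Om' where d: "\<And>t. t \<in> T \<Longrightarrow> \<phi> t \<in> states"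
    "\<And>t. t \<in> T \<Longrightarrow> ((\<lambda>t. sx (\<phi> t)) has_vector_derivative sv (\<phi> t)) (at t within T)"
    "\<And>t. t \<in> T \<Longrightarrow> ((\<lambda>t. sv (\<phi> t)) has_vector_derivative a t) (at t within T)"
    "\<And>t i. t \<in> T \<Longrightarrow> ((\<lambda>t. sq (\<phi> t) $ i) has_vector_derivative cross3 (sw (\<phi> t) $ i) (sq (\<phi> t) $ i)) (at t within T)"
    "\<And>t i. t \<in> T \<Longrightarrow> ((\<lambda>t. sw (\<phi> t) $ i) has_vector_derivative cross3 (sq (\<phi> t) $ i) (p t $ i)) (at t within T)"
    "\<And>t. t \<in> T \<Longrightarrow> ((\<lambda>t. sR (\<phi> t)) has_vector_derivative sR (\<phi> t) ** hat (sOm (\<phi> t))) (at t within T)"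
    "\<And>t. t \<in> T \<Longrightarrow> ((\<lambda>t. sOm (\<phi> t)) has_vector_derivative Om' t) (at t within T)"
    and e: "\<And>t. t \<in> T \<Longrightarrow> M00 P *\<^sub>R a t + (\<Sum>i\<in>UNIV. M0 P i *\<^sub>R p t $ i) = - (thrust P K (\<phi> t) *\<^sub>R (sR (\<phi> t) *v e3)) + (M00 P * gravity P) *\<^sub>R e3"
    "\<And>t. t \<in> T \<Longrightarrow> (\<forall>i. Mij P i i *\<^sub>R p t $ i - (hat (sq (\<phi> t) $ i) ** hat (sq (\<phi> t) $ i)) *v
               (M0 P i *\<^sub>R a t + (\<Sum>j\<in>UNIV - {i}. Mij P i j *\<^sub>R p t $ j))
         = - ((Mij P i i * (norm (cross3 (sw (\<phi> t) $ i) (sq (\<phi> t) $ i)))\<^sup>2) *\<^sub>R sq (\<phi> t) $ i)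
           - Gi P i *\<^sub>R ((hat (sq (\<phi> t) $ i) ** hat (sq (\<phi> t) $ i)) *v e3))"
    and m: "\<And>t. t \<in> T \<Longrightarrow> inertia P *v Om' t + hat (sOm (\<phi> t)) *v (inertia P *v sOm (\<phi> t)) = moment P K \<epsilon> (Omc t) (Omc' t) (\<phi> t)"
    by (rule full_dynamicsE[OF fd]) (rule that)
  have acc: "acc (\<phi> t) = (a t, p t)" if "t \<in> T" for t
    using equations_of_motion[of "a t" "p t" "\<phi> t"] e[OF that] acc_eqI[OF S[OF that], of "(a t, p t)"] by simp
  note der = err_derivative[where \<phi>=\<phi>, OF d(2,3,4,5) acc]
  show "((\<lambda>t. err (\<phi> t)) has_vector_derivative err_rate (\<phi> t)) (at t within T)" using der(1) t by blast
  have Rc': "Rc' t = commanded_deriv (heading K) (force (\<phi> t)) (force_rate (\<phi> t))"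
    and Omc: "Omc t = omc (\<phi> t)" and RcOmc: "Rc' t = Rc P K (\<phi> t) ** hat (Omc t)" if t: "t \<in> T" for t
  proof -
    have h: "cross3 (heading K) (force (\<phi> t)) \<noteq> 0"
      using heading_force[of "\<phi> t"] S[OF t] c_pos by (auto simp: S_def)
    have f: "((\<lambda>t. force (\<phi> t)) has_vector_derivative force_rate (\<phi> t)) (at t within T)" using der(2) t by blast
    have "((\<lambda>s. Rc P K (\<phi> s)) has_vector_derivative commanded_deriv (heading K) (force (\<phi> t)) (force_rate (\<phi> t))) (at t within T)"
      by (rule has_vector_derivative_transform[OF t _ has_vector_derivative_commanded[where A="\<lambda>t. force (\<phi> t)", OF f h]])
        (simp add: Rc_commanded S)
    with c[OF t] show Rc': "Rc' t = commanded_deriv (heading K) (force (\<phi> t)) (force_rate (\<phi> t))"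
      using vector_derivative_unique_within[OF interval_limit_point[OF T t]] by blast
    then show "Omc t = omc (\<phi> t)" using c[OF t] by (simp add: omc_def)
    have rot: "transpose (Rc P K (\<phi> t)) ** Rc P K (\<phi> t) = mat 1" "Rc P K (\<phi> t) ** transpose (Rc P K (\<phi> t)) = mat 1" if "t \<in> T" for t
      using rotation_matrix_inverse[OF rotation_commanded[OF S[OF that]]] by auto
    have "hat (Omc t) = transpose (Rc P K (\<phi> t)) ** Rc' t"
      using hat_vee[OF skew_of_orthogonal_curve[where R="\<lambda>t. Rc P K (\<phi> t)", OF _ interval_limit_point[OF T t] t rot(1)]] c[OF t] by auto
    then show "Rc' t = Rc P K (\<phi> t) ** hat (Omc t)" by (simp add: matrix_mul_assoc rot(2)[OF t])
  qed
  have rot: "rotation_matrix (Rc P K (\<phi> t))" "rotation_matrix (sR (\<phi> t))"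
    using rotation_commanded[OF S[OF t]] d(1)[OF t] by (auto simp: states_def)
  have domc: "((\<lambda>t. omc (\<phi> t)) has_vector_derivative Omc' t) (at t within T)"
    by (rule has_vector_derivative_transform[OF t, of _ Omc]) (use c[OF t] Omc in auto)
  have dR: "((\<lambda>t. Rc P K (\<phi> t)) has_vector_derivative Rc P K (\<phi> t) ** hat (omc (\<phi> t))) (at t within T)"
    using c[OF t] RcOmc[OF t] Omc[OF t] by simp
  have Q: "((\<lambda>t. transpose (Rc P K (\<phi> t)) ** sR (\<phi> t)) has_vector_derivative
      (transpose (Rc P K (\<phi> t)) ** sR (\<phi> t)) ** hat (e_Om (Rc P K (\<phi> t)) (omc (\<phi> t)) (sR (\<phi> t)) (sOm (\<phi> t)))) (at t within T)"
    by (rule attitude_error_derivative[where Rd="\<lambda>t. Rc P K (\<phi> t)" and R="\<lambda>t. sR (\<phi> t)", OF dR d(6)[OF t] rot])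
  have mom: "inertia P *v Om' t + hat (sOm (\<phi> t)) *v (inertia P *v sOm (\<phi> t)) =
      - ((k_R K / \<epsilon>\<^sup>2) *\<^sub>R e_R (Rc P K (\<phi> t)) (sR (\<phi> t))) - (k_Om K / \<epsilon>) *\<^sub>R e_Om (Rc P K (\<phi> t)) (omc (\<phi> t)) (sR (\<phi> t)) (sOm (\<phi> t))
      + cross3 (sOm (\<phi> t)) (inertia P *v sOm (\<phi> t))
      - inertia P *v (hat (sOm (\<phi> t)) *v ((transpose (sR (\<phi> t)) ** Rc P K (\<phi> t)) *v omc (\<phi> t))
          - (transpose (sR (\<phi> t)) ** Rc P K (\<phi> t)) *v Omc' t)"
    unfolding m[OF t] Omc[OF t] by (cases "\<phi> t") (simp add: moment_def Let_def)
  show "((\<lambda>t. eta (\<phi> t)) has_vector_derivative eta_rate (k_R K / \<epsilon>\<^sup>2) (k_Om K / \<epsilon>) Ji (\<phi> t)) (at t within T)"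
    unfolding eta_def eta_rate_def fst_conv snd_conv att_def
    by (rule has_vector_derivative_Pair[OF e_R_derivative[where Rd="\<lambda>t. Rc P K (\<phi> t)" and R="\<lambda>t. sR (\<phi> t)", OF Q]
          e_Om_derivative[where Rd="\<lambda>t. Rc P K (\<phi> t)" and R="\<lambda>t. sR (\<phi> t)" and Omd="\<lambda>t. omc (\<phi> t)" and Om="\<lambda>t. sOm (\<phi> t)",
            OF Q domc d(7)[OF t] Ji mom]])
qed

text \<open>The weighted sum \<open>W\<close> of the two Lyapunov functions is comparable with
  \<open>V\<close>, the sum of the squared errors. Its derivative is at most \<open>- g * V\<close>
  as long as the trajectory stays so close that the nonlinear remainders fall under the tolerance
  \<open>k\<close> of \<open>cascade_decay\<close>.\<close>

lemma trajectory_decay: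
  assumes "0 < \<epsilon>"
  obtains r1 C \<gamma> where "0 < r1" "r1 \<le> r" "0 < C" "0 < \<gamma>"
    "\<And>T \<phi> t. closed_loop P K \<epsilon> T \<phi> \<Longrightarrow> T = {0..} \<or> (\<exists>b>0. T = {0..<b}) \<Longrightarrow> (\<And>t. t \<in> T \<Longrightarrow> D (\<phi> t) \<le> r1) \<Longrightarrow>
      t \<in> T \<Longrightarrow> D (\<phi> t) \<le> C * D (\<phi> 0) * exp (- \<gamma> * t)"
proof -
  define a b where "a = k_R K / \<epsilon>\<^sup>2" and "b = k_Om K / \<epsilon>"
  have ab: "0 < a" "0 < b" using k_R_pos k_Om_pos assms by (auto simp: a_def b_def)
  obtain Ji where Ji: "\<And>v. inertia P *v (Ji *v v) = v" "\<And>v. Ji *v (inertia P *v v) = v"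
    by (rule inertia_inverse) (rule that)
  obtain B1 k1 where B1: "bounded_bilinear B1" "\<And>x y. B1 x y = B1 y x" "0 < k1" "\<And>x. k1 * (norm x)\<^sup>2 \<le> B1 x x"
    "\<And>x. 2 * B1 x (lin x) \<le> - (norm x)\<^sup>2 / 2"
    by (rule linear_lyapunov_form[OF bounded_linear_lin], rule lin_converges, blast, rule that, assumption, assumption, assumption, assumption, assumption)
  define L2 where "L2 z = (snd z, - (Ji *v (a *\<^sub>R fst z + b *\<^sub>R snd z)))" for z :: "(real^3) \<times> (real^3)"
  obtain B2 k2 c2 where B2: "bounded_bilinear B2" "\<And>x y. B2 x y = B2 y x" "0 < k2" "\<And>x. k2 * (norm x)\<^sup>2 \<le> B2 x x" "0 < c2"
    "\<And>x. 2 * B2 x (snd x, - (Ji *v (a *\<^sub>R fst x + b *\<^sub>R snd x))) \<le> - c2 * (norm x)\<^sup>2"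
    by (rule attitude_lyapunov_form[OF inertia_sym inertia_pos ab Ji(1)], assumption, rule that, assumption, assumption, assumption, assumption, assumption, assumption)
  have d2: "\<And>z. 2 * B2 z (L2 z) \<le> - c2 * (norm z)\<^sup>2" unfolding L2_def by (rule B2(6))
  obtain Ce where Ce: "0 < Ce" "\<And>s. s \<in> S \<Longrightarrow> s \<in> states \<Longrightarrow>
    norm (err_rate s - lin (err s)) \<le> Ce * norm (att s - mat 1) + Ce * (D s)\<^sup>2" by (rule err_rate_bound) (rule that)
  obtain r' C where C: "0 < r'" "r' \<le> r" "0 < C"
    "\<And>s. s \<in> states \<Longrightarrow> D s \<le> r' \<Longrightarrow> norm (err s) + norm (eta s) \<le> C * D s"
    "\<And>s. s \<in> states \<Longrightarrow> D s \<le> r' \<Longrightarrow> D s \<le> C * (norm (err s) + norm (eta s))"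
    "\<And>s. s \<in> states \<Longrightarrow> D s \<le> r' \<Longrightarrow> norm (att s - mat 1) \<le> C * norm (eta s)"
    "\<And>s. s \<in> states \<Longrightarrow> D s \<le> r' \<Longrightarrow> norm (att s - mat 1) \<le> C * D s"
    "\<And>Q e. norm ((1/2) *\<^sub>R vee (Q ** hat e + hat e ** transpose Q) - e) \<le> C * norm (Q - mat 1) * norm e"
    by (rule coordinates, rule that, assumption, assumption, assumption, assumption, assumption, assumption, assumption, assumption)
  have d1: "\<And>y. 2 * B1 y (lin y) \<le> - (1/2) * (norm y)\<^sup>2" using B1(5) by simp
  have M0: "0 \<le> Ce * C" "(0::real) < 1 / 2" using Ce C by auto
  obtain m k g where mkg: "0 < m" "0 < k" "0 < g"
    "\<And>y z h1 h2. norm h1 \<le> Ce * C * norm z + k * (norm y + norm z) \<Longrightarrow> norm h2 \<le> k * (norm y + norm z) \<Longrightarrow>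
      2 * B1 y (lin y + h1) + m * (2 * B2 z (L2 z + h2)) \<le> - g * ((norm y)\<^sup>2 + (norm z)\<^sup>2)"
    by (rule cascade_decay[OF B1(1) B2(1) M0(2) B2(5) M0(1) d1 d2], rule that, assumption, assumption, assumption, assumption)
  obtain K1 where K1: "0 < K1" "\<And>x y. norm (B1 x y) \<le> norm x * norm y * K1" using bounded_bilinear.pos_bounded[OF B1(1)] by blast
  obtain K2 where K2: "0 < K2" "\<And>x y. norm (B2 x y) \<le> norm x * norm y * K2" using bounded_bilinear.pos_bounded[OF B2(1)] by blast
  \<comment> \<open>Constants of the two-sided comparison
    \<open>kw * V s \<le> W s \<le> Kw * V s\<close>.\<close>
  define Kw kw where "Kw = K1 + m * K2" and "kw = min k1 (m * k2)"
  have Kw: "0 < Kw" using K1 K2 mkg by (simp add: Kw_def add_pos_pos)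
  have kw: "0 < kw" "kw \<le> k1" "kw \<le> m * k2" using B1(3) B2(3) mkg by (auto simp: kw_def)
  define W where "W s = B1 (err s) (err s) + m * B2 (eta s) (eta s)" for s
  define V where "V s = (norm (err s))\<^sup>2 + (norm (eta s))\<^sup>2" for s
  have WV: "W s \<le> Kw * V s" for s
  proof -
    have "B1 (err s) (err s) \<le> K1 * (norm (err s))\<^sup>2" "B2 (eta s) (eta s) \<le> K2 * (norm (eta s))\<^sup>2"
      using K1(2)[of "err s" "err s"] K2(2)[of "eta s" "eta s"] by (simp_all add: power2_eq_square mult_ac abs_le_iff)
    then have "W s \<le> K1 * (norm (err s))\<^sup>2 + m * (K2 * (norm (eta s))\<^sup>2)"
      unfolding W_def using mkg(1) by (intro add_mono mult_left_mono) auto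
    also have "\<dots> \<le> Kw * V s"
    proof -
      have "0 \<le> m * K2 * (norm (err s))\<^sup>2" "0 \<le> K1 * (norm (eta s))\<^sup>2" using K1 K2 mkg by auto
      then show ?thesis by (simp add: Kw_def V_def algebra_simps)
    qed
    finally show ?thesis .
  qed
  have VW: "kw * V s \<le> W s" for s
  proof -
    have "kw * (norm (err s))\<^sup>2 \<le> k1 * (norm (err s))\<^sup>2" "kw * (norm (eta s))\<^sup>2 \<le> m * k2 * (norm (eta s))\<^sup>2"
      using kw by (auto intro!: mult_right_mono)
    moreover have "m * (k2 * (norm (eta s))\<^sup>2) \<le> m * B2 (eta s) (eta s)" using B2(4)[of "eta s"] mkg(1) by simp
    ultimately show ?thesis using B1(4)[of "err s"] unfolding W_def V_def by (simp add: algebra_simps)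
  qed
  \<comment> \<open>One factor \<open>D\<close> of the quadratic remainder in
    \<open>err_rate_bound\<close> is estimated by \<open>r1\<close>, the other by the errors; the
    first quotient makes the result at most \<open>k\<close>. The second quotient does the same for
    the derivative of \<open>e_R\<close>.\<close>
  define r1 where "r1 = min r' (min (k / (Ce * C)) (k / (C * C)))"
  have r1: "0 < r1" "r1 \<le> r'" "Ce * C * r1 \<le> k" "C * C * r1 \<le> k"
  proof -
    show "0 < r1" "r1 \<le> r'" using C Ce mkg by (auto simp: r1_def)
    have "r1 \<le> k / (Ce * C)" "r1 \<le> k / (C * C)" by (auto simp: r1_def)
    then show "Ce * C * r1 \<le> k" "C * C * r1 \<le> k" using C(3) Ce(1) by (simp_all add: pos_le_divide_eq mult_ac)
  qed
  \<comment> \<open>\<open>W\<close> decays at rate \<open>g / Kw\<close>, and the distance behaves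
    like the square root of \<open>W\<close>, which halves the rate. The constant \<open>c\<close>
    collects the comparisons of \<open>D\<close> with \<open>V\<close> and of \<open>V\<close> with
    \<open>W\<close> at both ends of the interval.\<close>
  define \<gamma> where "\<gamma> = g / (2 * Kw)"
  define c where "c = sqrt (2 * C\<^sup>2 * Kw * C\<^sup>2 / kw)"
  show thesis
  proof (rule that[of r1 c \<gamma>])
    show "0 < r1" "r1 \<le> r" using r1 C by auto
    show "0 < c" "0 < \<gamma>" using C Kw kw mkg by (simp_all add: c_def \<gamma>_def)
    fix T and \<phi> :: "real \<Rightarrow> 'n state" and t
    assume cl: "closed_loop P K \<epsilon> T \<phi>" and T: "T = {0..} \<or> (\<exists>b>0. T = {0..<b})"
      and small: "\<And>t. t \<in> T \<Longrightarrow> D (\<phi> t) \<le> r1" and t: "t \<in> T"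
    have st: "\<phi> u \<in> states" if "u \<in> T" for u using continuous_on_trajectory(2)[OF cl that] .
    have S: "\<phi> u \<in> S" if "u \<in> T" for u using small[OF that] r1(2) C(2) by (simp add: S_def)
    have r'u: "D (\<phi> u) \<le> r'" if "u \<in> T" for u using small[OF that] r1(2) by simp
    have sub: "{0..t} \<subseteq> T" and t0: "0 \<le> t" and T0: "0 \<in> T" using T t by auto
    define W' where "W' u = 2 * B1 (err (\<phi> u)) (err_rate (\<phi> u)) + m * (2 * B2 (eta (\<phi> u)) (eta_rate a b Ji (\<phi> u)))" for u
    have W: "W (\<phi> t) \<le> W (\<phi> 0) * exp (- (g / Kw) * t)"
    proof (rule gronwall_differential[OF t0])
      fix u assume u: "u \<in> {0..t}"
      then have uT: "u \<in> T" using sub by blast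
      note td = trajectory_derivatives[OF cl T S Ji(2) uT, folded a_def b_def]
      have e1: "((\<lambda>t. err (\<phi> t)) has_vector_derivative err_rate (\<phi> u)) (at u within {0..t})"
        by (rule has_vector_derivative_within_subset[OF td(1) sub])
      have e2: "((\<lambda>t. eta (\<phi> t)) has_vector_derivative eta_rate a b Ji (\<phi> u)) (at u within {0..t})"
        by (rule has_vector_derivative_within_subset[OF td(2) sub])
      have "((\<lambda>t. B1 (err (\<phi> t)) (err (\<phi> t))) has_real_derivative 2 * B1 (err (\<phi> u)) (err_rate (\<phi> u))) (at u within {0..t})"
        unfolding has_real_derivative_iff_has_vector_derivative
        using bounded_bilinear.has_vector_derivative[OF B1(1) e1 e1] by (simp add: B1(2)[of "err_rate (\<phi> u)"])
      moreover have "((\<lambda>t. B2 (eta (\<phi> t)) (eta (\<phi> t))) has_real_derivative 2 * B2 (eta (\<phi> u)) (eta_rate a b Ji (\<phi> u))) (at u within {0..t})"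
        unfolding has_real_derivative_iff_has_vector_derivative
        using bounded_bilinear.has_vector_derivative[OF B2(1) e2 e2] by (simp add: B2(2)[of "eta_rate a b Ji (\<phi> u)"])
      ultimately show "((\<lambda>u. W (\<phi> u)) has_real_derivative W' u) (at u within {0..t})"
        unfolding W_def W'_def by (intro DERIV_add DERIV_cmult)
      let ?y = "err (\<phi> u)" and ?z = "eta (\<phi> u)"
      define h1 where "h1 = err_rate (\<phi> u) - lin ?y"
      define h2 where "h2 = eta_rate a b Ji (\<phi> u) - L2 ?z"
      have Y: "0 \<le> norm ?y + norm ?z" by simp
      have Dk: "D (\<phi> u) \<le> r1" by (rule small[OF uT])
      have "norm h1 \<le> Ce * norm (att (\<phi> u) - mat 1) + Ce * (D (\<phi> u))\<^sup>2" unfolding h1_def by (rule Ce(2)[OF S[OF uT] st[OF uT]])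
      also have "\<dots> \<le> Ce * (C * norm ?z) + Ce * (r1 * (C * (norm ?y + norm ?z)))"
      proof (rule add_mono)
        show "Ce * norm (att (\<phi> u) - mat 1) \<le> Ce * (C * norm ?z)"
          using C(6)[OF st[OF uT] r'u[OF uT]] Ce(1) by simp
        have "D (\<phi> u) * D (\<phi> u) \<le> r1 * (C * (norm ?y + norm ?z))"
          using Dk C(5)[OF st[OF uT] r'u[OF uT]] r1(1) by (intro mult_mono) auto
        then show "Ce * (D (\<phi> u))\<^sup>2 \<le> Ce * (r1 * (C * (norm ?y + norm ?z)))"
          using Ce(1) by (simp add: power2_eq_square)
      qed
      also have "\<dots> = Ce * C * norm ?z + (Ce * C * r1) * (norm ?y + norm ?z)" by (simp add: algebra_simps)
      also have "\<dots> \<le> Ce * C * norm ?z + k * (norm ?y + norm ?z)"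
        by (intro add_left_mono mult_right_mono r1(3) Y)
      finally have h1: "norm h1 \<le> Ce * C * norm ?z + k * (norm ?y + norm ?z)" .
      have "h2 = ((1/2) *\<^sub>R vee (att (\<phi> u) ** hat (snd ?z) + hat (snd ?z) ** transpose (att (\<phi> u))) - snd ?z, 0)"
        by (simp add: h2_def eta_rate_def L2_def)
      then have "norm h2 = norm ((1/2) *\<^sub>R vee (att (\<phi> u) ** hat (snd ?z) + hat (snd ?z) ** transpose (att (\<phi> u))) - snd ?z)"
        by (simp add: norm_Pair)
      also have "\<dots> \<le> C * norm (att (\<phi> u) - mat 1) * norm (snd ?z)" by (rule C(8))
      also have "\<dots> \<le> C * (C * r1) * (norm ?y + norm ?z)"
      proof (intro mult_mono mult_left_mono)
        show "norm (att (\<phi> u) - mat 1) \<le> C * r1"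
          using C(7)[OF st[OF uT] r'u[OF uT]] mult_left_mono[OF Dk less_imp_le[OF C(3)]] by linarith
        show "norm (snd ?z) \<le> norm ?y + norm ?z"
          using norm_snd_le[of "snd ?z" "fst ?z"] by (simp add: add_increasing)
      qed (use C r1 in auto)
      also have "\<dots> \<le> k * (norm ?y + norm ?z)" using r1(4) Y by (intro mult_right_mono) auto
      finally have h2: "norm h2 \<le> k * (norm ?y + norm ?z)" .
      have "W' u \<le> - g * V (\<phi> u)"
        using mkg(4)[OF h1 h2] by (simp add: W'_def V_def h1_def h2_def)
      also have "\<dots> \<le> - (g / Kw) * W (\<phi> u)"
      proof -
        have "g / Kw * W (\<phi> u) \<le> g / Kw * (Kw * V (\<phi> u))" using WV Kw mkg(3) by (intro mult_left_mono) auto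
        then show ?thesis using Kw by simp
      qed
      finally show "W' u \<le> - (g / Kw) * W (\<phi> u)" .
    qed
    have "(D (\<phi> t))\<^sup>2 \<le> (C * (norm (err (\<phi> t)) + norm (eta (\<phi> t))))\<^sup>2"
      by (rule power_mono[OF C(5)[OF st[OF t] r'u[OF t]]]) simp
    also have "\<dots> \<le> 2 * C\<^sup>2 * V (\<phi> t)"
    proof -
      have "(norm (err (\<phi> t)) + norm (eta (\<phi> t)))\<^sup>2 \<le> 2 * V (\<phi> t)"
        using sum_squares_bound[of "norm (err (\<phi> t))" "norm (eta (\<phi> t))"] by (simp add: V_def power2_sum)
      from mult_left_mono[OF this, of "C\<^sup>2"] show ?thesis by (simp add: power_mult_distrib)
    qed
    also have "\<dots> \<le> 2 * C\<^sup>2 * (W (\<phi> t) / kw)"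
      using VW[of "\<phi> t"] kw by (intro mult_left_mono) (auto simp: pos_le_divide_eq mult.commute)
    also have "\<dots> \<le> 2 * C\<^sup>2 * (Kw * (C\<^sup>2 * (D (\<phi> 0))\<^sup>2) * exp (- (g / Kw) * t) / kw)"
    proof (intro mult_left_mono divide_right_mono order_trans[OF W] mult_right_mono)
      have "V (\<phi> 0) \<le> (norm (err (\<phi> 0)) + norm (eta (\<phi> 0)))\<^sup>2" by (simp add: V_def power2_sum)
      also have "\<dots> \<le> (C * D (\<phi> 0))\<^sup>2" by (rule power_mono[OF C(4)[OF st[OF T0] r'u[OF T0]]]) simp
      finally have "Kw * V (\<phi> 0) \<le> Kw * (C\<^sup>2 * (D (\<phi> 0))\<^sup>2)" using Kw by (simp add: power_mult_distrib)
      with WV[of "\<phi> 0"] show "W (\<phi> 0) \<le> Kw * (C\<^sup>2 * (D (\<phi> 0))\<^sup>2)" by linarith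
    qed (use kw in auto)
    also have "\<dots> = (c * D (\<phi> 0) * exp (- \<gamma> * t))\<^sup>2"
    proof -
      have "(exp (- \<gamma> * t))\<^sup>2 = exp (- (g / Kw) * t)" by (simp add: exp_double[symmetric] \<gamma>_def)
      moreover have "c\<^sup>2 = 2 * C\<^sup>2 * Kw * C\<^sup>2 / kw" using Kw kw C by (simp add: c_def)
      ultimately show ?thesis by (simp add: power_mult_distrib)
    qed
    finally show "D (\<phi> t) \<le> c * D (\<phi> 0) * exp (- \<gamma> * t)"
      by (rule power2_le_imp_le) (use \<open>0 < c\<close> in simp)
  qed
qed

text \<open>Confinement to the ball, assumed in \<open>trajectory_decay\<close>, follows from that
  estimate itself: a start with \<open>C * D (\<phi> 0) \<le> r1 / 2\<close> keeps the trajectory in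
  the half-radius ball up to any exit time, so there is none.\<close>

lemma trajectory_bound:
  assumes "0 < \<epsilon>"
  obtains \<delta> C \<gamma> where "0 < \<delta>" "0 < C" "0 < \<gamma>"
    "\<And>T \<phi> t. closed_loop P K \<epsilon> T \<phi> \<Longrightarrow> T = {0..} \<or> (\<exists>b>0. T = {0..<b}) \<Longrightarrow> D (\<phi> 0) < \<delta> \<Longrightarrow>
      t \<in> T \<Longrightarrow> D (\<phi> t) \<le> C * D (\<phi> 0) * exp (- \<gamma> * t)"
proof -
  show thesis
  proof (rule trajectory_decay[OF assms])
    fix r1 C \<gamma> :: real
    assume 1: "0 < r1" "r1 \<le> r" "0 < C" "0 < \<gamma>"
      and decay: "\<And>T \<phi> t. closed_loop P K \<epsilon> T \<phi> \<Longrightarrow> T = {0..} \<or> (\<exists>b>0. T = {0..<b}) \<Longrightarrow> (\<And>t. t \<in> T \<Longrightarrow> D (\<phi> t) \<le> r1) \<Longrightarrow>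
        t \<in> T \<Longrightarrow> D (\<phi> t) \<le> C * D (\<phi> 0) * exp (- \<gamma> * t)"
    show thesis
    proof (rule that[of "min r1 (r1 / (2 * C))" C \<gamma>])
      show "0 < min r1 (r1 / (2 * C))" "0 < C" "0 < \<gamma>" using 1 by auto
      fix T and \<phi> :: "real \<Rightarrow> 'n state" and t
      assume cl: "closed_loop P K \<epsilon> T \<phi>" and T: "T = {0..} \<or> (\<exists>b>0. T = {0..<b})"
        and small: "D (\<phi> 0) < min r1 (r1 / (2 * C))" and t: "t \<in> T"
      have half: "C * D (\<phi> 0) \<le> r1 / 2" using small 1(3) by (simp add: pos_less_divide_eq mult_ac)
      have "D (\<phi> u) < r1" if u: "u \<in> T" for u
      proof (rule trapped[where g="\<lambda>u. D (\<phi> u)" and k="r1 / 2"])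
        have sub: "{0..u} \<subseteq> T" using T u by auto
        show "continuous_on {0..u} (\<lambda>u. D (\<phi> u))"
          by (intro continuous_intros continuous_on_subset[OF continuous_on_trajectory(1)[OF cl] sub])
        show "D (\<phi> 0) < r1" "0 \<le> u" "r1 / 2 < r1" using small T u 1 by auto
        fix b v assume b: "0 < b" "b \<le> u" "\<And>t. t \<in> {0..<b} \<Longrightarrow> D (\<phi> t) < r1" and v: "v \<in> {0..<b}"
        have "{0..<b} \<subseteq> T" using sub b by auto
        from closed_loop_subset[OF cl this] have "D (\<phi> v) \<le> C * D (\<phi> 0) * exp (- \<gamma> * v)"
        proof (rule decay)
          show "{0..<b} = {0..} \<or> (\<exists>b'>0. {0..<b} = {0..<b'})" using b(1) by blast
          show "D (\<phi> t) \<le> r1" if "t \<in> {0..<b}" for t using b(3)[OF that] by simp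
        qed (rule v)
        also have "\<dots> \<le> C * D (\<phi> 0) * 1" using 1 v by (intro mult_left_mono) auto
        finally show "D (\<phi> v) \<le> r1 / 2" using half by simp
      qed
      then show "D (\<phi> t) \<le> C * D (\<phi> 0) * exp (- \<gamma> * t)"
        by (intro decay[OF cl T _ t]) (simp add: less_imp_le)
    qed
  qed
qed

end

section \<open>Existence of trajectories\<close>

lemma has_vector_derivative_zero_dominated:
  fixes f :: "real \<Rightarrow> 'a::real_normed_vector" and k :: "real \<Rightarrow> 'b::real_normed_vector"
  assumes k: "(k has_vector_derivative 0) (at t within T)" and "t \<in> T"
    and le: "\<And>s. s \<in> T \<Longrightarrow> norm (f s - f t) \<le> C * norm (k s - k t)"
  shows "(f has_vector_derivative 0) (at t within T)"
proof -
  have k0: "((\<lambda>y. (1 / norm (y - t)) *\<^sub>R (k y - k t)) \<longlongrightarrow> 0) (at t within T)"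
    using k by (simp add: has_vector_derivative_def has_derivative_within)
  have "((\<lambda>y. (1 / norm (y - t)) *\<^sub>R (f y - f t)) \<longlongrightarrow> 0) (at t within T)"
  proof (rule Lim_null_comparison)
    show "((\<lambda>y. C * norm ((1 / norm (y - t)) *\<^sub>R (k y - k t))) \<longlongrightarrow> 0) (at t within T)"
      using tendsto_mult_left[OF tendsto_norm_zero[OF k0], of C] by simp
    show "\<forall>\<^sub>F y in at t within T. norm ((1 / norm (y - t)) *\<^sub>R (f y - f t)) \<le> C * norm ((1 / norm (y - t)) *\<^sub>R (k y - k t))"
      unfolding eventually_at_filter
    proof (rule always_eventually, intro allI impI)
      fix y assume "y \<in> T"
      from mult_left_mono[OF le[OF this], of "1 / \<bar>y - t\<bar>"]
      show "norm ((1 / norm (y - t)) *\<^sub>R (f y - f t)) \<le> C * norm ((1 / norm (y - t)) *\<^sub>R (k y - k t))" by simp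
    qed
  qed
  then show ?thesis by (simp add: has_vector_derivative_def has_derivative_within bounded_linear_zero)
qed

text \<open>Formal differentiation of the equation predicts the derivative \<open>u'\<close>. After
  subtracting the linear motion with this velocity, both sides are constant to first order, and
  coercivity transfers this from the right side to the solution. The inverse of \<open>N s\<close>
  is never differentiated.\<close>

lemma differentiable_solve:
  fixes N :: "real \<Rightarrow> 'a::euclidean_space \<Rightarrow> 'a" and U r :: "real \<Rightarrow> 'a"
  assumes lin: "\<And>s. s \<in> T \<Longrightarrow> linear (N s)" and "0 < c" and coercive: "\<And>s u. s \<in> T \<Longrightarrow> c * norm u \<le> norm (N s u)"
    and sol: "\<And>s. s \<in> T \<Longrightarrow> N s (U s) = r s" and t: "t \<in> T"
    and N: "\<And>u. (\<lambda>s. N s u) differentiable (at t within T)" and r: "r differentiable (at t within T)"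
  shows "U differentiable (at t within T)"
proof -
  obtain n where n: "((\<lambda>s. N s (U t)) has_vector_derivative n) (at t within T)"
    using N vector_derivative_works by blast
  obtain r' where r': "(r has_vector_derivative r') (at t within T)" using r vector_derivative_works by blast
  have "inj (N t)"
  proof (rule injI)
    fix u v assume "N t u = N t v"
    then have "c * norm (u - v) \<le> 0" using coercive[OF t, of "u - v"] by (simp add: linear_diff[OF lin[OF t]])
    then show "u = v" using \<open>0 < c\<close> by (simp add: mult_le_0_iff)
  qed
  then have "surj (N t)" using linear_injective_imp_surjective[OF lin[OF t]] by blast
  then obtain u' where u': "N t u' = r' - n" by (metis surjD)
  obtain m where m: "((\<lambda>s. N s u') has_vector_derivative m) (at t within T)" using N vector_derivative_works by blast
  define k where "k s = r s - N s (U t) - (s - t) *\<^sub>R N s u'" for s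
  have id: "((\<lambda>s. s - t) has_real_derivative 1) (at t within T)" by (auto intro!: derivative_eq_intros)
  have "(k has_vector_derivative (r' - n - ((t - t) *\<^sub>R m + 1 *\<^sub>R N t u'))) (at t within T)"
    unfolding k_def by (intro has_vector_derivative_diff r' n has_vector_derivative_scaleR id m)
  then have k: "(k has_vector_derivative 0) (at t within T)" by (simp add: u')
  define f where "f s = U s - (s - t) *\<^sub>R u'" for s
  have "(f has_vector_derivative 0) (at t within T)"
  proof (rule has_vector_derivative_zero_dominated[OF k t])
    fix s assume s: "s \<in> T"
    have "N s (f s - f t) = k s - k t"
      by (simp add: f_def k_def linear_diff[OF lin[OF s]] linear_scale[OF lin[OF s]] sol s t)
    then have "c * norm (f s - f t) \<le> norm (k s - k t)" using coercive[OF s, of "f s - f t"] by simp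
    then show "norm (f s - f t) \<le> (1 / c) * norm (k s - k t)" using \<open>0 < c\<close> by (simp add: field_simps)
  qed
  then have "((\<lambda>s. f s + (s - t) *\<^sub>R u') has_vector_derivative (0 + ((t - t) *\<^sub>R 0 + 1 *\<^sub>R u'))) (at t within T)"
    by (intro has_vector_derivative_add has_vector_derivative_scaleR id has_vector_derivative_const)
  then have "(U has_vector_derivative u') (at t within T)" by (simp add: f_def)
  then show ?thesis by (simp add: differentiableI_vector)
qed

lemma differentiable_vec:
  fixes f :: "real \<Rightarrow> 'a::real_normed_vector ^ 'n"
  assumes "\<And>i. (\<lambda>t. f t $ i) differentiable (at t within T)"
  shows "f differentiable (at t within T)"
proof -
  have "(f has_vector_derivative (\<chi> i. vector_derivative (\<lambda>t. f t $ i) (at t within T))) (at t within T)"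
    by (rule has_vector_derivative_vec) (use assms in \<open>simp add: vector_derivative_works[symmetric]\<close>)
  then show ?thesis by (simp add: differentiableI_vector)
qed

lemma constant_curve:
  fixes f :: "real \<Rightarrow> 'a::real_normed_vector"
  assumes "\<And>t. t \<in> T \<Longrightarrow> (f has_vector_derivative 0) (at t within T)" "{0..u} \<subseteq> T" "0 \<le> u"
  shows "f u = f 0"
proof -
  have "(f has_derivative (\<lambda>h. 0)) (at t within {0..u})" if "t \<in> {0..u}" for t
    using has_vector_derivative_within_subset[OF assms(1) assms(2)] that assms(2)
    by (auto simp: has_vector_derivative_def)
  then obtain c where "\<And>x. x \<in> {0..u} \<Longrightarrow> f x = c"
    using has_derivative_zero_constant[of "{0..u}" f] by auto
  then show ?thesis using assms(3) by simp
qed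

context quadrotor_ball
begin

text \<open>States are now written in the coordinates \<open>(x, v, q, w, Q, e)\<close>, where \<open>Q = R\<^sub>c\<^sup>T R\<close> and \<open>e = e\<^sub>\<Omega>\<close>;
  there the closed loop is an ordinary differential equation.\<close>

definition origin :: "'n state" where
  "origin = (target K, 0, (\<chi> i. e3), 0, mat 1, 0)"

text \<open>The physical state without its angular velocity, for which 0 is inserted.
  \<open>acc\<close> and \<open>omc\<close> do not depend on that component, so they can be
  evaluated before the true angular velocity is known.\<close>

definition lift :: "'n state \<Rightarrow> 'n state" where
  "lift y = (sx y, sv y, sq y, sw y, commanded (heading K) (force y) ** sR y, 0)"

definition chart :: "'n state \<Rightarrow> 'n state" where
  "chart s = (sx s, sv s, sq s, sw s, att s, snd (eta s))"

text \<open>The last component solves the definition of the angular velocity error for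
  \<open>Om\<close>; \<open>sR y\<close> and \<open>sOm y\<close> play the roles of \<open>Q\<close>
  and \<open>e\<close>.\<close>

definition unchart :: "'n state \<Rightarrow> 'n state" where
  "unchart y = (sx y, sv y, sq y, sw y, commanded (heading K) (force y) ** sR y, sOm y + transpose (sR y) *v omc (lift y))"

text \<open>The term with \<open>vee\<close> is \<open>e_R\<close> expressed by \<open>Q\<close>
  alone; \<open>a\<close> and \<open>b\<close> stand for the gains divided by powers of \<epsilon>,
  and \<open>Ji\<close> for the inverse inertia.\<close>

definition field :: "real \<Rightarrow> real \<Rightarrow> real^3^3 \<Rightarrow> 'n state \<Rightarrow> 'n state" where
  "field a b Ji y = (sv y, fst (acc (lift y)), (\<chi> i. cross3 (sw y $ i) (sq y $ i)),
     (\<chi> i. cross3 (sq y $ i) (snd (acc (lift y)) $ i)), sR y ** hat (sOm y),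
     - (Ji *v (a *\<^sub>R ((1/2) *\<^sub>R vee (sR y - transpose (sR y))) + b *\<^sub>R sOm y)))"

lemma force_cong:
  "sx s = sx t \<Longrightarrow> sv s = sv t \<Longrightarrow> sq s = sq t \<Longrightarrow> sw s = sw t \<Longrightarrow> force s = force t"
  by (simp add: force_def pos_err_def vel_err_def)

lemma omc_cong:
  assumes "sx s = sx t" "sv s = sv t" "sq s = sq t" "sw s = sw t" "sR s = sR t"
    and "cross3 (heading K) (force s) \<noteq> 0"
  shows "load s = load t" "acc s = acc t" "omc s = omc t"
proof -
  have f: "force s = force t" by (rule force_cong) (fact assms)+
  show l: "load s = load t" by (simp add: load_def f assms)
  show a: "acc s = acc t" unfolding acc_def l assms ..
  have "Rc P K s = Rc P K t" using Rc_eq[of s] Rc_eq[of t] assms(6) f by simp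
  then show "omc s = omc t" by (simp add: omc_def force_rate_def pos_rate_def vel_rate_def f a assms)
qed

lemma origin_components:
  "sx origin = target K" "sv origin = 0" "sq origin = (\<chi> i. e3)" "sw origin = 0" "sR origin = mat 1" "sOm origin = 0"
  by (simp_all add: origin_def)

text \<open>The force ignores attitude and angular velocity. Replacing both by their equilibrium
  values yields a state no farther from the equilibrium than \<open>y\<close> is from
  \<open>origin\<close>.\<close>

lemma force_nondegenerate:
  assumes "norm (y - origin) \<le> r"
  shows "c \<le> norm (cross3 (heading K) (force y))" "c \<le> norm (force y)"
proof -
  define s where "s = (sx y, sv y, sq y, sw y, sR equilibrium, 0 :: real^3)"
  have f: "force s = force y" by (rule force_cong) (simp_all add: s_def)
  have "norm (s - equilibrium) \<le> norm (y - origin)"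
    by (cases y) (simp add: s_def origin_def desired_equilibrium_def norm_Pair)
  with assms have "norm (s - equilibrium) \<le> r" by simp
  from heading_force[OF this] force_lower[OF this]
  show "c \<le> norm (cross3 (heading K) (force y))" "c \<le> norm (force y)" by (simp_all add: f)
qed

lemma lip_lift: "lip (cball origin r) lift"
proof -
  have f: "lip (cball origin r) force" by (intro lip_intros)
  obtain B where "0 < B" "\<And>s. s \<in> cball origin r \<Longrightarrow> norm (force s) \<le> B" using lip_bounded[OF f bounded_cball] by blast
  then have "bounded (force ` cball origin r)" unfolding bounded_pos by auto
  then have "lip (force ` cball origin r) (commanded (heading K))"
    using force_nondegenerate by (intro lip_commanded[OF c_pos]) (auto simp: dist_norm norm_minus_commute)
  from lip_compose[OF f this] have "lip (cball origin r) (\<lambda>y. commanded (heading K) (force y))" by simp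
  then show ?thesis
    unfolding lift_def[abs_def] by (intro lip_intros lip_matrix_mult bounded_cball)
qed

lemma lift_origin: "lift origin = equilibrium"
proof -
  have "force origin = force equilibrium"
    by (rule force_cong) (simp_all add: origin_components equilibrium_components)
  then have "commanded (heading K) (force origin) ** sR origin = sR equilibrium"
    by (simp add: origin_components err_equilibrium sR_equilibrium)
  then show ?thesis by (simp add: lift_def origin_components desired_equilibrium_def prod_eq_iff)
qed

lemma chart_ball:
  obtains \<rho> where "0 < \<rho>" "\<rho> \<le> r" "\<And>y. y \<in> cball origin \<rho> \<Longrightarrow> lift y \<in> S" "lip (cball origin \<rho>) (\<lambda>y. acc (lift y))"
proof -
  obtain C where C: "0 < C" "\<And>x y. x \<in> cball origin r \<Longrightarrow> y \<in> cball origin r \<Longrightarrow> norm (lift x - lift y) \<le> C * norm (x - y)"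
    using lipD[OF lip_lift] by blast
  define \<rho> where "\<rho> = min r (r / C)"
  have \<rho>: "0 < \<rho>" "\<rho> \<le> r" "C * \<rho> \<le> r" using r_pos C(1) by (auto simp: \<rho>_def min_def field_simps)
  have lS: "lift y \<in> S" if "y \<in> cball origin \<rho>" for y
  proof -
    have "norm (lift y - equilibrium) \<le> C * norm (y - origin)"
      using C(2)[of y origin] that \<rho> r_pos by (simp add: lift_origin)
    also have "\<dots> \<le> C * \<rho>" using that C(1) by (simp add: dist_norm norm_minus_commute)
    finally show ?thesis using \<rho>(3) by (simp add: S_def)
  qed
  have "lip (cball origin \<rho>) lift" by (rule lip_subset[OF lip_lift]) (use \<rho> in auto)
  from lip_compose[OF this lip_acc] have "lip (cball origin \<rho>) (\<lambda>y. acc (lift y))" using lS by blast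
  with \<rho> lS show thesis by (intro that[of \<rho>])
qed

lemma lip_field:
  assumes "lip (cball origin \<rho>) (\<lambda>y. acc (lift y))"
  shows "lip (cball origin \<rho>) (field a b Ji)"
  unfolding field_def[abs_def]
  by (intro lip_intros assms lip_cross3 lip_matrix_mult bounded_cball)

text \<open>Composition with the projection to the closed ball, which is 1-Lipschitz by convexity,
  makes the field globally Lipschitz and changes nothing inside the ball.\<close>

lemma global_chart_solution:
  assumes "lip (cball origin \<rho>) (field a b Ji)" "0 < \<rho>"
  obtains \<psi> where "\<psi> 0 = y" "\<And>t. 0 \<le> t \<Longrightarrow> \<psi> t \<in> cball origin \<rho> \<Longrightarrow>
    (\<psi> has_vector_derivative field a b Ji (\<psi> t)) (at t within {0..})" "continuous_on {0..} \<psi>"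
proof -
  let ?p = "closest_point (cball origin \<rho>)"
  have ne: "cball origin \<rho> \<noteq> {}" "closed (cball origin \<rho>)" "convex (cball origin \<rho>)" using assms(2) by auto
  have "lip UNIV ?p"
    unfolding lip_def using closest_point_lipschitz[OF ne(3,2,1)] by (intro exI[of _ 1] lipschitz_onI) auto
  moreover have "?p ` UNIV \<subseteq> cball origin \<rho>" using closest_point_in_set[OF ne(2,1)] by blast
  ultimately have "lip UNIV (\<lambda>y. field a b Ji (?p y))" using lip_compose[OF _ assms(1)] by blast
  then obtain L where "L-lipschitz_on UNIV (\<lambda>y. field a b Ji (?p y))" by (auto simp: lip_def)
  from lipschitz_global_solution[OF this, of y]
  obtain \<psi> where \<psi>: "\<psi> 0 = y" "\<And>t. 0 \<le> t \<Longrightarrow> (\<psi> has_vector_derivative field a b Ji (?p (\<psi> t))) (at t within {0..})"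
    by metis
  show thesis
  proof (rule that)
    show "\<psi> 0 = y" by (rule \<psi>(1))
    show "(\<psi> has_vector_derivative field a b Ji (\<psi> t)) (at t within {0..})" if "0 \<le> t" "\<psi> t \<in> cball origin \<rho>" for t
      using \<psi>(2)[OF that(1)] closest_point_self[OF that(2)] by simp
    show "continuous_on {0..} \<psi>"
      using \<psi>(2) has_vector_derivative_continuous continuous_on_eq_continuous_within by (metis atLeast_iff)
  qed
qed

text \<open>The constraints are first integrals: both derivatives are sums of triple products with a
  repeated factor for the links, and zero for the orthogonality of \<open>Q\<close>. The determinant
  stays 1 by continuity.\<close>

lemma chart_constraints:
  fixes \<psi> :: "real \<Rightarrow> 'n state"
  assumes der: "\<And>t. t \<in> T \<Longrightarrow> (\<psi> has_vector_derivative field a b Ji (\<psi> t)) (at t within T)"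
    and sub: "{0..u} \<subseteq> T" "0 \<le> u"
    and init: "\<And>i. norm (sq (\<psi> 0) $ i) = 1" "\<And>i. sq (\<psi> 0) $ i \<bullet> sw (\<psi> 0) $ i = 0" "rotation_matrix (sR (\<psi> 0))"
  shows "norm (sq (\<psi> u) $ i) = 1" "sq (\<psi> u) $ i \<bullet> sw (\<psi> u) $ i = 0" "rotation_matrix (sR (\<psi> u))"
proof -
  note L = bounded_linear.has_vector_derivative
  have dq: "((\<lambda>t. sq (\<psi> t) $ i) has_vector_derivative cross3 (sw (\<psi> t) $ i) (sq (\<psi> t) $ i)) (at t within T)"
    and dw: "((\<lambda>t. sw (\<psi> t) $ i) has_vector_derivative cross3 (sq (\<psi> t) $ i) (snd (acc (lift (\<psi> t))) $ i)) (at t within T)"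
    and dQ: "((\<lambda>t. sR (\<psi> t)) has_vector_derivative sR (\<psi> t) ** hat (sOm (\<psi> t))) (at t within T)" if "t \<in> T" for t
  proof -
    note d3 = L[OF bounded_linear_snd L[OF bounded_linear_snd der[OF that]]]
    note d4 = L[OF bounded_linear_snd d3]
    show "((\<lambda>t. sq (\<psi> t) $ i) has_vector_derivative cross3 (sw (\<psi> t) $ i) (sq (\<psi> t) $ i)) (at t within T)"
      using L[OF bounded_linear_vec_nth L[OF bounded_linear_fst d3], of i] by (simp add: field_def)
    show "((\<lambda>t. sw (\<psi> t) $ i) has_vector_derivative cross3 (sq (\<psi> t) $ i) (snd (acc (lift (\<psi> t))) $ i)) (at t within T)"
      using L[OF bounded_linear_vec_nth L[OF bounded_linear_fst d4], of i] by (simp add: field_def)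
    show "((\<lambda>t. sR (\<psi> t)) has_vector_derivative sR (\<psi> t) ** hat (sOm (\<psi> t))) (at t within T)"
      using L[OF bounded_linear_fst L[OF bounded_linear_snd d4]] by (simp add: field_def)
  qed
  have "sq (\<psi> u) $ i \<bullet> sq (\<psi> u) $ i = sq (\<psi> 0) $ i \<bullet> sq (\<psi> 0) $ i"
  proof (rule constant_curve[OF _ sub])
    fix t assume "t \<in> T"
    from bounded_bilinear.has_vector_derivative[OF bounded_bilinear_inner dq[OF this] dq[OF this]]
    show "((\<lambda>t. sq (\<psi> t) $ i \<bullet> sq (\<psi> t) $ i) has_vector_derivative 0) (at t within T)"
      by (simp add: dot_cross_self)
  qed
  then show "norm (sq (\<psi> u) $ i) = 1" using init(1)[of i] by (simp add: norm_eq_1)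
  have "sq (\<psi> u) $ i \<bullet> sw (\<psi> u) $ i = sq (\<psi> 0) $ i \<bullet> sw (\<psi> 0) $ i"
  proof (rule constant_curve[OF _ sub])
    fix t assume "t \<in> T"
    from bounded_bilinear.has_vector_derivative[OF bounded_bilinear_inner dq[OF this] dw[OF this]]
    show "((\<lambda>t. sq (\<psi> t) $ i \<bullet> sw (\<psi> t) $ i) has_vector_derivative 0) (at t within T)"
      by (simp add: dot_cross_self)
  qed
  then show "sq (\<psi> u) $ i \<bullet> sw (\<psi> u) $ i = 0" using init(2) by simp
  \<comment> \<open>For \<open>Q' = Q ** hat e\<close> the product \<open>Q ** transpose Q\<close>
    has derivative 0 at once, since \<open>hat e\<close> is skew. The product in the other order
    would only satisfy a linear differential equation.\<close>
  have const: "sR (\<psi> v) ** transpose (sR (\<psi> v)) = mat 1" if v: "v \<in> {0..u}" for v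
  proof -
    have "sR (\<psi> v) ** transpose (sR (\<psi> v)) = sR (\<psi> 0) ** transpose (sR (\<psi> 0))"
    proof (rule constant_curve)
      show "{0..v} \<subseteq> T" "0 \<le> v" using v sub by auto
      fix t assume t: "t \<in> T"
      have "transpose (sR (\<psi> t) ** hat (sOm (\<psi> t))) = - (hat (sOm (\<psi> t)) ** transpose (sR (\<psi> t)))"
        by (simp add: matrix_transpose_mul transpose_hat bounded_bilinear.minus_left[OF bounded_bilinear_matrix_mult])
      then show "((\<lambda>t. sR (\<psi> t) ** transpose (sR (\<psi> t))) has_vector_derivative 0) (at t within T)"
        using bounded_bilinear.has_vector_derivative[OF bounded_bilinear_matrix_mult dQ[OF t] L[OF bounded_linear_transpose dQ[OF t]]]
        by (simp add: matrix_mul_assoc bounded_bilinear.minus_right[OF bounded_bilinear_matrix_mult])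
    qed
    then show ?thesis using rotation_matrix_inverse(2)[OF init(3)] by simp
  qed
  have det1: "det (sR (\<psi> v)) \<noteq> 0" if "v \<in> {0..u}" for v
    using arg_cong[OF const[OF that], of det] by (auto simp: det_mul)
  have "continuous_on {0..u} (\<lambda>v. sR (\<psi> v))"
    using sub has_vector_derivative_continuous[OF dQ] continuous_within_subset
    unfolding continuous_on_eq_continuous_within by blast
  then have "continuous_on {0..u} (\<lambda>v. sR (\<psi> v) $ i $ j)" for i j
    by (intro bounded_linear.continuous_on[OF bounded_linear_vec_nth])
  then have cd: "continuous_on {0..u} (\<lambda>v. det (sR (\<psi> v)))"
    unfolding det_3 by (intro continuous_on_add continuous_on_diff continuous_on_mult)
  have "orthogonal_matrix (sR (\<psi> u))"
    using const[of u] sub(2) by (simp add: orthogonal_matrix_def matrix_left_right_inverse)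
  \<comment> \<open>An orthogonal matrix has determinant 1 or -1. A change of sign would force a
    zero of the determinant on the way, where the matrix is still invertible.\<close>
  moreover have "det (sR (\<psi> u)) = 1"
  proof (rule ccontr)
    assume "det (sR (\<psi> u)) \<noteq> 1"
    with det_orthogonal_matrix[OF \<open>orthogonal_matrix (sR (\<psi> u))\<close>] have "det (sR (\<psi> u)) \<le> 0" by auto
    moreover have "0 \<le> det (sR (\<psi> 0))" using init(3) by (simp add: rotation_matrix_def)
    ultimately obtain v where "0 \<le> v" "v \<le> u" "det (sR (\<psi> v)) = 0"
      using IVT2'[of "\<lambda>v. det (sR (\<psi> v))" u 0 0] sub(2) cd by auto
    then show False using det1[of v] by simp
  qed
  ultimately show "rotation_matrix (sR (\<psi> u))" by (simp add: rotation_matrix_def)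
qed

text \<open>The converse of \<open>trajectory_derivatives\<close>: all curves whose existence the
  closed loop demands are built from a solution in the chart. The substantial point is that the
  commanded angular velocity is differentiable, because it contains the accelerations.\<close>

lemma closed_loop_of_chart:
  fixes \<psi> :: "real \<Rightarrow> 'n state"
  assumes T: "T = {0..} \<or> (\<exists>b>0. T = {0..<b})"
    and Ji: "\<And>v. inertia P *v (Ji *v v) = v"
    and der: "\<And>t. t \<in> T \<Longrightarrow> (\<psi> has_vector_derivative field (k_R K / \<epsilon>\<^sup>2) (k_Om K / \<epsilon>) Ji (\<psi> t)) (at t within T)"
    and ball: "\<And>t. t \<in> T \<Longrightarrow> norm (\<psi> t - origin) \<le> r" and lS: "\<And>t. t \<in> T \<Longrightarrow> lift (\<psi> t) \<in> S"
    and init: "\<And>i. norm (sq (\<psi> 0) $ i) = 1" "\<And>i. sq (\<psi> 0) $ i \<bullet> sw (\<psi> 0) $ i = 0" "rotation_matrix (sR (\<psi> 0))"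
  shows "closed_loop P K \<epsilon> T (\<lambda>t. unchart (\<psi> t))"
    and "\<And>t. t \<in> T \<Longrightarrow> chart (unchart (\<psi> t)) = \<psi> t"
proof -
  note L = bounded_linear.has_vector_derivative
  \<comment> \<open>This curve differs from the trajectory \<phi> at most in the angular velocity,
    so loads, accelerations and commanded angular velocity coincide.\<close>
  define lc where "lc t = lift (\<psi> t)" for t
  define A where "A t = force (lc t)" for t
  define dA where "dA t = force_rate (lc t)" for t
  define U where "U t = acc (lc t)" for t
  define x v q w Q e where "x t = sx (\<psi> t)" and "v t = sv (\<psi> t)" and "q t = sq (\<psi> t)" and "w t = sw (\<psi> t)"
    and "Q t = sR (\<psi> t)" and "e t = sOm (\<psi> t)" for t
  define RC where "RC t = commanded (heading K) (A t)" for t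
  define Oc where "Oc t = omc (lc t)" for t
  define \<phi> where "\<phi> t = unchart (\<psi> t)" for t
  have fA: "force (\<psi> t) = A t" for t unfolding A_def lc_def by (rule force_cong) (simp_all add: lift_def)
  have lc: "lc t = (x t, v t, q t, w t, RC t ** Q t, 0)" for t
    by (simp add: lc_def lift_def x_def v_def q_def w_def Q_def RC_def fA)
  have \<phi>: "\<phi> t = (x t, v t, q t, w t, RC t ** Q t, e t + transpose (Q t) *v Oc t)" for t
    by (simp add: \<phi>_def unchart_def x_def v_def q_def w_def Q_def e_def RC_def fA Oc_def lc_def del: transpose_matrix_vector)
  have sub: "{0..t} \<subseteq> T" "0 \<le> t" if "t \<in> T" for t using T that by auto
  have con: "norm (q t $ i) = 1" "q t $ i \<bullet> w t $ i = 0" "rotation_matrix (Q t)" if "t \<in> T" for t i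
    using chart_constraints[OF der sub[OF that] init] by (simp_all add: q_def w_def Q_def)
  have hA: "cross3 (heading K) (A t) \<noteq> 0" "A t \<noteq> 0" if "t \<in> T" for t
    using force_nondegenerate[OF ball[OF that]] c_pos by (auto simp: fA)
  have rotC: "rotation_matrix (RC t)" if "t \<in> T" for t
    unfolding RC_def by (rule rotation_matrix_commanded[OF hA(1)[OF that]])
  have A\<phi>: "force (\<phi> t) = A t" for t unfolding A_def by (rule force_cong) (simp_all add: \<phi> lc)
  have Rc\<phi>: "Rc P K (\<phi> t) = RC t" "Rc P K (lc t) = RC t" if "t \<in> T" for t
    using Rc_eq[of "\<phi> t"] Rc_eq[of "lc t"] hA(1)[OF that] by (simp_all add: A\<phi> A_def[symmetric] RC_def)
  have cong: "load (\<phi> t) = load (lc t)" "omc (\<phi> t) = Oc t" if "t \<in> T" for t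
  proof -
    have "cross3 (heading K) (force (\<phi> t)) \<noteq> 0" using hA(1)[OF that] by (simp add: A\<phi>)
    from omc_cong[OF _ _ _ _ _ this, of "lc t"]
    show "load (\<phi> t) = load (lc t)" "omc (\<phi> t) = Oc t" by (simp_all add: \<phi> lc Oc_def)
  qed
  have stL: "lc t \<in> states" and st\<phi>: "\<phi> t \<in> states" if "t \<in> T" for t
    using con[OF that] rotation_matrix_mult[OF rotC[OF that] con(3)[OF that]] by (simp_all add: states_def lc \<phi>)
  have eqU: "inertia_op (q t) (U t) = load (lc t)" if "t \<in> T" for t
    using acc[OF lS[OF that]] by (simp add: U_def lc_def[symmetric] lc[of t])
  have dx: "(x has_vector_derivative v t) (at t within T)"
    and dv: "(v has_vector_derivative fst (U t)) (at t within T)"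
    and dq: "((\<lambda>t. q t $ i) has_vector_derivative cross3 (w t $ i) (q t $ i)) (at t within T)"
    and dw: "((\<lambda>t. w t $ i) has_vector_derivative cross3 (q t $ i) (snd (U t) $ i)) (at t within T)"
    and dqv: "(q has_vector_derivative (\<chi> i. cross3 (w t $ i) (q t $ i))) (at t within T)"
    and dQ: "(Q has_vector_derivative Q t ** hat (e t)) (at t within T)"
    and de: "(e has_vector_derivative - (Ji *v ((k_R K / \<epsilon>\<^sup>2) *\<^sub>R ((1/2) *\<^sub>R vee (Q t - transpose (Q t))) + (k_Om K / \<epsilon>) *\<^sub>R e t))) (at t within T)"
    if "t \<in> T" for t i
  proof -
    note d1 = der[OF that]
    note d2 = L[OF bounded_linear_snd d1]
    note d3 = L[OF bounded_linear_snd d2]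
    note d4 = L[OF bounded_linear_snd d3]
    note d5 = L[OF bounded_linear_snd d4]
    note defs = x_def v_def q_def w_def Q_def e_def U_def lc_def
    show "(x has_vector_derivative v t) (at t within T)"
      using L[OF bounded_linear_fst d1] by (simp add: field_def defs[abs_def])
    show "(v has_vector_derivative fst (U t)) (at t within T)"
      using L[OF bounded_linear_fst d2] by (simp add: field_def defs[abs_def])
    show q: "(q has_vector_derivative (\<chi> i. cross3 (w t $ i) (q t $ i))) (at t within T)"
      using L[OF bounded_linear_fst d3] by (simp add: field_def defs[abs_def])
    show "((\<lambda>t. q t $ i) has_vector_derivative cross3 (w t $ i) (q t $ i)) (at t within T)"
      using L[OF bounded_linear_vec_nth q, of i] by simp
    show "((\<lambda>t. w t $ i) has_vector_derivative cross3 (q t $ i) (snd (U t) $ i)) (at t within T)"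
      using L[OF bounded_linear_vec_nth L[OF bounded_linear_fst d4], of i] by (simp add: field_def defs[abs_def])
    show "(Q has_vector_derivative Q t ** hat (e t)) (at t within T)"
      using L[OF bounded_linear_fst d5] by (simp add: field_def defs[abs_def])
    show "(e has_vector_derivative - (Ji *v ((k_R K / \<epsilon>\<^sup>2) *\<^sub>R ((1/2) *\<^sub>R vee (Q t - transpose (Q t))) + (k_Om K / \<epsilon>) *\<^sub>R e t))) (at t within T)"
      using L[OF bounded_linear_snd d5] by (simp add: field_def defs[abs_def])
  qed
  have dAder: "(A has_vector_derivative dA t) (at t within T)" if t: "t \<in> T" for t
    unfolding A_def dA_def
  proof (rule err_derivative(2)[where \<phi>=lc and a="fst (U t)" and p="snd (U t)"])
    show "acc (lc t) = (fst (U t), snd (U t))" by (simp add: U_def)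
  qed (simp_all add: lc dx[OF t] dv[OF t] dq[OF t] dw[OF t])
  have dRC: "(RC has_vector_derivative commanded_deriv (heading K) (A t) (dA t)) (at t within T)" if t: "t \<in> T" for t
    unfolding RC_def by (rule has_vector_derivative_commanded[OF dAder[OF t] hA(1)[OF t]])
  have OC: "Oc t = vee (transpose (RC t) ** commanded_deriv (heading K) (A t) (dA t))" if "t \<in> T" for t
    unfolding Oc_def omc_def Rc\<phi>(2)[OF that] A_def dA_def ..
  have RCO: "commanded_deriv (heading K) (A t) (dA t) = RC t ** hat (Oc t)" if t: "t \<in> T" for t
  proof -
    have "hat (Oc t) = transpose (RC t) ** commanded_deriv (heading K) (A t) (dA t)"
      unfolding OC[OF t]
      by (rule hat_vee[OF skew_of_orthogonal_curve[OF dRC[OF t] interval_limit_point[OF T t] t]])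
        (use rotation_matrix_inverse(1)[OF rotC] in blast)
    then show ?thesis using rotation_matrix_inverse(2)[OF rotC[OF t]] by (simp add: matrix_mul_assoc)
  qed
  \<comment> \<open>The field gives one derivative of the components, so the load and the inertia
    operator are differentiable in time. \<open>differentiable_solve\<close> passes this on to the
    accelerations, and from there it reaches the rate of the force and the formula
    \<open>OC\<close>.\<close>
  have dO: "Oc differentiable (at t within T)" if t: "t \<in> T" for t
  proof -
    note bl = differentiable_linear and bil = differentiable_bilinear
    have dif: "v differentiable (at t within T)" "A differentiable (at t within T)" "RC differentiable (at t within T)"
      "Q differentiable (at t within T)" "\<And>i. (\<lambda>t. q t $ i) differentiable (at t within T)"
      "\<And>i. (\<lambda>t. w t $ i) differentiable (at t within T)"
      using dv[OF t] dAder[OF t] dRC[OF t] dQ[OF t] dq[OF t] dw[OF t] by (blast intro: differentiableI_vector)+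
    note X = bil[OF bounded_bilinear_cross3] and V = bil[OF bounded_bilinear_matrix_vector] and I = bil[OF bounded_bilinear_inner]
      and SC = bil[OF bounded_bilinear_scaleR] and MM = bil[OF bounded_bilinear_matrix_mult]
    have R: "(\<lambda>t. (RC t ** Q t) *v e3) differentiable (at t within T)"
      by (intro V MM dif differentiable_const)
    have "(\<lambda>t. load (lc t)) differentiable (at t within T)"
    proof -
      have 1: "(\<lambda>t. (A t \<bullet> ((RC t ** Q t) *v e3)) *\<^sub>R ((RC t ** Q t) *v e3) + (M00 P * gravity P) *\<^sub>R e3) differentiable (at t within T)"
        by (intro differentiable_add SC I dif R differentiable_const)
      have 2: "(\<lambda>t. \<chi> i. - ((Mij P i i * (cross3 (w t $ i) (q t $ i) \<bullet> cross3 (w t $ i) (q t $ i))) *\<^sub>R q t $ i)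
         - Gi P i *\<^sub>R cross3 (q t $ i) (cross3 (q t $ i) e3)) differentiable (at t within T)"
        by (rule differentiable_vec, unfold vec_lambda_beta)
          (intro differentiable_diff differentiable_minus SC I X dif differentiable_const differentiable_mult)
      show ?thesis
        unfolding load_def A_def[symmetric] unfolding lc fst_conv snd_conv by (rule differentiable_Pair[OF 1 2])
    qed
    moreover have "(\<lambda>s. inertia_op (q s) u) differentiable (at t within T)" for u
    proof -
      have "(\<lambda>s. \<chi> i. Mij P i i *\<^sub>R snd u $ i - cross3 (q s $ i) (cross3 (q s $ i) (coupling i u))) differentiable (at t within T)"
        by (rule differentiable_vec, unfold vec_lambda_beta) (intro differentiable_diff X dif differentiable_const)
      from differentiable_Pair[OF differentiable_const this] show ?thesis by (simp add: inertia_op_def)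
    qed
    moreover have "c * norm u \<le> norm (inertia_op (q s) u)" if "s \<in> T" for s u
      using coercive[of "lc s" u] lS[OF that] by (simp add: S_def lc_def[symmetric] lc[of s])
    ultimately have U: "U differentiable (at t within T)"
      using differentiable_solve[where N="\<lambda>s. inertia_op (q s)" and U=U and r="\<lambda>t. load (lc t)" and T=T and t=t,
          OF linear_inertia_op c_pos _ eqU t] by blast
    have bv: "(\<lambda>t. block_vector (f t) (\<lambda>i. g t i)) differentiable (at t within T)"
      if "f differentiable (at t within T)" "\<And>i. (\<lambda>t. g t i) differentiable (at t within T)"
      for f and g :: "real \<Rightarrow> 'n \<Rightarrow> real^2"
    proof -
      have "(\<lambda>t. \<chi> i. g t i) differentiable (at t within T)" by (rule differentiable_vec) (simp add: that(2))
      from bl[OF bounded_linear_block_vector differentiable_Pair[OF that(1) this]] show ?thesis by simp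
    qed
    have "(\<lambda>t. snd (U t) $ i) differentiable (at t within T)" for i
      by (rule bl[OF bounded_linear_vec_nth bl[OF bounded_linear_snd U]])
    then have "(\<lambda>t. pos_rate (lc t)) differentiable (at t within T)" "(\<lambda>t. vel_rate (lc t)) differentiable (at t within T)"
      unfolding pos_rate_def vel_rate_def U_def[symmetric] unfolding lc fst_conv snd_conv
      by (intro bv V X dif differentiable_const bl[OF bounded_linear_fst U]; simp)+
    then have "dA differentiable (at t within T)"
      unfolding dA_def[abs_def] force_rate_def by (intro differentiable_diff differentiable_minus V differentiable_const)
    from differentiable_commanded_deriv(1)[OF dif(2) this hA(1)[OF t]]
    have dif': "(\<lambda>t. vee (transpose (RC t) ** commanded_deriv (heading K) (A t) (dA t))) differentiable (at t within T)"
      by (intro bl[OF bounded_linear_vee] MM bl[OF bounded_linear_transpose] dif)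
    obtain D' where "((\<lambda>t. vee (transpose (RC t) ** commanded_deriv (heading K) (A t) (dA t))) has_vector_derivative D') (at t within T)"
      using dif' vector_derivative_works by blast
    then have "(Oc has_vector_derivative D') (at t within T)"
      by (rule has_vector_derivative_transform[OF t, rotated]) (simp add: OC)
    then show ?thesis by (rule differentiableI_vector)
  qed
  define Oc' where "Oc' t = vector_derivative Oc (at t within T)" for t
  have dO': "(Oc has_vector_derivative Oc' t) (at t within T)" if "t \<in> T" for t
    using dO[OF that] by (simp add: Oc'_def vector_derivative_works)
  define Om where "Om t = e t + transpose (Q t) *v Oc t" for t
  \<comment> \<open>\<open>Om t\<close> and \<open>e t\<close> differ by
    \<open>transpose (Q t) *v Oc t\<close>, whose cross product with itself is 0.\<close>
  have OmO: "cross3 (e t) (transpose (Q t) *v Oc t) = cross3 (Om t) (transpose (Q t) *v Oc t)" for t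
    by (simp add: Om_def cross_add_left del: transpose_matrix_vector)
  \<comment> \<open>The derivative of \<open>e + transpose Q *v Oc\<close>. Multiplied by the
    inertia it reproduces the moment, with the value of \<open>Oc'\<close> left unspecified.\<close>
  define Om' where "Om' t = - (Ji *v ((k_R K / \<epsilon>\<^sup>2) *\<^sub>R ((1/2) *\<^sub>R vee (Q t - transpose (Q t))) + (k_Om K / \<epsilon>) *\<^sub>R e t))
      + (transpose (Q t) *v Oc' t - cross3 (Om t) (transpose (Q t) *v Oc t))" for t
  have dOm: "(Om has_vector_derivative Om' t) (at t within T)" if t: "t \<in> T" for t
  proof -
    have "transpose (Q t ** hat (e t)) = - (hat (e t) ** transpose (Q t))"
      by (simp add: matrix_transpose_mul transpose_hat bounded_bilinear.minus_left[OF bounded_bilinear_matrix_mult])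
    then have "((\<lambda>t. transpose (Q t)) has_vector_derivative - (hat (e t) ** transpose (Q t))) (at t within T)"
      using L[OF bounded_linear_transpose dQ[OF t]] by simp
    from bounded_bilinear.has_vector_derivative[OF bounded_bilinear_matrix_vector this dO'[OF t]]
    have "((\<lambda>t. transpose (Q t) *v Oc t) has_vector_derivative
        (transpose (Q t) *v Oc' t + - cross3 (Om t) (transpose (Q t) *v Oc t))) (at t within T)"
      unfolding bounded_bilinear.minus_left[OF bounded_bilinear_matrix_vector] matrix_vector_mul_assoc[symmetric] hat_mult OmO .
    from has_vector_derivative_add[OF de[OF t] this] show ?thesis unfolding Om_def[abs_def] Om'_def by simp
  qed
  have QR: "transpose (RC t) ** (RC t ** Q t) = Q t" "transpose (RC t ** Q t) ** RC t = transpose (Q t)" if "t \<in> T" for t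
    using rotation_matrix_inverse(1)[OF rotC[OF that]]
    by (simp add: matrix_mul_assoc, simp add: matrix_transpose_mul matrix_mul_assoc[symmetric])
  have eR: "e_R (RC t) (RC t ** Q t) = (1/2) *\<^sub>R vee (Q t - transpose (Q t))" if "t \<in> T" for t
    unfolding e_R_def QR[OF that] ..
  have eO: "e_Om (RC t) (Oc t) (RC t ** Q t) (Om t) = e t" if "t \<in> T" for t
    unfolding e_Om_def QR[OF that] Om_def by simp
  have dR: "((\<lambda>t. RC t ** Q t) has_vector_derivative (RC t ** Q t) ** hat (Om t)) (at t within T)" if t: "t \<in> T" for t
  proof -
    have "(RC t ** Q t) ** hat (Om t) = RC t ** (Q t ** hat (e t)) + (RC t ** hat (Oc t)) ** Q t"
      unfolding Om_def linear_add[OF bounded_linear.linear[OF bounded_linear_hat]] matrix_mul_assoc[symmetric]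
        hat_mult_rotation[OF con(3)[OF t]] matrix_add_ldistrib ..
    then show ?thesis
      using bounded_bilinear.has_vector_derivative[OF bounded_bilinear_matrix_mult dRC[OF t] dQ[OF t]] RCO[OF t] by simp
  qed
  have mom: "inertia P *v Om' t + hat (Om t) *v (inertia P *v Om t) = moment P K \<epsilon> (Oc t) (Oc' t) (\<phi> t)" if t: "t \<in> T" for t
  proof -
    have m1: "moment P K \<epsilon> (Oc t) (Oc' t) (\<phi> t) = - ((k_R K / \<epsilon>\<^sup>2) *\<^sub>R ((1/2) *\<^sub>R vee (Q t - transpose (Q t)))) - (k_Om K / \<epsilon>) *\<^sub>R e t
       + cross3 (Om t) (inertia P *v Om t) - inertia P *v (cross3 (Om t) (transpose (Q t) *v Oc t) - transpose (Q t) *v Oc' t)"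
      using Rc\<phi>(1)[OF t] unfolding \<phi> moment_def Om_def[symmetric] Let_def prod.case
      by (simp only: eR[OF t] eO[OF t] QR[OF t] hat_mult)
    have m2: "inertia P *v Om' t = - ((k_R K / \<epsilon>\<^sup>2) *\<^sub>R ((1/2) *\<^sub>R vee (Q t - transpose (Q t))) + (k_Om K / \<epsilon>) *\<^sub>R e t)
       + inertia P *v (transpose (Q t) *v Oc' t - cross3 (Om t) (transpose (Q t) *v Oc t))"
      unfolding Om'_def matrix_vector_right_distrib bounded_bilinear.minus_right[OF bounded_bilinear_matrix_vector] Ji ..
    show ?thesis
      unfolding m1 m2 hat_mult matrix_vector_mult_diff_distrib by (simp add: algebra_simps del: transpose_matrix_vector)
  qed
  have full: "full_dynamics P (\<lambda>t. thrust P K (\<phi> t)) (\<lambda>t. moment P K \<epsilon> (Oc t) (Oc' t) (\<phi> t)) T \<phi>"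
    unfolding full_dynamics_def
  proof (rule exI[of _ x], rule exI[of _ v], rule exI[of _ "\<lambda>t. fst (U t)"], rule exI[of _ q],
      rule exI[of _ "\<lambda>t. \<chi> i. cross3 (w t $ i) (q t $ i)"], rule exI[of _ "\<lambda>t. snd (U t)"], rule exI[of _ w],
      rule exI[of _ "\<lambda>t. RC t ** Q t"], rule exI[of _ Om], rule exI[of _ Om'], rule ballI, intro conjI)
    fix t assume t: "t \<in> T"
    show "\<phi> t = (x t, v t, q t, w t, RC t ** Q t, Om t)" by (simp add: \<phi> Om_def)
    show "\<phi> t \<in> states" by (rule st\<phi>[OF t])
    show "(x has_vector_derivative v t) (at t within T)" "(v has_vector_derivative fst (U t)) (at t within T)"
      "(q has_vector_derivative (\<chi> i. cross3 (w t $ i) (q t $ i))) (at t within T)"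
      "((\<lambda>t. RC t ** Q t) has_vector_derivative (RC t ** Q t) ** hat (Om t)) (at t within T)"
      "(Om has_vector_derivative Om' t) (at t within T)"
      by (fact dx[OF t] dv[OF t] dqv[OF t] dR[OF t] dOm[OF t])+
    show "\<forall>i. (\<chi> i. cross3 (w t $ i) (q t $ i)) $ i = cross3 (w t $ i) (q t $ i)" by simp
    show "((\<lambda>t. \<chi> i. cross3 (w t $ i) (q t $ i)) has_vector_derivative snd (U t)) (at t within T)"
    proof (rule has_vector_derivative_vec)
      fix i
      \<comment> \<open>The derivative of \<open>cross3 w q\<close> consists of the tangential part
        of \<open>q''\<close> and a centripetal part along \<open>q\<close>. By this identity the
        centripetal part is exactly the component of \<open>q''\<close> along the link.\<close>
      have qp: "q t $ i \<bullet> snd (U t) $ i = - (norm (w t $ i))\<^sup>2"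
        using acc_equations(2)[OF lS[OF t, folded lc_def] stL[OF t]] by (simp add: U_def lc[of t])
      have "q t $ i \<bullet> q t $ i = 1" "w t $ i \<bullet> q t $ i = 0" using con(1,2)[OF t, of i] by (simp_all add: norm_eq_1 inner_commute)
      then have "cross3 (w t $ i) (cross3 (w t $ i) (q t $ i)) + cross3 (cross3 (q t $ i) (snd (U t) $ i)) (q t $ i) = snd (U t) $ i"
        using cross_skew[of "cross3 (q t $ i) (snd (U t) $ i)" "q t $ i"]
        by (simp add: Lagrange qp power2_norm_eq_inner)
      then show "((\<lambda>t. (\<chi> i. cross3 (w t $ i) (q t $ i)) $ i) has_vector_derivative snd (U t) $ i) (at t within T)"
        using bounded_bilinear.has_vector_derivative[OF bounded_bilinear_cross3 dw[OF t, of i] dq[OF t, of i]] by simp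
    qed
    have "inertia_op (sq (\<phi> t)) (fst (U t), snd (U t)) = load (\<phi> t)"
      using eqU[OF t] cong(1)[OF t] by (simp add: \<phi>)
    from this[unfolded equations_of_motion[symmetric]]
    show "M00 P *\<^sub>R fst (U t) + (\<Sum>i\<in>UNIV. M0 P i *\<^sub>R snd (U t) $ i)
       = - (thrust P K (\<phi> t) *\<^sub>R ((RC t ** Q t) *v e3)) + (M00 P * gravity P) *\<^sub>R e3"
      and "\<forall>i. Mij P i i *\<^sub>R snd (U t) $ i
           - (hat (q t $ i) ** hat (q t $ i)) *v
               (M0 P i *\<^sub>R fst (U t) + (\<Sum>j\<in>UNIV - {i}. Mij P i j *\<^sub>R snd (U t) $ j))
         = - ((Mij P i i * (norm ((\<chi> i. cross3 (w t $ i) (q t $ i)) $ i))\<^sup>2) *\<^sub>R q t $ i)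
           - Gi P i *\<^sub>R ((hat (q t $ i) ** hat (q t $ i)) *v e3)"
      by (simp_all add: \<phi>)
    show "inertia P *v Om' t + hat (Om t) *v (inertia P *v Om t) = moment P K \<epsilon> (Oc t) (Oc' t) (\<phi> t)" by (rule mom[OF t])
  qed
  have "closed_loop P K \<epsilon> T \<phi>"
    unfolding closed_loop_def
  proof (rule exI[of _ "\<lambda>t. commanded_deriv (heading K) (A t) (dA t)"], rule exI[of _ Oc], rule exI[of _ Oc'],
      rule conjI[OF ballI full], intro conjI)
    fix t assume t: "t \<in> T"
    show "virtual_force P K (\<phi> t) \<noteq> 0" using hA(2)[OF t] by (simp add: virtual_force_eq A\<phi>)
    show "\<not> collinear {0, heading K, b3c P K (\<phi> t)}"
      using hA[OF t] by (simp add: cross_eq_0[symmetric] b3c_def virtual_force_eq A\<phi> cross_mult_right)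
    show "((\<lambda>s. Rc P K (\<phi> s)) has_vector_derivative commanded_deriv (heading K) (A t) (dA t)) (at t within T)"
      by (rule has_vector_derivative_transform[OF t _ dRC[OF t]]) (simp add: Rc\<phi>)
    show "Oc t = vee (transpose (Rc P K (\<phi> t)) ** commanded_deriv (heading K) (A t) (dA t))"
      using OC[OF t] by (simp add: Rc\<phi>(1)[OF t])
    show "(Oc has_vector_derivative Oc' t) (at t within T)" by (rule dO'[OF t])
  qed
  then show "closed_loop P K \<epsilon> T (\<lambda>t. unchart (\<psi> t))" by (simp add: \<phi>_def[abs_def])
  fix t assume t: "t \<in> T"
  have "chart (\<phi> t) = (x t, v t, q t, w t, Q t, e t)"
    using QR(1)[OF t] eO[OF t] Rc\<phi>(1)[OF t] cong(2)[OF t] unfolding chart_def att_def eta_def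
    by (simp add: \<phi> Om_def del: transpose_matrix_vector)
  then show "chart (unchart (\<psi> t)) = \<psi> t" by (simp add: \<phi>_def x_def v_def q_def w_def Q_def e_def)
qed

text \<open>Ensures that the solution started at \<open>chart s\<close> translates into a trajectory
  started at \<open>s\<close>.\<close>

lemma unchart_chart:
  assumes "s \<in> S"
  shows "unchart (chart s) = s"
proof -
  have hA: "cross3 (heading K) (force s) \<noteq> 0" using heading_force[of s] assms c_pos by (auto simp: S_def)
  have f: "force (chart s) = force s" by (rule force_cong) (simp_all add: chart_def)
  have R: "commanded (heading K) (force s) ** att s = sR s"
    using rotation_matrix_inverse(2)[OF rotation_commanded[OF assms]]
    by (simp add: att_def matrix_mul_assoc Rc_commanded[OF assms, symmetric])
  have "omc (lift (chart s)) = omc s"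
  proof (rule omc_cong(3))
    have "force (lift (chart s)) = force s" by (rule force_cong) (simp_all add: chart_def lift_def)
    then show "cross3 (heading K) (force (lift (chart s))) \<noteq> 0" using hA by simp
  qed (simp_all add: lift_def f, simp_all add: chart_def R)
  moreover have "snd (eta s) + transpose (att s) *v omc s = sOm s"
    by (simp add: eta_def e_Om_def att_def matrix_transpose_mul del: transpose_matrix_vector)
  ultimately show ?thesis
    unfolding unchart_def f by (simp add: prod_eq_iff chart_def R del: transpose_matrix_vector)
qed

lemma chart_bound:
  obtains r' C where "0 < r'" "r' \<le> r" "0 < C" "\<And>s. s \<in> states \<Longrightarrow> D s \<le> r' \<Longrightarrow> norm (chart s - origin) \<le> C * D s"
proof (rule coordinates)
  fix r' C :: real
  assume r': "0 < r'" "r' \<le> r" "0 < C"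
    and 1: "\<And>s. s \<in> states \<Longrightarrow> D s \<le> r' \<Longrightarrow> norm (err s) + norm (eta s) \<le> C * D s"
    and 2: "\<And>s. s \<in> states \<Longrightarrow> D s \<le> r' \<Longrightarrow> norm (att s - mat 1) \<le> C * D s"
  show thesis
  proof (rule that[OF r'(1,2)])
    show "0 < 4 + 2 * C" using r'(3) by simp
    fix s assume s: "s \<in> states" "D s \<le> r'"
    have "norm (chart s - origin) \<le> norm (sx s - target K) + norm (sv s) + norm (sq s - (\<chi> i. e3)) + norm (sw s)
        + norm (att s - mat 1) + norm (snd (eta s))"
      using norm_state_components(7)[of "chart s - origin"] by (simp add: chart_def origin_components)
    also have "\<dots> \<le> D s + D s + D s + D s + C * D s + C * D s"
    proof (intro add_mono component_bounds 2 s)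
      show "norm (sq s - (\<chi> i. e3)) \<le> D s" "norm (sw s) \<le> D s"
        using norm_state_components(3,4)[of "s - equilibrium"] by (simp_all add: equilibrium_components)
      show "norm (snd (eta s)) \<le> C * D s"
        using 1[OF s] norm_snd_le[of "snd (eta s)" "fst (eta s)"] norm_ge_zero[of "err s"]
        unfolding prod.collapse by linarith
    qed
    finally show "norm (chart s - origin) \<le> (4 + 2 * C) * D s" by (simp add: algebra_simps)
  qed
qed

text \<open>The decay estimate needs a trajectory, while the solution of the extended equation is
  one only inside the ball of radius \<rho>. A first-exit argument resolves this: before an exit the
  solution is a trajectory, and its decay keeps it within half the radius.\<close>

lemma exponentially_stable_closed_loop:
  assumes "0 < \<epsilon>"
  shows "exponentially_stable states (closed_loop P K \<epsilon>) equilibrium"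
proof (rule trajectory_bound[OF assms])
  fix \<delta> C \<gamma> :: real
  assume \<delta>: "0 < \<delta>" "0 < C" "0 < \<gamma>"
    and bound: "\<And>T \<phi> t. closed_loop P K \<epsilon> T \<phi> \<Longrightarrow> T = {0..} \<or> (\<exists>b>0. T = {0..<b}) \<Longrightarrow> D (\<phi> 0) < \<delta> \<Longrightarrow>
      t \<in> T \<Longrightarrow> D (\<phi> t) \<le> C * D (\<phi> 0) * exp (- \<gamma> * t)"
  obtain r' B where r': "0 < r'" "r' \<le> r" "0 < B" "\<And>s. s \<in> states \<Longrightarrow> D s \<le> r' \<Longrightarrow> norm (chart s - origin) \<le> B * D s"
    by (rule chart_bound) (rule that)
  obtain \<rho> where \<rho>: "0 < \<rho>" "\<rho> \<le> r" "\<And>y. y \<in> cball origin \<rho> \<Longrightarrow> lift y \<in> S" "lip (cball origin \<rho>) (\<lambda>y. acc (lift y))"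
    by (rule chart_ball) (rule that)
  obtain Ji where Ji: "\<And>v. inertia P *v (Ji *v v) = v" "\<And>v. Ji *v (inertia P *v v) = v"
    by (rule inertia_inverse) (rule that)
  \<comment> \<open>Up to distance \<open>h\<close> from the equilibrium, the chart coordinates stay
    within \<rho> / 2 of \<open>origin\<close>.\<close>
  define h where "h = min r' (\<rho> / (2 * B))"
  have h: "0 < h" "h \<le> r'" "B * h \<le> \<rho> / 2" using r' \<rho> by (auto simp: h_def min_def field_simps)
  \<comment> \<open>The decay estimate applies to starts closer than \<open>d\<close>, and its bound
    \<open>C * d\<close> does not exceed \<open>h\<close>.\<close>
  define d where "d = min \<delta> (min h (h / C))"
  have d: "0 < d" "d \<le> \<delta>" "d \<le> h" "C * d \<le> h"
  proof -
    show "0 < d" "d \<le> \<delta>" "d \<le> h" using h \<delta> by (auto simp: d_def)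
    have "d \<le> h / C" by (simp add: d_def)
    then show "C * d \<le> h" using \<delta>(2) by (simp add: pos_le_divide_eq mult.commute)
  qed
  have ex: "\<exists>\<phi>. closed_loop P K \<epsilon> {0..} \<phi> \<and> \<phi> 0 = s" if s: "s \<in> states" "D s < d" for s
  proof -
    have sS: "s \<in> S" using s(2) d h r' by (simp add: S_def)
    obtain \<psi> where \<psi>: "\<psi> 0 = chart s" "\<And>t. 0 \<le> t \<Longrightarrow> \<psi> t \<in> cball origin \<rho> \<Longrightarrow>
        (\<psi> has_vector_derivative field (k_R K / \<epsilon>\<^sup>2) (k_Om K / \<epsilon>) Ji (\<psi> t)) (at t within {0..})" "continuous_on {0..} \<psi>"
      using global_chart_solution[OF lip_field[OF \<rho>(4)] \<rho>(1)] by metis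
    have init: "norm (sq (\<psi> 0) $ i) = 1" "sq (\<psi> 0) $ i \<bullet> sw (\<psi> 0) $ i = 0" "rotation_matrix (sR (\<psi> 0))" for i
    proof -
      show "norm (sq (\<psi> 0) $ i) = 1" "sq (\<psi> 0) $ i \<bullet> sw (\<psi> 0) $ i = 0"
        using s(1) unfolding \<psi>(1) chart_def by (auto simp: states_def)
      have "rotation_matrix (sR s)" using s(1) by (auto simp: states_def)
      then show "rotation_matrix (sR (\<psi> 0))"
        unfolding \<psi>(1) chart_def att_def
        by (simp add: rotation_matrix_mult rotation_matrix_transpose rotation_commanded[OF sS])
    qed
    have loop: "closed_loop P K \<epsilon> T (\<lambda>t. unchart (\<psi> t))" "\<And>t. t \<in> T \<Longrightarrow> chart (unchart (\<psi> t)) = \<psi> t"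
      if T: "T = {0..} \<or> (\<exists>b>0. T = {0..<b})" and ball: "\<And>t. t \<in> T \<Longrightarrow> norm (\<psi> t - origin) < \<rho>" for T
    proof -
      have T0: "T \<subseteq> {0..}" using T by auto
      have cb: "\<psi> t \<in> cball origin \<rho>" if "t \<in> T" for t
        using ball[OF that] by (simp add: dist_norm norm_minus_commute)
      have der: "(\<psi> has_vector_derivative field (k_R K / \<epsilon>\<^sup>2) (k_Om K / \<epsilon>) Ji (\<psi> t)) (at t within T)" if "t \<in> T" for t
        using that T0 by (intro has_vector_derivative_within_subset[OF \<psi>(2)[OF _ cb[OF that]] T0]) auto
      have b: "norm (\<psi> t - origin) \<le> r" if "t \<in> T" for t using ball[OF that] \<rho>(2) by simp
      note cl = closed_loop_of_chart[OF T Ji(1) der b \<rho>(3)[OF cb] init]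
      show "closed_loop P K \<epsilon> T (\<lambda>t. unchart (\<psi> t))" by (rule cl(1))
      show "\<And>t. t \<in> T \<Longrightarrow> chart (unchart (\<psi> t)) = \<psi> t" by (rule cl(2))
    qed
    have \<phi>0: "unchart (\<psi> 0) = s" unfolding \<psi>(1) by (rule unchart_chart[OF sS])
    have small: "norm (\<psi> u - origin) < \<rho>" if "0 \<le> u" for u
    proof (rule trapped[where g="\<lambda>u. norm (\<psi> u - origin)" and k="\<rho> / 2"])
      show "continuous_on {0..u} (\<lambda>u. norm (\<psi> u - origin))"
        by (intro continuous_intros continuous_on_subset[OF \<psi>(3)]) auto
      have "norm (\<psi> 0 - origin) \<le> B * D s" unfolding \<psi>(1) by (rule r'(4)[OF s(1)]) (use s(2) d h in simp)
      also have "\<dots> \<le> B * h" using s(2) d r'(3) by (intro mult_left_mono) auto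
      finally show "norm (\<psi> 0 - origin) < \<rho>" "0 \<le> u" "\<rho> / 2 < \<rho>" using h \<rho>(1) that by auto
      fix b v assume b: "0 < b" "b \<le> u" "\<And>t. t \<in> {0..<b} \<Longrightarrow> norm (\<psi> t - origin) < \<rho>" and v: "v \<in> {0..<b}"
      have T: "{0..<b} = {0..} \<or> (\<exists>b'>0. {0..<b} = {0..<b'})" using b(1) by blast
      have lp: "closed_loop P K \<epsilon> {0..<b} (\<lambda>t. unchart (\<psi> t))" by (rule loop(1)[OF T]) (rule b(3))
      have cv: "chart (unchart (\<psi> v)) = \<psi> v" by (rule loop(2)[OF T _ v]) (rule b(3))
      have "D (unchart (\<psi> v)) \<le> C * D (unchart (\<psi> 0)) * exp (- \<gamma> * v)"
      proof (rule bound[OF lp T _ v])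
        show "D (unchart (\<psi> 0)) < \<delta>" unfolding \<phi>0 using s(2) d(2) by linarith
      qed
      also have "\<dots> \<le> C * d * 1" using \<delta> v s(2) d by (intro mult_mono) (auto simp: \<phi>0)
      finally have Dv: "D (unchart (\<psi> v)) \<le> h" using d(4) by simp
      have "norm (chart (unchart (\<psi> v)) - origin) \<le> B * D (unchart (\<psi> v))"
        by (rule r'(4)[OF continuous_on_trajectory(2)[OF lp v] order_trans[OF Dv h(2)]])
      also have "\<dots> \<le> B * h" using Dv r'(3) by (intro mult_left_mono) auto
      finally show "norm (\<psi> v - origin) \<le> \<rho> / 2" using h(3) cv by simp
    qed
    have "closed_loop P K \<epsilon> {0..} (\<lambda>t. unchart (\<psi> t))" by (rule loop(1)) (use small in auto)
    with \<phi>0 show ?thesis by blast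
  qed
  show ?thesis
    unfolding exponentially_stable_def dist_norm
  proof (intro conjI equilibrium_in_states, rule exI[of _ d], intro conjI d(1), rule exI[of _ C], intro conjI \<delta>(2),
      rule exI[of _ \<gamma>], intro conjI \<delta>(3) ballI impI allI)
    fix s assume s: "s \<in> states" "D s < d"
    show "\<exists>\<phi>. closed_loop P K \<epsilon> {0..} \<phi> \<and> \<phi> 0 = s" by (rule ex[OF s])
    fix T \<phi> t assume T: "T = {0..} \<or> (\<exists>b>0. T = {0..<b})" and cl: "closed_loop P K \<epsilon> T \<phi>" and \<phi>0: "\<phi> 0 = s" and t: "t \<in> T"
    show "D (\<phi> t) \<le> C * D s * exp (- \<gamma> * t)"
      using bound[OF cl T _ t] s(2) d(2) by (simp add: \<phi>0)
  qed
qed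

end

theorem proposition3:
  fixes P :: "'n::{finite,linorder} quadrotor" and K :: "'n controller"
  assumes "mass P > 0"
    and "transpose (inertia P) = inertia P"
    and "\<And>v. v \<noteq> 0 \<Longrightarrow> v \<bullet> (inertia P *v v) > 0"
    and "\<And>i. link_mass P i > 0"
    and "\<And>i. link_length P i > 0"
    and "gravity P > 0"
    and "asymptotically_stable (linearized_dynamics P K) 0"
    and "k_R K > 0"
    and "k_Om K > 0"
    and "norm (heading K) = 1"
    and "\<not> collinear {0, heading K, e3}"
  shows "\<exists>\<epsilon>\<^sub>0>0. \<forall>\<epsilon>. 0 < \<epsilon> \<and> \<epsilon> < \<epsilon>\<^sub>0 \<longrightarrow>
           exponentially_stable states (closed_loop P K \<epsilon>) (desired_equilibrium P K)"
proof -
  interpret quadrotor_chain P K by unfold_locales (fact assms)+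
  show ?thesis
  proof (rule neighbourhood)
    fix r c :: real
    assume "0 < r" "0 < c" "r \<le> 1"
      and "\<And>s u. norm (s - equilibrium) \<le> r \<Longrightarrow> c * norm u \<le> norm (inertia_op (sq s) u)"
      and "\<And>s. norm (s - equilibrium) \<le> r \<Longrightarrow> c \<le> norm (cross3 (heading K) (force s))"
      and "\<And>s. norm (s - equilibrium) \<le> r \<Longrightarrow> c \<le> norm (force s)"
    then interpret quadrotor_ball P K r c by unfold_locales
    \<comment> \<open>The stability result holds for each positive \<epsilon> separately, so any
      positive number may serve as the threshold.\<close>
    show ?thesis
      by (intro exI[of _ 1]) (simp add: exponentially_stable_closed_loop)
  qed
qed

end
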